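(* For real $t>0$ let $n_1=\lfloor\sqrt{t/(2\pi)}\rfloor$ and $g(t)=\sqrt{2\pi}\exp\left(\frac{5}{3t^2}+\frac{\pi}{6t}\right)$. Then $$|\zeta(1+it)|\leq \left|\sum_{n=1}^{n_1}\frac{1}{n^{1+it}}\right|+\frac{g(t)}{t^{1/2}}\left|\sum_{n=1}^{n_1}\frac{1}{n^{-it}}\right|+\mathcal{R}(t),$$ where $$\mathcal{R}(t)=\frac{1}{t^{1/2}}\left(\sqrt{\frac{\pi}{2}}+\frac{g(t)}{2}\right)+\frac{1}{t}\left(9\sqrt{\frac{\pi}{2}}+\frac{g(t)}{\sqrt{\pi(3-2\log 2)}}\right)+\frac{1}{t^{3/2}}\left(\frac{968\pi^{3/2}+242\pi\, g(t)}{700}\right).$$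
   Context: $\zeta$ is the Riemann zeta function; $\log$ is the natural logarithm. *)

theory Defs
  imports "HOL-Complex_Analysis.Complex_Analysis"
begin

text \<open>
  The Riemann zeta function: the analytic continuation of the Dirichlet series to the plane
  without the point 1. The continuation exists and, as the domain is connected, any two choices
  agree on it; the value at the pole 1 is left unspecified.
\<close>

definition is_zeta_continuation :: "(complex \<Rightarrow> complex) \<Rightarrow> bool" where
  "is_zeta_continuation f \<longleftrightarrow>
     f holomorphic_on (- {1}) \<and>
     (\<forall>s. Re s > 1 \<longrightarrow> f s = (\<Sum>n. 1 / of_nat (Suc n) powr s))"

definition zeta :: "complex \<Rightarrow> complex" where
  "zeta = (SOME f. is_zeta_continuation f)"

definition n1 :: "real \<Rightarrow> nat" where
  "n1 t = nat \<lfloor>sqrt (t / (2 * pi))\<rfloor>"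

definition g :: "real \<Rightarrow> real" where
  "g t = sqrt (2 * pi) * exp (5 / (3 * t\<^sup>2) + pi / (6 * t))"

definition R :: "real \<Rightarrow> real" where
  "R t = 1 / t powr (1/2) * (sqrt (pi / 2) + g t / 2)
       + 1 / t * (9 * sqrt (pi / 2) + g t / sqrt (pi * (3 - 2 * ln 2)))
       + 1 / t powr (3/2) * ((968 * pi powr (3/2) + 242 * pi * g t) / 700)"

end

theory Submission
  imports Defs "HOL-Probability.Distributions" "HOL-Real_Asymp.Real_Asymp"
begin

text \<open>
  The proof rests on the Riemann--Siegel integral formula
  \<open>\<zeta>(s) = I(s) + \<chi>(s) \<cdot> cnj (I (1 - cnj s))\<close>, where \<open>I(s)\<close> is the integral of
  \<open>x powr (-s) * exp (\<pi> \<i> x\<^sup>2) / (2 \<i> sin (\<pi> x))\<close> along a line of slope one, traversed downwards and crossing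
  the real axis between \<open>0\<close> and \<open>1\<close>. For real \<open>3 < s < 4\<close> the formula is the Mellin transform of Mordell's
  closed form of the integral of \<open>exp (\<pi> \<i> x\<^sup>2 + 2 \<pi> \<i> x y) / (2 \<i> sin (\<pi> x))\<close> along a ray in \<open>y\<close>; it also
  supplies the continuation of \<open>\<zeta>\<close>, so the identity theorem carries it everywhere.

  Moving the line to the saddle point \<open>a = sqrt (t / (2 \<pi>))\<close> splits off the two sums up to \<open>\<lfloor>a\<rfloor>\<close>.
  On that line the integrand is, up to a constant of modulus one (and a factor \<open>1 / a\<close> when \<open>Re s = 1\<close>),
  \<open>exp (- 2 \<pi> u\<^sup>2) / (2 \<i> sin (\<pi> x))\<close> times a factor that differs from \<open>1\<close> by \<open>O((\<bar>u\<bar> + \<bar>u\<bar>\<^sup>3) / a)\<close>, up to a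
  weaker Gaussian growth. The integral of the Gaussian term has modulus
  at most \<open>1 / 2\<close>: turn the line to the vertical one, where the symmetrised integrand is dominated by an
  explicit kernel of total mass one. In the correction the factor \<open>\<bar>u\<bar>\<close> cancels the possible pole, because
  \<open>\<bar>sin (\<pi> x)\<bar> \<ge> \<pi> \<bar>u\<bar> / sqrt 2\<close>. All these estimates hold for every \<open>t > 0\<close> with \<open>a\<close> not an integer; the remaining
  \<open>t\<close> follow by continuity from the right.
\<close>

section \<open>Gaussian domination and holomorphic parameter integrals\<close>

text \<open>The leading coefficient of \<open>R\<close> shapes the argument. For
  \<open>a = sqrt (t / (2 * pi))\<close> one has
  \<open>1 / (2 * a) = sqrt (pi / 2) / sqrt t\<close>, so the terms of order
  \<open>t powr (- 1 / 2)\<close> in \<open>R\<close> are exactly what the value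
  \<open>1 / 2\<close> for the Gaussian term yields, with nothing to spare. This value has to hold
  uniformly in \<open>a\<close>, although a pole approaches the line when \<open>a\<close> nears an
  integer; a pointwise bound for the cosecant would cost a logarithm of the distance. Hence the
  symmetrisation about \<open>a\<close> comes before any modulus is taken. Only the corrections,
  smaller by a factor \<open>1 / a\<close>, may be estimated crudely, against the coefficients of
  \<open>1 / t\<close>.

  As \<open>zeta\<close> is an arbitrary choice among continuations, one continuation must be
  exhibited first. The formula alone does not provide it, because \<open>Gamma (1 - s)\<close> in
  \<open>chi\<close> has poles at all positive integers; the Dirichlet series fills in
  \<open>2, 3, ...\<close>.

  The window \<open>3 < s < 4\<close>: \<open>s > 2\<close> keeps
  \<open>x powr (s - 1) / sin (pi * x)\<close> bounded at \<open>0\<close>, and for \<open>s\<close>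
  not an integer \<open>sin (pi * s / 2)\<close> and \<open>cos (pi * s / 2)\<close> are nonzero and
  \<open>Gamma (1 - s)\<close> is finite.\<close>

lemma has_bochner_integral_gauss:
  fixes k :: real assumes "k > 0"
  shows "has_bochner_integral lborel (\<lambda>u. exp (- k * u\<^sup>2)) (sqrt (pi / k))"
    and "has_bochner_integral lborel (\<lambda>u. exp (- k * u\<^sup>2) * u\<^sup>2) (sqrt (pi / k) / (2 * k))"
proof -
  have k: "sqrt k \<noteq> 0" "sqrt k > 0" using assms by auto
  have "has_bochner_integral lborel (\<lambda>x::real. exp (- x\<^sup>2)) (2 *\<^sub>R (sqrt pi / 2))"
    by (rule has_bochner_integral_even_function, rule gaussian_moment_0) (simp only: power2_minus)
  hence "has_bochner_integral lborel (\<lambda>x. exp (- (0 + sqrt k * x)\<^sup>2)) ((2 *\<^sub>R (sqrt pi / 2)) /\<^sub>R \<bar>sqrt k\<bar>)"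
    by (subst lborel_has_bochner_integral_real_affine_iff[symmetric, OF k(1)])
  moreover have "(\<lambda>x. exp (- (0 + sqrt k * x)\<^sup>2)) = (\<lambda>u. exp (- k * u\<^sup>2))"
    using assms by (simp add: power_mult_distrib)
  moreover have "(2 *\<^sub>R (sqrt pi / 2)) /\<^sub>R \<bar>sqrt k\<bar> = sqrt (pi / k)"
    using k(2) by (simp add: real_sqrt_divide field_simps)
  ultimately show "has_bochner_integral lborel (\<lambda>u. exp (- k * u\<^sup>2)) (sqrt (pi / k))"
    by simp
  have "has_bochner_integral lborel (\<lambda>x::real. exp (- x\<^sup>2) * x ^ (2 * 1))
          (2 *\<^sub>R (sqrt pi / 2 * (fact (2 * 1) / (2 ^ (2 * 1) * fact 1))))"
    by (rule has_bochner_integral_even_function, rule gaussian_moment_even_pos) (simp add: power2_minus)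
  hence "has_bochner_integral lborel (\<lambda>x. exp (- (0 + sqrt k * x)\<^sup>2) * (0 + sqrt k * x) ^ (2 * 1))
      ((2 *\<^sub>R (sqrt pi / 2 * (fact (2 * 1) / (2 ^ (2 * 1) * fact 1)))) /\<^sub>R \<bar>sqrt k\<bar>)"
    by (subst lborel_has_bochner_integral_real_affine_iff[symmetric, OF k(1)])
  from has_bochner_integral_mult_right[OF this, of "1 / k"]
  have "has_bochner_integral lborel (\<lambda>x. 1 / k * (exp (- (0 + sqrt k * x)\<^sup>2) * (0 + sqrt k * x) ^ (2 * 1)))
      (1 / k * ((2 *\<^sub>R (sqrt pi / 2 * (fact (2 * 1) / (2 ^ (2 * 1) * fact 1)))) /\<^sub>R \<bar>sqrt k\<bar>))"
    by blast
  moreover have "(\<lambda>x. 1 / k * (exp (- (0 + sqrt k * x)\<^sup>2) * (0 + sqrt k * x) ^ (2 * 1))) = (\<lambda>u. exp (- k * u\<^sup>2) * u\<^sup>2)"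
    using assms by (simp add: power_mult_distrib)
  moreover have "1 / k * ((2 *\<^sub>R (sqrt pi / 2 * (fact (2 * 1) / (2 ^ (2 * 1) * fact 1)))) /\<^sub>R \<bar>sqrt k\<bar>) = sqrt (pi / k) / (2 * k)"
    using k assms by (simp add: real_sqrt_divide fact_numeral field_simps)
  ultimately show "has_bochner_integral lborel (\<lambda>u. exp (- k * u\<^sup>2) * u\<^sup>2) (sqrt (pi / k) / (2 * k))"
    by simp
qed

text \<open>The common majorant along lines of slope one: \<open>exp (pi * \<i> * x\<^sup>2)\<close>
  contributes \<open>- pi * u\<^sup>2\<close>, while powers of \<open>x\<close>, exponentials of
  \<open>x\<close> and shifts of the parameter contribute at most a linear term in
  \<open>\<bar>u\<bar>\<close>.\<close>

definition gauss_dom :: "real \<Rightarrow> real \<Rightarrow> real \<Rightarrow> real" where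
  "gauss_dom A L u = exp (A + L * \<bar>u\<bar> - pi * u\<^sup>2)"

lemma gauss_dom_pos: "gauss_dom A L u > 0"
  by (simp add: gauss_dom_def)

lemma gauss_dom_mono: "A \<le> A' \<Longrightarrow> L \<le> L' \<Longrightarrow> gauss_dom A L u \<le> gauss_dom A' L' u"
  by (auto simp: gauss_dom_def intro!: add_mono mult_right_mono)

text \<open>Completing the square spends half of the Gaussian on the linear term.\<close>

lemma gauss_dom_le: "gauss_dom A L u \<le> exp (A + L\<^sup>2 / (2 * pi)) * exp (- (pi / 2) * u\<^sup>2)"
proof -
  have *: "2 * (L / sqrt (2 * pi)) * (sqrt (pi / 2) * \<bar>u\<bar>) = L * \<bar>u\<bar>"
  proof -
    have "sqrt (pi / 2) / sqrt (2 * pi) = 1 / 2"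
      by (simp flip: real_sqrt_divide) (simp add: real_sqrt_divide)
    thus ?thesis by (simp add: field_simps)
  qed
  have "0 \<le> (L / sqrt (2 * pi) - sqrt (pi / 2) * \<bar>u\<bar>)\<^sup>2" by simp
  also have "\<dots> = L\<^sup>2 / (2 * pi) + (pi / 2) * u\<^sup>2 - L * \<bar>u\<bar>"
    unfolding power2_diff * by (simp add: power_divide power_mult_distrib)
  finally show ?thesis
    by (simp add: gauss_dom_def flip: exp_add)
qed

lemma integrable_gauss_dom: "integrable lborel (gauss_dom A L)"
proof (rule Bochner_Integration.integrable_bound)
  show "integrable lborel (\<lambda>u. exp (A + L\<^sup>2 / (2 * pi)) * exp (- (pi / 2) * u\<^sup>2))"
    by (intro integrable_mult_right has_bochner_integral_gauss(1)[THEN integrable.intros]) auto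
  have "continuous_on UNIV (gauss_dom A L)"
    unfolding gauss_dom_def by (intro continuous_intros)
  from borel_measurable_continuous_onI[OF this]
  show "gauss_dom A L \<in> borel_measurable lborel"
    by simp
  show "AE u in lborel. norm (gauss_dom A L u) \<le> norm (exp (A + L\<^sup>2 / (2 * pi)) * exp (- (pi / 2) * u\<^sup>2))"
  proof (rule AE_I2)
    fix u
    show "norm (gauss_dom A L u) \<le> norm (exp (A + L\<^sup>2 / (2 * pi)) * exp (- (pi / 2) * u\<^sup>2))"
      unfolding real_norm_def abs_of_pos[OF gauss_dom_pos]
      by (rule order.trans[OF gauss_dom_le abs_ge_self])
  qed
qed

text \<open>A bound far out suffices, since the maximum over the compact middle can be absorbed into
  the constant. This makes estimates of the cosecant usable that hold only away from the real
  axis.\<close>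

lemma continuous_gauss_dom:
  fixes f :: "real \<Rightarrow> complex"
  assumes cont: "continuous_on UNIV f" and L: "L \<ge> 0"
    and dom: "\<And>u. \<bar>u\<bar> \<ge> T \<Longrightarrow> norm (f u) \<le> gauss_dom A L u"
  obtains A' where "\<And>u. norm (f u) \<le> gauss_dom A' L u"
proof -
  define T' where "T' = max T 0"
  have "compact (f ` {-T'..T'})"
    by (intro compact_continuous_image continuous_on_subset[OF cont]) auto
  then obtain B where "B > 0" and B: "\<And>x. x \<in> f ` {-T'..T'} \<Longrightarrow> norm x \<le> B"
    using bounded_pos compact_imp_bounded by metis
  \<comment> \<open>\<open>ln B\<close> covers the maximum on the middle part, and
    \<open>pi * T'\<^sup>2\<close> makes up for the Gaussian at its ends.\<close>
  show thesis
  proof (rule that[of "max A (ln B + pi * T'\<^sup>2)"])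
    fix u
    show "norm (f u) \<le> gauss_dom (max A (ln B + pi * T'\<^sup>2)) L u"
    proof (cases "\<bar>u\<bar> \<ge> T'")
      case True
      hence "norm (f u) \<le> gauss_dom A L u" by (intro dom) (auto simp: T'_def)
      also have "\<dots> \<le> gauss_dom (max A (ln B + pi * T'\<^sup>2)) L u" by (rule gauss_dom_mono) auto
      finally show ?thesis .
    next
      case False
      hence "u \<in> {-T'..T'}" by auto
      hence "norm (f u) \<le> exp (ln B)" using B \<open>B > 0\<close> by simp
      also have "exp (ln B) \<le> gauss_dom (max A (ln B + pi * T'\<^sup>2)) L u"
      proof -
        have "u\<^sup>2 \<le> T'\<^sup>2" using False by (intro abs_le_square_iff[THEN iffD1]) auto
        hence "pi * u\<^sup>2 \<le> pi * T'\<^sup>2" by simp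
        moreover have "0 \<le> L * \<bar>u\<bar>" using L by simp
        ultimately show ?thesis
          unfolding gauss_dom_def exp_le_cancel_iff by linarith
      qed
      finally show ?thesis .
    qed
  qed
qed

lemma gauss_dom_integrable:
  fixes f :: "real \<Rightarrow> complex"
  assumes "continuous_on UNIV f" "\<And>u. norm (f u) \<le> gauss_dom A L u"
  shows "integrable lborel f"
proof (rule Bochner_Integration.integrable_bound[OF integrable_gauss_dom[of A L]])
  show "f \<in> borel_measurable lborel"
    using borel_measurable_continuous_onI[OF assms(1)] by simp
  show "AE u in lborel. norm (f u) \<le> norm (gauss_dom A L u)"
  proof (rule AE_I2)
    fix u show "norm (f u) \<le> norm (gauss_dom A L u)"
      unfolding real_norm_def by (rule order.trans[OF assms(2) abs_ge_self])
  qed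
qed

lemma gauss_dom_mult:
  assumes "norm x \<le> exp (A + L * \<bar>u\<bar>)" "norm (y::complex) \<le> gauss_dom A' L' u"
  shows "norm (x * y) \<le> gauss_dom (A + A') (L + L') u"
proof -
  have "norm (x * y) \<le> exp (A + L * \<bar>u\<bar>) * gauss_dom A' L' u"
    unfolding norm_mult by (intro mult_mono assms) auto
  thus ?thesis by (simp add: gauss_dom_def algebra_simps flip: exp_add)
qed

section \<open>Truncated integrals and integrals depending on a complex parameter\<close>

lemma integral_norm_tail_tendsto_0:
  fixes g :: "real \<Rightarrow> real"
  assumes g: "integrable lborel g"
  shows "(\<lambda>n::nat. LBINT u. indicator (- {-real n..real n}) u * g u) \<longlonglongrightarrow> 0"
proof -
  have [measurable]: "g \<in> borel_measurable lborel" using g by simp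
  have "(\<lambda>n::nat. LBINT u. indicator (- {-real n..real n}) u * g u) \<longlonglongrightarrow> (LBINT u::real. 0)"
  proof (rule integral_dominated_convergence[where w = "\<lambda>u. \<bar>g u\<bar>"])
    show "AE u in lborel. (\<lambda>n. indicator (- {-real n..real n}) u * g u) \<longlonglongrightarrow> 0"
    proof (intro AE_I2 tendsto_eventually)
      fix u :: real
      show "eventually (\<lambda>n. indicator (- {-real n..real n}) u * g u = 0) sequentially"
        using eventually_ge_at_top[of "nat \<lceil>\<bar>u\<bar>\<rceil>"]
      proof eventually_elim
        case (elim n)
        hence "\<bar>u\<bar> \<le> real n" by linarith
        thus ?case by (auto simp: indicator_def abs_le_iff)
      qed
    qed
    show "AE u in lborel. norm (indicator (- {-real n..real n}) u * g u) \<le> \<bar>g u\<bar>" for n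
      by (intro AE_I2) (simp add: indicator_def)
    show "integrable lborel (\<lambda>u. \<bar>g u\<bar>)" using g by simp
  qed simp_all
  thus ?thesis by simp
qed

text \<open>The error is controlled by a tail of the majorant alone, hence uniformly over all
  \<open>f\<close> below \<open>g\<close>. For integrals with a parameter this yields locally
  uniform convergence.\<close>

lemma integral_trunc_bound:
  fixes f :: "real \<Rightarrow> complex" and g :: "real \<Rightarrow> real"
  assumes f: "integrable lborel f" and g: "integrable lborel g" and fg: "\<And>u. norm (f u) \<le> g u"
  shows "norm (integral {-real n..real n} f - (LBINT u. f u)) \<le> (LBINT u. indicator (- {-real n..real n}) u * g u)"
proof -
  have *: "set_integrable lborel {-real n..real n} f"
    using f unfolding set_integrable_def by (intro integrable_mult_indicator) auto
  have "integral {-real n..real n} f = (LINT u:{-real n..real n}|lborel. f u)"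
    using set_borel_integral_eq_integral(2)[OF *] by simp
  also have "\<dots> - (LBINT u. f u) = (LBINT u. indicator {-real n..real n} u *\<^sub>R f u - f u)"
    using f * unfolding set_lebesgue_integral_def set_integrable_def by simp
  also have "norm \<dots> \<le> (LBINT u. indicator (- {-real n..real n}) u * g u)"
  proof (rule Bochner_Integration.integral_norm_bound_integral)
    show "complex_integrable lborel (\<lambda>u. indicator {-real n..real n} u *\<^sub>R f u - f u)"
      using f * by (auto simp: set_integrable_def)
    have "set_integrable lborel (- {-real n..real n}) g"
      using g unfolding set_integrable_def by (intro integrable_mult_indicator) auto
    thus "integrable lborel (\<lambda>u. indicator (- {-real n..real n}) u * g u)"
      by (simp add: set_integrable_def)
    fix u show "norm (indicator {-real n..real n} u *\<^sub>R f u - f u) \<le> indicator (- {-real n..real n}) u * g u"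
      using fg[of u] by (simp add: indicator_def)
  qed
  finally show ?thesis .
qed

lemma integral_trunc_tendsto:
  fixes f :: "real \<Rightarrow> complex"
  assumes f: "integrable lborel f"
  shows "(\<lambda>n::nat. integral {-real n..real n} f) \<longlonglongrightarrow> (LBINT u. f u)"
proof -
  have "integrable lborel (\<lambda>u. norm (f u))" using f by (rule integrable_norm)
  from Lim_null_comparison[OF always_eventually[OF allI] integral_norm_tail_tendsto_0[OF this],
      OF integral_trunc_bound[OF f this order.refl]]
  have "(\<lambda>n::nat. integral {-real n..real n} f - (LBINT u. f u)) \<longlonglongrightarrow> 0" .
  thus ?thesis by (rule LIM_zero_cancel)
qed

text \<open>The truncated integrals are holomorphic by the Leibniz rule on compact intervals, and
  they converge locally uniformly because one majorant serves a whole neighbourhood. So domination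
  is asked of \<open>f\<close>, and only continuity of \<open>f'\<close>.\<close>

lemma holomorphic_on_lborel_integral:
  fixes f :: "complex \<Rightarrow> real \<Rightarrow> complex"
  assumes U: "open U"
    and deriv: "\<And>z u. z \<in> U \<Longrightarrow> ((\<lambda>z. f z u) has_field_derivative f' z u) (at z)"
    and cont: "continuous_on (U \<times> UNIV) (\<lambda>(z, u). f z u)"
    and cont': "continuous_on (U \<times> UNIV) (\<lambda>(z, u). f' z u)"
    and dom: "\<And>z. z \<in> U \<Longrightarrow> \<exists>r>0. \<exists>g. integrable lborel g \<and> (\<forall>w\<in>cball z r \<inter> U. \<forall>u. norm (f w u) \<le> g u)"
  shows "(\<lambda>z. LBINT u. f z u) holomorphic_on U"
proof -
  have contz: "continuous_on UNIV (f z)" if "z \<in> U" for z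
  proof -
    have "continuous_on UNIV ((\<lambda>(z, u). f z u) \<circ> (\<lambda>u. (z, u)))"
      by (intro continuous_on_compose continuous_intros continuous_on_subset[OF cont]) (use that in auto)
    thus ?thesis by (simp add: o_def)
  qed
  have int: "integrable lborel (f z)" if z: "z \<in> U" for z
  proof -
    obtain r g where r: "r > 0" and g: "integrable lborel g"
      and gb: "\<forall>w\<in>cball z r \<inter> U. \<forall>u. norm (f w u) \<le> g u"
      using dom[OF z] by blast
    have "z \<in> cball z r \<inter> U" using z r by simp
    hence gz: "norm (f z u) \<le> g u" for u using gb by blast
    show ?thesis
    proof (rule Bochner_Integration.integrable_bound[OF g])
      show "f z \<in> borel_measurable lborel"
        using borel_measurable_continuous_onI[OF contz[OF z]] by simp
      show "AE u in lborel. norm (f z u) \<le> norm (g u)"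
        unfolding real_norm_def by (intro AE_I2 order.trans[OF gz abs_ge_self])
    qed
  qed
  define F where "F = (\<lambda>(n::nat) z. integral (cbox (-real n) (real n)) (f z))"
  have Fhol: "F n holomorphic_on U" for n
  proof -
    have "(F n) holomorphic_on ball z r" if "ball z r \<subseteq> U" for z r
      unfolding F_def
    proof (rule leibniz_rule_holomorphic[where fx = f'])
      fix x t assume "x \<in> ball z r"
      thus "((\<lambda>x. f x t) has_field_derivative f' x t) (at x within ball z r)"
        using deriv that has_field_derivative_at_within by blast
    next
      fix x assume "x \<in> ball z r"
      thus "f x integrable_on cbox (-real n) (real n)"
        using contz that by (intro integrable_continuous continuous_on_subset[OF contz]) auto
    next
      show "continuous_on (ball z r \<times> cbox (- real n) (real n)) (\<lambda>(x, t). f' x t)"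
        by (rule continuous_on_subset[OF cont']) (use that in auto)
    qed auto
    hence "\<exists>r>0. F n holomorphic_on ball z r" if "z \<in> U" for z
      using openE[OF U that] by metis
    thus ?thesis
      by (meson U analytic_on_def analytic_on_open)
  qed
  show ?thesis
  proof (rule holomorphic_uniform_sequence[OF U Fhol])
    fix z assume z: "z \<in> U"
    obtain r g where r: "r > 0" "integrable lborel g" and g: "\<And>w u. w \<in> cball z r \<inter> U \<Longrightarrow> norm (f w u) \<le> g u"
      using dom[OF z] by blast
    obtain e where e: "e > 0" "cball z e \<subseteq> U" using open_contains_cball U z by blast
    define d where "d = min r e"
    have d: "d > 0" "cball z d \<subseteq> U" "cball z d \<subseteq> cball z r" using r e by (auto simp: d_def)
    have [measurable]: "g \<in> borel_measurable lborel" using r by simp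
    have est: "norm (F n w - (LBINT u. f w u)) \<le> (LBINT u. indicator (- {-real n..real n}) u * g u)"
      if w: "w \<in> cball z d" for n w
    proof -
      have "w \<in> U" "w \<in> cball z r \<inter> U" using w d(2,3) by blast+
      hence "w \<in> U" "\<And>u. norm (f w u) \<le> g u" using g by blast+
      thus ?thesis
        unfolding F_def cbox_interval by (intro integral_trunc_bound int r(2))
    qed
    have "uniform_limit (cball z d) F (\<lambda>z. LBINT u. f z u) sequentially"
    proof (rule uniform_limitI)
      fix e :: real assume "e > 0"
      with integral_norm_tail_tendsto_0[OF r(2)]
      have "eventually (\<lambda>n. (LBINT u. indicator (- {-real n..real n}) u * g u) < e) sequentially"
        by (rule order_tendstoD(2))
      thus "\<forall>\<^sub>F n in sequentially. \<forall>w\<in>cball z d. dist (F n w) (LBINT u. f w u) < e"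
        by eventually_elim (auto simp: dist_norm intro: le_less_trans[OF est])
    qed
    with d show "\<exists>d>0. cball z d \<subseteq> U \<and> uniform_limit (cball z d) F (\<lambda>z. LBINT u. f z u) sequentially"
      by blast
  qed
qed

section \<open>Lines of slope one\<close>

lemma gauss_dom_tendsto_0: "(\<lambda>n::nat. gauss_dom A L (real n)) \<longlonglongrightarrow> 0"
proof (rule Lim_null_comparison)
  show "\<forall>\<^sub>F n in sequentially. norm (gauss_dom A L (real n)) \<le> exp (A + L\<^sup>2 / (2 * pi)) * exp (- (pi / 2) * (real n)\<^sup>2)"
    unfolding real_norm_def abs_of_pos[OF gauss_dom_pos] by (intro always_eventually allI gauss_dom_le)
  have "(\<lambda>n::nat. exp (- (pi / 2) * (real n)\<^sup>2)) \<longlonglongrightarrow> 0"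
    by real_asymp
  thus "(\<lambda>n::nat. exp (A + L\<^sup>2 / (2 * pi)) * exp (- (pi / 2) * (real n)\<^sup>2)) \<longlonglongrightarrow> 0"
    by (rule tendsto_mult_right_zero)
qed

lemma contour_integral_linepath_affine:
  fixes c d :: complex and a b :: real
  assumes "a < b"
  shows "contour_integral (linepath (c + d * of_real a) (c + d * of_real b)) f
       = d * integral {a..b} (\<lambda>x. f (c + d * of_real x))"
proof -
  have "contour_integral (linepath (c + d * of_real a) (c + d * of_real b)) f
      = (c + d * of_real b - (c + d * of_real a)) * integral {0..1} (\<lambda>x. f (linepath (c + d * of_real a) (c + d * of_real b) x))"
    by (simp add: contour_integral_integral)
  also have "(\<lambda>x. f (linepath (c + d * of_real a) (c + d * of_real b) x)) = (\<lambda>x. f (c + d * linepath (of_real a) (of_real b) x))"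
    by (simp add: linepath_def scaleR_conv_of_real algebra_simps)
  also have "(c + d * of_real b - (c + d * of_real a)) * integral {0..1} \<dots>
      = d * ((of_real b - of_real a) * integral {0..1} (\<lambda>x. f (c + d * linepath (of_real a) (of_real b) x)))"
    by (simp add: algebra_simps)
  also have "(of_real b - of_real a) * integral {0..1} (\<lambda>x. f (c + d * linepath (of_real a) (of_real b) x))
      = contour_integral (linepath (of_real a) (of_real b)) (\<lambda>w. f (c + d * w))"
    by (simp add: contour_integral_integral)
  also have "\<dots> = integral {a..b} (\<lambda>x. f (c + d * of_real x))"
    using assms by (subst contour_integral_linepath_Reals_eq) auto
  finally show ?thesis .
qed

text \<open>The residue theorem on rectangles of width \<open>2 * n\<close>, where the Gaussian
  bound kills the vertical sides as \<open>n\<close> grows. The bound is asked only for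
  \<open>\<bar>u\<bar> \<ge> T\<close>, since there are poles between the two lines.\<close>

lemma residue_strip:
  fixes F :: "complex \<Rightarrow> complex"
  assumes h: "h1 < h2" and e: "e > 0" and pts: "finite pts" "\<And>p. p \<in> pts \<Longrightarrow> h1 < Im p \<and> Im p < h2"
    and holo: "F holomorphic_on {z. h1 - e < Im z \<and> Im z < h2 + e} - pts"
    and dom: "\<And>u h. h1 \<le> h \<Longrightarrow> h \<le> h2 \<Longrightarrow> \<bar>u\<bar> \<ge> T \<Longrightarrow> norm (F (Complex u h)) \<le> gauss_dom A L u"
    and int: "integrable lborel (\<lambda>u. F (Complex u h1))" "integrable lborel (\<lambda>u. F (Complex u h2))"
  shows "(LBINT u. F (Complex u h1)) - (LBINT u. F (Complex u h2)) = 2 * pi * \<i> * (\<Sum>p\<in>pts. residue F p)"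
proof -
  define S where "S = {z. h1 - e < Im z \<and> Im z < h2 + e}"
  let ?seg = "\<lambda>r. closed_segment (Complex r h1) (Complex r h2)"
  have S: "open S" "convex S"
  proof -
    have *: "S = {z. h1 - e < Im z} \<inter> {z. Im z < h2 + e}" by (auto simp: S_def)
    show "open S" unfolding * by (intro open_Int open_halfspace_Im_lt open_halfspace_Im_gt)
    show "convex S" unfolding * by (intro convex_Int convex_halfspace_Im_lt convex_halfspace_Im_gt)
  qed
  define side where "side = (\<lambda>r. contour_integral (linepath (Complex r h1) (Complex r h2)) F)"
  \<comment> \<open>Once \<open>n > M\<close>, the rectangle encloses all poles and its vertical
    sides miss them.\<close>
  obtain M where M: "\<And>p. p \<in> pts \<Longrightarrow> \<bar>Re p\<bar> \<le> M"
  proof -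
    have "finite ((\<lambda>p. \<bar>Re p\<bar>) ` pts)" using pts by simp
    hence "\<bar>Re p\<bar> \<le> Max ((\<lambda>p. \<bar>Re p\<bar>) ` pts)" if "p \<in> pts" for p
      using that by (intro Max_ge) auto
    thus thesis by (rule that)
  qed
  have side_bound: "norm (side r) \<le> gauss_dom A L \<bar>r\<bar> * (h2 - h1)"
    and side_cint: "F contour_integrable_on (linepath (Complex r h1) (Complex r h2))"
    if r: "\<bar>r\<bar> \<ge> T" "\<bar>r\<bar> > M" for r
  proof -
    have seg: "\<exists>h. h1 \<le> h \<and> h \<le> h2 \<and> x = Complex r h"
      if "x \<in> ?seg r" for x
      using that h closed_segment_same_Re[of "Complex r h1" "Complex r h2"]
      by (intro exI[of _ "Im x"]) (auto simp: complex_eq_iff closed_segment_eq_real_ivl)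
    have "?seg r \<subseteq> S - pts"
    proof
      fix x assume "x \<in> ?seg r"
      then obtain h where hh: "h1 \<le> h" "h \<le> h2" "x = Complex r h" using seg by blast
      hence "x \<notin> pts" using M[of x] r by auto
      thus "x \<in> S - pts" using hh e by (auto simp: S_def)
    qed
    hence "continuous_on (?seg r) F"
      using continuous_on_subset[OF holomorphic_on_imp_continuous_on[OF holo[folded S_def]]] by blast
    thus ci: "F contour_integrable_on (linepath (Complex r h1) (Complex r h2))"
      by (rule contour_integrable_continuous_linepath)
    have "norm (side r) \<le> gauss_dom A L \<bar>r\<bar> * norm (Complex r h2 - Complex r h1)"
      unfolding side_def
    proof (rule contour_integral_bound_linepath[OF ci])
      show "0 \<le> gauss_dom A L \<bar>r\<bar>" using gauss_dom_pos less_imp_le by blast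
      fix x assume "x \<in> ?seg r"
      then obtain h where hh: "h1 \<le> h" "h \<le> h2" "x = Complex r h" using seg by blast
      have "norm (F x) \<le> gauss_dom A L r" unfolding hh using hh r by (intro dom) auto
      thus "norm (F x) \<le> gauss_dom A L \<bar>r\<bar>" by (simp add: gauss_dom_def)
    qed
    also have "norm (Complex r h2 - Complex r h1) = h2 - h1"
      using h by (simp add: cmod_def)
    finally show "norm (side r) \<le> gauss_dom A L \<bar>r\<bar> * (h2 - h1)" .
  qed
  have hor_cint: "F contour_integrable_on (linepath (Complex a h) (Complex b h))"
    if "h = h1 \<or> h = h2" for a b h
  proof -
    have "closed_segment (Complex a h) (Complex b h) \<subseteq> S - pts"
    proof
      fix x assume "x \<in> closed_segment (Complex a h) (Complex b h)"
      hence "Im x = h" using closed_segment_same_Im[of "Complex a h" "Complex b h"] by auto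
      thus "x \<in> S - pts" using pts(2)[of x] that e h by (auto simp: S_def)
    qed
    thus ?thesis
      using continuous_on_subset[OF holomorphic_on_imp_continuous_on[OF holo[folded S_def]]]
      by (intro contour_integrable_continuous_linepath) blast
  qed
  let ?I = "\<lambda>n h. integral {-real n..real n} (\<lambda>u. F (Complex u h))"
  have main: "?I n h1 - ?I n h2
      + (side (real n) - side (- real n)) = 2 * pi * \<i> * (\<Sum>p\<in>pts. residue F p)"
    if n: "real n > M" "real n \<ge> T" "n > 0" for n
  proof -
    define a1 a2 a3 a4 where "a1 = Complex (-real n) h1" "a2 = Complex (real n) h1"
      "a3 = Complex (real n) h2" "a4 = Complex (-real n) h2"
    note a = a1_a2_a3_a4_def
    have le: "Re a1 \<le> Re a3" "Im a1 \<le> Im a3" using h by (auto simp: a)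
    have path: "path_image (rectpath a1 a3) \<subseteq> S - pts"
    proof -
      have "p \<in> box a1 a3" if "p \<in> pts" for p
        using pts(2)[OF that] M[OF that] n by (auto simp: in_box_complex_iff a)
      moreover have "cbox a1 a3 \<subseteq> S" using e by (auto simp: in_cbox_complex_iff a S_def)
      ultimately show ?thesis
        unfolding path_image_rectpath_cbox_minus_box[OF le] by blast
    qed
    have "contour_integral (rectpath a1 a3) F = 2 * pi * \<i> * (\<Sum>p\<in>pts. winding_number (rectpath a1 a3) p * residue F p)"
    proof (rule Residue_theorem[OF S(1) convex_connected[OF S(2)] pts(1) holo[folded S_def]])
      show "\<forall>z. z \<notin> S \<longrightarrow> winding_number (rectpath a1 a3) z = 0"
        using path by (auto intro!: winding_number_zero_outside[OF _ S(2)])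
    qed (use path in auto)
    also have "(\<Sum>p\<in>pts. winding_number (rectpath a1 a3) p * residue F p) = (\<Sum>p\<in>pts. residue F p)"
    proof (rule sum.cong[OF refl])
      fix p assume p: "p \<in> pts"
      have "p \<in> box a1 a3"
        using pts(2)[OF p] M[OF p] n by (auto simp: in_box_complex_iff a)
      thus "winding_number (rectpath a1 a3) p * residue F p = residue F p"
        by (simp add: winding_number_rectpath)
    qed
    finally have 1: "contour_integral (rectpath a1 a3) F = 2 * pi * \<i> * (\<Sum>p\<in>pts. residue F p)" .
    have rp: "rectpath a1 a3 = linepath a1 a2 +++ linepath a2 a3 +++ linepath a3 a4 +++ linepath a4 a1"
      by (simp add: rectpath_def a Let_def)
    have ci: "F contour_integrable_on linepath a1 a2" "F contour_integrable_on linepath a2 a3"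
      "F contour_integrable_on linepath a3 a4" "F contour_integrable_on linepath a4 a1"
    proof -
      show "F contour_integrable_on linepath a1 a2" "F contour_integrable_on linepath a3 a4"
        by (auto simp: a intro!: hor_cint)
      show "F contour_integrable_on linepath a2 a3"
        unfolding a using n by (intro side_cint) auto
      have "F contour_integrable_on linepath a1 a4" unfolding a using n by (intro side_cint) auto
      thus "F contour_integrable_on linepath a4 a1"
        using contour_integrable_reversepath[of "linepath a1 a4"] by simp
    qed
    have "contour_integral (rectpath a1 a3) F = contour_integral (linepath a1 a2) F +
      (contour_integral (linepath a2 a3) F + (contour_integral (linepath a3 a4) F + contour_integral (linepath a4 a1) F))"
      unfolding rp using ci by simp
    also have "contour_integral (linepath a1 a2) F = ?I n h1"
      using contour_integral_linepath_affine[of "- real n" "real n" "\<i> * h1" 1 F] n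
      by (simp add: a Complex_eq add_ac)
    also have "contour_integral (linepath a3 a4) F = - contour_integral (linepath a4 a3) F"
      by (metis contour_integral_reversepath reversepath_linepath valid_path_linepath)
    also have "contour_integral (linepath a4 a3) F = ?I n h2"
      using contour_integral_linepath_affine[of "- real n" "real n" "\<i> * h2" 1 F] n
      by (simp add: a Complex_eq add_ac)
    also have "contour_integral (linepath a4 a1) F = - contour_integral (linepath a1 a4) F"
      by (metis contour_integral_reversepath reversepath_linepath valid_path_linepath)
    also have "contour_integral (linepath a1 a4) F = side (- real n)" by (simp add: side_def a)
    also have "contour_integral (linepath a2 a3) F = side (real n)" by (simp add: side_def a)
    finally show ?thesis using 1 by simp
  qed
  have side0: "(\<lambda>n. side (real n) - side (- real n)) \<longlonglongrightarrow> 0"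
  proof (rule Lim_null_comparison)
    have "eventually (\<lambda>n. real n > M) sequentially" "eventually (\<lambda>n. real n \<ge> T) sequentially"
      by real_asymp+
    thus "\<forall>\<^sub>F n in sequentially. norm (side (real n) - side (- real n)) \<le> 2 * (gauss_dom A L (real n) * (h2 - h1))"
    proof eventually_elim
      case (elim n)
      show ?case using side_bound[of "real n"] side_bound[of "- real n"] elim
          norm_triangle_ineq4[of "side (real n)" "side (- real n)"] by simp
    qed
    show "(\<lambda>n. 2 * (gauss_dom A L (real n) * (h2 - h1))) \<longlonglongrightarrow> 0"
      by (intro tendsto_mult_right_zero tendsto_mult_left_zero gauss_dom_tendsto_0)
  qed
  have "(\<lambda>n. ?I n h1 - ?I n h2
      + (side (real n) - side (- real n))) \<longlonglongrightarrow> (LBINT u. F (Complex u h1)) - (LBINT u. F (Complex u h2)) + 0"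
    by (intro tendsto_add tendsto_diff integral_trunc_tendsto int side0)
  moreover have "(\<lambda>n. ?I n h1 - ?I n h2
      + (side (real n) - side (- real n))) \<longlonglongrightarrow> 2 * pi * \<i> * (\<Sum>p\<in>pts. residue F p)"
  proof (rule tendsto_eventually)
    have "eventually (\<lambda>n. real n > M) sequentially" "eventually (\<lambda>n. real n \<ge> T) sequentially"
      "eventually (\<lambda>n::nat. n > 0) sequentially"
      by real_asymp+
    thus "\<forall>\<^sub>F n in sequentially. ?I n h1 - ?I n h2
      + (side (real n) - side (- real n)) = 2 * pi * \<i> * (\<Sum>p\<in>pts. residue F p)"
      by eventually_elim (rule main)
  qed
  ultimately show ?thesis
    using LIMSEQ_unique by fastforce
qed

section \<open>Geometry of a single line and lower bounds for the sine\<close>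

definition omega :: complex ("\<omega>") where "\<omega> = cis (pi / 4)"

definition line :: "real \<Rightarrow> real \<Rightarrow> complex" where
  "line c u = of_real c + \<omega> * of_real u"

lemma omega_Complex: "\<omega> = Complex (1 / sqrt 2) (1 / sqrt 2)"
  by (simp add: omega_def complex_eq_iff cos_45 sin_45 real_div_sqrt)

lemma omega_nz [simp]: "\<omega> \<noteq> 0"
  by (simp add: omega_def)

lemma norm_omega [simp]: "norm \<omega> = 1"
  by (simp add: omega_def)

lemma omega_power2: "\<omega>\<^sup>2 = \<i>"
  by (simp add: omega_def Complex.DeMoivre complex_eq_iff)

lemma omega_mult_cnj: "\<omega> * cnj \<omega> = 1" "cnj \<omega> * \<omega> = 1"
  by (simp_all add: omega_def cis_cnj cis_mult)

lemma Re_Im_line: "Re (line c u) = c + u / sqrt 2" "Im (line c u) = u / sqrt 2"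
  by (simp_all add: line_def omega_Complex)

lemma continuous_on_line [continuous_intros]:
  "continuous_on S p \<Longrightarrow> continuous_on S q \<Longrightarrow> continuous_on S (\<lambda>x. line (p x) (q x))"
  unfolding line_def by (intro continuous_intros)

text \<open>Source of the lower bounds for the sine: the \<open>sinh\<close> part gives growth away
  from the real axis, the \<open>sin\<close> part measures the distance from the zeros along
  it.\<close>

lemma norm_sin_sq_eq: "(norm (sin z))\<^sup>2 = (sin (Re z))\<^sup>2 + (sinh (Im z))\<^sup>2" for z :: complex
proof -
  have "cos (2 * Re z) = 1 - 2 * (sin (Re z))\<^sup>2" by (rule cos_double_sin)
  moreover have "(sinh (Im z))\<^sup>2 = (exp (2 * Im z) + inverse (exp (2 * Im z)) - 2) / 4"
    by (simp add: sinh_def power2_eq_square algebra_simps flip: exp_minus exp_add)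
  ultimately show ?thesis unfolding norm_sin_squared by simp
qed

lemma abs_le_abs_sinh: "\<bar>y\<bar> \<le> \<bar>sinh y\<bar>" for y :: real
  using real_le_abs_sinh[of y] by (simp add: sinh_def exp_minus)

lemma norm_sin_ge_Im: "norm (sin z) \<ge> \<bar>Im z\<bar>" for z :: complex
proof -
  have "\<bar>Im z\<bar>\<^sup>2 \<le> \<bar>sinh (Im z)\<bar>\<^sup>2" by (intro power_mono abs_le_abs_sinh) auto
  also have "\<dots> \<le> (norm (sin z))\<^sup>2" by (simp add: norm_sin_sq_eq)
  finally show ?thesis by (rule power2_le_imp_le) auto
qed

lemma sin_pi_line_nz: "c \<notin> \<int> \<Longrightarrow> sin (of_real pi * line c u) \<noteq> 0"
proof
  assume c: "c \<notin> \<int>" and "sin (of_real pi * line c u) = 0"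
  then obtain n :: int where "of_real pi * line c u = of_real (n * pi)" by (auto simp: sin_eq_0)
  hence "of_real pi * line c u = of_real pi * of_int n" by simp
  hence "line c u = of_int n" by simp
  hence "Re (line c u) = of_int n" "Im (line c u) = 0" by simp_all
  hence "c = of_int n" by (simp add: Re_Im_line)
  thus False using c by simp
qed

text \<open>The factor \<open>\<omega>\<close> is \<open>dx / du\<close>, so the line is traversed
  upwards; the downward orientation of the Riemann-Siegel integral appears as the sign in
  \<open>RSI\<close>.\<close>

definition line_integral :: "(complex \<Rightarrow> complex) \<Rightarrow> real \<Rightarrow> complex" where
  "line_integral f c = \<omega> * (LBINT u. f (line c u))"

lemma norm_csc_line_le:
  assumes "\<bar>u\<bar> \<ge> 1"
  shows "norm (x / (2 * \<i> * sin (of_real pi * line c u))) \<le> norm x"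
proof -
  have s: "sqrt 2 \<le> 2" by (rule real_le_lsqrt) auto
  have "1 \<le> 2 * (pi * \<bar>u\<bar> / sqrt 2)"
  proof -
    have "2 * 1 \<le> 2 * (pi * \<bar>u\<bar>)" using assms pi_gt3 mult_mono[of 1 pi 1 "\<bar>u\<bar>"] by simp
    thus ?thesis using s by (simp add: field_simps)
  qed
  also have "pi * \<bar>u\<bar> / sqrt 2 = \<bar>Im (of_real pi * line c u)\<bar>" by (simp add: Re_Im_line abs_mult)
  also have "\<dots> \<le> norm (sin (of_real pi * line c u))" by (rule norm_sin_ge_Im)
  finally have "1 \<le> norm (2 * \<i> * sin (of_real pi * line c u))" by (simp add: norm_mult)
  hence "norm x / norm (2 * \<i> * sin (of_real pi * line c u)) \<le> norm x / 1"
    by (intro divide_left_mono) auto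
  thus ?thesis unfolding norm_divide by simp
qed

lemma csc_line_gauss:
  assumes c: "c \<notin> \<int>" and L: "L \<ge> 0" and cont: "continuous_on UNIV (\<lambda>u. h (line c u))"
    and dom: "\<And>u. norm (h (line c u)) \<le> gauss_dom A L u"
  shows "integrable lborel (\<lambda>u. h (line c u) / (2 * \<i> * sin (of_real pi * line c u)))"
proof -
  have ct: "continuous_on UNIV (\<lambda>u. h (line c u) / (2 * \<i> * sin (of_real pi * line c u)))"
    using sin_pi_line_nz[OF c] by (intro continuous_intros cont) auto
  have "norm (h (line c u) / (2 * \<i> * sin (of_real pi * line c u))) \<le> gauss_dom A L u" if "\<bar>u\<bar> \<ge> 1" for u
    using norm_csc_line_le[OF that] dom order.trans by blast
  then obtain A' where "\<And>u. norm (h (line c u) / (2 * \<i> * sin (of_real pi * line c u))) \<le> gauss_dom A' L u"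
    using continuous_gauss_dom[OF ct L] by blast
  thus ?thesis by (rule gauss_dom_integrable[OF ct])
qed

text \<open>Needed because turning the plane moves the parameter on the line through
  \<open>c\<close> by \<open>c / sqrt 2\<close>.\<close>

lemma gauss_dom_shift:
  assumes "\<bar>k\<bar> \<le> K" "L \<ge> 0"
  shows "gauss_dom A L (u - k) \<le> gauss_dom (A + L * K) (L + 2 * pi * K) u"
proof -
  have "L * \<bar>u - k\<bar> \<le> L * (\<bar>u\<bar> + K)" using assms by (intro mult_left_mono) auto
  moreover have "(u - k)\<^sup>2 \<ge> u\<^sup>2 - 2 * (K * \<bar>u\<bar>)"
  proof -
    have "u * k \<le> \<bar>k\<bar> * \<bar>u\<bar>" by (metis abs_ge_self abs_mult mult.commute)
    also have "\<dots> \<le> K * \<bar>u\<bar>" using assms by (intro mult_right_mono) auto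
    finally show ?thesis using zero_le_power2[of k] unfolding power2_diff by linarith
  qed
  hence "pi * (u - k)\<^sup>2 \<ge> pi * (u\<^sup>2 - 2 * (K * \<bar>u\<bar>))" by (intro mult_left_mono) auto
  ultimately show ?thesis unfolding gauss_dom_def exp_le_cancel_iff by (simp add: algebra_simps)
qed

text \<open>Turning the plane by \<open>cnj \<omega>\<close> makes the lines horizontal.\<close>

lemma line_shift:
  assumes c: "c1 < c2" "c1 \<notin> \<int>" "c2 \<notin> \<int>" and e: "e > 0" and L: "L \<ge> 0"
    and holo: "h holomorphic_on {x. c1 - e < Re x - Im x \<and> Re x - Im x < c2 + e}"
    and dom: "\<And>c u. c1 \<le> c \<Longrightarrow> c \<le> c2 \<Longrightarrow> norm (h (line c u)) \<le> gauss_dom A L u"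
  shows "line_integral (\<lambda>x. h x / (2 * \<i> * sin (of_real pi * x))) c2
       - line_integral (\<lambda>x. h x / (2 * \<i> * sin (of_real pi * x))) c1
       = (\<Sum>n | c1 < of_int n \<and> of_int n < c2. (- 1) powi n * h (of_int n))"
proof -
  \<comment> \<open>A margin so narrow that the widened strip contains no integer beyond those
    strictly between \<open>c1\<close> and \<open>c2\<close>; \<open>residue_strip\<close> asks for
    holomorphy slightly past both lines.\<close>
  define e' where "e' = Min {e, c1 - \<lfloor>c1\<rfloor>, \<lceil>c2\<rceil> - c2}"
  have "c1 \<noteq> \<lfloor>c1\<rfloor>" "c2 \<noteq> \<lceil>c2\<rceil>" using c by (metis Ints_of_int)+
  hence "\<lfloor>c1\<rfloor> < c1" "c2 < \<lceil>c2\<rceil>"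
    using of_int_floor_le[of c1] le_of_int_ceiling[of c2] by (simp_all only: order_less_le) auto
  hence e': "e' > 0" "e' \<le> e" "e' \<le> c1 - \<lfloor>c1\<rfloor>" "e' \<le> \<lceil>c2\<rceil> - c2"
    using e unfolding e'_def by auto
  have int_between: "c1 < of_int n \<and> of_int n < c2" if "c1 - e' < of_int n" "of_int n < c2 + e'" for n :: int
  proof -
    have "\<lfloor>c1\<rfloor> < n" "n < \<lceil>c2\<rceil>"
      using that e' by (simp_all only: of_int_less_iff[where 'a = real, symmetric])
    thus ?thesis by (simp add: floor_less_iff less_ceiling_iff)
  qed
  \<comment> \<open>\<open>Re x - Im x\<close> has the constant value \<open>c\<close> on the line
    through \<open>c\<close>, so \<open>H\<close> is the region swept by the lines, with its
    margin.\<close>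
  define H where "H = {x. c1 - e < Re x - Im x \<and> Re x - Im x < c2 + e}"
  define f where "f = (\<lambda>x. h x / (2 * \<i> * sin (of_real pi * x)))"
  define F where "F = (\<lambda>z. f (\<omega> * z))"
  define N where "N = {n::int. c1 < of_int n \<and> of_int n < c2}"
  have "N \<subseteq> {\<lfloor>c1\<rfloor>..\<lceil>c2\<rceil>}" by (auto simp: N_def floor_le_iff le_ceiling_iff)
  hence finN: "finite N" by (rule finite_subset) auto
  define pts where "pts = (\<lambda>n. cnj \<omega> * of_int n) ` N"
  have inj: "inj_on (\<lambda>n. cnj \<omega> * of_int n) N" by (auto simp: inj_on_def)
  define r where "r = sqrt 2"
  have r: "r > 0" "r * r = 2" by (auto simp: r_def)
  have ReIm: "Re (\<omega> * z) - Im (\<omega> * z) = - r * Im z" for z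
    using r by (simp add: omega_Complex field_simps flip: r_def)
  have Im_pt: "Im (cnj \<omega> * of_int n) = - of_int n / r" for n
    by (simp add: omega_Complex r_def)
  have Fline: "F (Complex u (- c / r)) = f (line c (u - c / r))" for u c
  proof -
    have "\<omega> * Complex u (- c / r) = line c (u - c / r)"
      using r by (simp add: line_def complex_eq_iff omega_Complex field_simps flip: r_def)
    thus ?thesis by (simp add: F_def)
  qed
  define K where "K = (\<bar>c1\<bar> + \<bar>c2\<bar>) / r"
  have K: "\<bar>c / r\<bar> \<le> K" if "c1 \<le> c" "c \<le> c2" for c
    using that r by (auto simp: K_def abs_divide intro!: divide_right_mono)
  define U where "U = {z. - c2 / r - e' / r < Im z \<and> Im z < - c1 / r + e' / r}"
  have U_iff: "z \<in> U \<longleftrightarrow> c1 - e' < - r * Im z \<and> - r * Im z < c2 + e'" for z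
    using r by (auto simp: U_def field_simps)
  have openU: "open U"
  proof -
    have "U = {z. - c2 / r - e' / r < Im z} \<inter> {z. Im z < - c1 / r + e' / r}" by (auto simp: U_def)
    thus ?thesis by (metis open_Int open_halfspace_Im_lt open_halfspace_Im_gt)
  qed
  have subH: "\<omega> * z \<in> H" if "z \<in> U" for z
    using that r e' unfolding H_def mem_Collect_eq ReIm U_iff by auto
  have Fholo: "F holomorphic_on U - pts"
  proof -
    have "sin (of_real pi * (\<omega> * z)) \<noteq> 0" if z: "z \<in> U" "z \<notin> pts" for z
    proof
      assume "sin (of_real pi * (\<omega> * z)) = 0"
      then obtain n :: int where "of_real pi * (\<omega> * z) = of_real (n * pi)" by (auto simp: sin_eq_0)
      hence "of_real pi * (\<omega> * z) = of_real pi * of_int n" by simp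
      hence wz: "\<omega> * z = of_int n" by simp
      have "cnj \<omega> * of_int n = z" unfolding wz[symmetric] mult.assoc[symmetric] omega_mult_cnj by simp
      moreover have "of_int n = - r * Im z" using ReIm[of z] unfolding wz by simp
      hence "n \<in> N" using z(1) int_between[of n] by (simp add: U_iff N_def)
      ultimately show False using z(2) by (auto simp: pts_def)
    qed
    moreover have "(\<lambda>z. h (\<omega> * z)) holomorphic_on (U - pts)"
      by (rule holomorphic_on_compose_gen[where g = h and t = H, unfolded o_def])
         (use holo subH in \<open>auto intro!: holomorphic_intros simp: H_def\<close>)
    ultimately show ?thesis
      unfolding F_def f_def by (intro holomorphic_intros) auto
  qed
  have openH: "open H"
  proof -
    have "H = {x. c1 - e < Re x - Im x} \<inter> {x. Re x - Im x < c2 + e}" by (auto simp: H_def)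
    thus ?thesis by (auto intro!: open_Int open_Collect_less continuous_intros)
  qed
  have shift: "(LBINT u. F (Complex u (- c / r))) = (LBINT u. f (line c u))" for c
    using lborel_integral_real_affine[of 1 "\<lambda>u. f (line c u)" "- (c / r)"] unfolding Fline by simp
  \<comment> \<open>Increasing \<open>c\<close> lowers the turned line, so \<open>c2\<close> belongs
    to the lower edge of the strip.\<close>
  have "(LBINT u. F (Complex u (- c2 / r))) - (LBINT u. F (Complex u (- c1 / r)))
      = 2 * pi * \<i> * (\<Sum>p\<in>pts. residue F p)"
  proof (rule residue_strip[where e = "e' / r" and T = "1 + K" and A = "A + L * K" and L = "L + 2 * pi * K"])
    show "- c2 / r < - c1 / r" "e' / r > 0" using c e' r by (auto simp: divide_strict_right_mono)
    show "finite pts" by (simp add: pts_def finN)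
    show "- c2 / r < Im p \<and> Im p < - c1 / r" if pp: "p \<in> pts" for p
    proof -
      obtain n where "n \<in> N" "p = cnj \<omega> * of_int n" using pp unfolding pts_def by blast
      thus ?thesis using r by (simp only: Im_pt N_def mem_Collect_eq) (simp add: divide_strict_right_mono)
    qed
    show "F holomorphic_on {z. - c2 / r - e' / r < Im z \<and> Im z < - c1 / r + e' / r} - pts"
      using Fholo by (simp add: U_def)
    show "norm (F (Complex u h')) \<le> gauss_dom (A + L * K) (L + 2 * pi * K) u"
      if h': "- c2 / r \<le> h'" "h' \<le> - c1 / r" "\<bar>u\<bar> \<ge> 1 + K" for u h'
    proof -
      define c' where "c' = - r * h'"
      have h'_eq: "h' = - c' / r" using r by (simp add: c'_def)
      have c': "c1 \<le> c'" "c' \<le> c2" using h' r by (auto simp: c'_def field_simps)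
      have "\<bar>u - c' / r\<bar> \<ge> 1" using h'(3) K[OF c'] by linarith
      hence "norm (F (Complex u h')) \<le> norm (h (line c' (u - c' / r)))"
        unfolding h'_eq Fline f_def by (rule norm_csc_line_le)
      also have "\<dots> \<le> gauss_dom A L (u - c' / r)" by (rule dom[OF c'])
      also have "\<dots> \<le> gauss_dom (A + L * K) (L + 2 * pi * K) u" by (rule gauss_dom_shift[OF K[OF c'] L])
      finally show ?thesis .
    qed
    have int: "integrable lborel (\<lambda>u. F (Complex u (- c / r)))" if cc: "c \<notin> \<int>" "c1 \<le> c" "c \<le> c2" for c
    proof -
      have "continuous_on UNIV (\<lambda>u. h (line c u))"
        by (rule continuous_on_compose2[OF holomorphic_on_imp_continuous_on[OF holo]])
           (use cc e in \<open>auto intro!: continuous_intros simp: Re_Im_line\<close>)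
      hence "integrable lborel (\<lambda>u. f (line c u))"
        unfolding f_def by (rule csc_line_gauss[OF cc(1) L _ dom[OF cc(2,3)]])
      from lborel_integrable_real_affine[OF this, of 1 "- (c / r)"] show ?thesis unfolding Fline by simp
    qed
    show "integrable lborel (\<lambda>u. F (Complex u (- c2 / r)))" "integrable lborel (\<lambda>u. F (Complex u (- c1 / r)))"
      using int c by auto
  qed
  hence "(LBINT u. f (line c2 u)) - (LBINT u. f (line c1 u)) = 2 * pi * \<i> * (\<Sum>p\<in>pts. residue F p)"
    unfolding shift .
  also have "(\<Sum>p\<in>pts. residue F p) = (\<Sum>n\<in>N. residue F (cnj \<omega> * of_int n))"
    unfolding pts_def using inj by (simp add: sum.reindex)
  also have "\<dots> = (\<Sum>n\<in>N. (- 1) powi n * h (of_int n) / (2 * pi * \<i> * \<omega>))"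
  proof (rule sum.cong[OF refl])
    fix n assume n: "n \<in> N"
    define p where "p = cnj \<omega> * of_int n"
    have wp: "\<omega> * p = of_int n" by (simp add: p_def omega_mult_cnj flip: mult.assoc)
    define g where "g = (\<lambda>z. sin (of_real pi * (\<omega> * z)))"
    have gp: "g p = 0" by (simp add: g_def wp sin_eq_0 mult.commute)
    \<comment> \<open>Derivative at \<open>p\<close> of the sine in the denominator. It is nonzero,
      so the pole is at most simple and the residue is a limit of quotients.\<close>
    define g' where "g' = of_real pi * \<omega> * cos (of_real pi * of_int n)"
    have cosn: "cos (of_real pi * of_int n :: complex) = (- 1) powi n"
    proof -
      have "cos (of_real pi * of_int n :: complex) = of_real (cos (pi * of_int n))"
        by (metis cos_of_real of_real_mult of_real_of_int_eq)
      thus ?thesis by (simp add: cos_npi_int power_int_minus_left)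
    qed
    have "(g has_field_derivative g') (at p)"
      unfolding g_def g'_def wp[symmetric] by (auto intro!: derivative_eq_intros)
    hence lim: "(\<lambda>z. g z / (z - p)) \<midarrow>p\<rightarrow> g'"
      by (simp add: has_field_derivative_iff gp)
    from e have hH: "of_int n \<in> H" using n e by (auto simp: H_def N_def)
    have hcont: "isCont h (\<omega> * p)"
      using holomorphic_on_imp_continuous_on[OF holo, folded H_def] hH
      unfolding wp continuous_on_eq_continuous_at[OF openH] by blast
    have "(\<lambda>z. \<omega> * z) \<midarrow>p\<rightarrow> \<omega> * p" by (rule tendsto_mult_left[OF tendsto_ident_at])
    from isCont_tendsto_compose[OF hcont this]
    have hlim: "(\<lambda>z. h (\<omega> * z)) \<midarrow>p\<rightarrow> h (of_int n)" unfolding wp .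
    have g'nz: "g' \<noteq> 0" by (simp add: g'_def cosn)
    have "(\<lambda>z. h (\<omega> * z) / (2 * \<i> * (g z / (z - p)))) \<midarrow>p\<rightarrow> h (of_int n) / (2 * \<i> * g')"
      using g'nz by (intro tendsto_intros hlim lim) auto
    hence "(\<lambda>z. F z * (z - p)) \<midarrow>p\<rightarrow> h (of_int n) / (2 * \<i> * g')"
      by (simp add: F_def f_def g_def)
    moreover have "open (U - (pts - {p}))"
      using openU finN by (intro open_Diff finite_imp_closed) (auto simp: pts_def)
    moreover have "p \<in> U - (pts - {p})"
      using n e' r inj_onD[OF inj] unfolding Diff_iff U_iff p_def Im_pt N_def by auto
    moreover have "F holomorphic_on U - (pts - {p}) - {p}"
      by (rule holomorphic_on_subset[OF Fholo]) auto
    ultimately have "residue F p = h (of_int n) / (2 * \<i> * g')"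
      by (intro residue_simple')
    thus "residue F (cnj \<omega> * of_int n) = (- 1) powi n * h (of_int n) / (2 * pi * \<i> * \<omega>)"
      unfolding p_def[symmetric] g'_def cosn
      by (cases "even n") (simp_all add: power_int_minus_left field_simps)
  qed
  \<comment> \<open>The \<open>2 * pi * \<i>\<close> of the residue theorem cancels here; the
    left-over \<open>1 / \<omega>\<close> is removed by the factor \<open>\<omega>\<close> in
    \<open>line_integral\<close>.\<close>
  also have "2 * pi * \<i> * \<dots> = (\<Sum>n\<in>N. (- 1) powi n * h (of_int n)) / \<omega>"
    by (simp add: sum_distrib_left sum_divide_distrib field_simps)
  finally have "\<omega> * ((LBINT u. f (line c2 u)) - (LBINT u. f (line c1 u))) = (\<Sum>n\<in>N. (- 1) powi n * h (of_int n))"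
    by (simp add: field_simps)
  thus ?thesis unfolding line_integral_def f_def N_def by (simp add: algebra_simps)
qed

section \<open>Mordell's integral\<close>

text \<open>The form in which the identity theorem is used: a formula is computed for a real
  parameter, where real substitutions are available, and then holds on the whole domain.\<close>

lemma analytic_continuation_from_reals:
  fixes f g :: "complex \<Rightarrow> complex"
  assumes hol: "f holomorphic_on S" "g holomorphic_on S" and S: "open S" "connected S" and ab: "a < (b::real)"
    and eq: "\<And>x. a < x \<Longrightarrow> x < b \<Longrightarrow> of_real x \<in> S \<and> f (of_real x) = g (of_real x)"
    and z: "z \<in> S"
  shows "f z = g z"
proof -
  define U where "U = (of_real :: real \<Rightarrow> complex) ` {a<..<b}"
  define m where "m = (a + b) / 2"
  have m: "a < m" "m < b" using ab by (auto simp: m_def)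
  have lim: "complex_of_real m islimpt U"
    unfolding islimpt_approachable
  proof (intro allI impI)
    fix e :: real assume e: "e > 0"
    define x where "x = m + min (e / 2) ((b - m) / 2)"
    have x: "x > m" "x < m + e" "x < b" using e m by (auto simp: x_def min_def field_simps)
    have "dist (complex_of_real x) (of_real m) < e"
      using x by (simp add: dist_norm flip: of_real_diff)
    moreover have "complex_of_real x \<in> U" using x m by (auto simp: U_def)
    moreover have "complex_of_real x \<noteq> of_real m" using x by simp
    ultimately show "\<exists>x'\<in>U. x' \<noteq> complex_of_real m \<and> dist x' (complex_of_real m) < e" by blast
  qed
  have "(\<lambda>z. f z - g z) z = 0"
  proof (rule analytic_continuation[where f = "\<lambda>z. f z - g z", OF _ S _ _ lim])
    show "(\<lambda>z. f z - g z) holomorphic_on S" by (intro holomorphic_intros hol)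
    show "U \<subseteq> S" "complex_of_real m \<in> S" "\<And>z. z \<in> U \<Longrightarrow> f z - g z = 0"
      using eq m by (auto simp: U_def)
  qed (rule z)
  thus ?thesis by simp
qed

section \<open>Gaussian integrals along a line\<close>

lemma norm_exp_gauss_linear:
  fixes \<beta> :: complex
  shows
  "norm (exp (of_real (- pi * u\<^sup>2) + 2 * \<beta> * of_real u)) \<le> gauss_dom 0 (2 * norm \<beta>) u"
proof -
  have "Re \<beta> * u \<le> \<bar>Re \<beta>\<bar> * \<bar>u\<bar>" by (metis abs_ge_self abs_mult)
  also have "\<dots> \<le> norm \<beta> * \<bar>u\<bar>" by (intro mult_right_mono abs_Re_le_cmod) auto
  finally have "Re (of_real (- pi * u\<^sup>2) + 2 * \<beta> * of_real u) \<le> 0 + 2 * norm \<beta> * \<bar>u\<bar> - pi * u\<^sup>2"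
    by (simp add: mult.assoc)
  thus ?thesis unfolding norm_exp_eq_Re gauss_dom_def exp_le_cancel_iff .
qed

lemma gauss_integral_real:
  "(LBINT u. exp (- pi * u\<^sup>2 + 2 * b * u)) = exp (b\<^sup>2 / pi)"
proof -
  have "(LBINT u. exp (- pi * u\<^sup>2)) = 1"
    using has_bochner_integral_integral_eq[OF has_bochner_integral_gauss(1)[of pi]] by simp
  also have "(LBINT u. exp (- pi * u\<^sup>2)) = (LBINT u. exp (- pi * (- b / pi + 1 * u)\<^sup>2))"
    using lborel_integral_real_affine[of 1 "\<lambda>u. exp (- pi * u\<^sup>2)" "- b / pi"] by simp
  also have "(\<lambda>u. exp (- pi * (- b / pi + 1 * u)\<^sup>2)) = (\<lambda>u. exp (- b\<^sup>2 / pi) * exp (- pi * u\<^sup>2 + 2 * b * u))"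
    by (rule ext, unfold exp_add[symmetric]) (simp add: power2_eq_square field_simps)
  also have "(LBINT u. exp (- b\<^sup>2 / pi) * exp (- pi * u\<^sup>2 + 2 * b * u)) = exp (- b\<^sup>2 / pi) * (LBINT u. exp (- pi * u\<^sup>2 + 2 * b * u))"
    by (rule integral_mult_right_zero)
  finally show ?thesis by (simp add: exp_minus field_simps)
qed

lemma gauss_integral_complex:
  fixes \<beta> :: complex
  shows
  "(LBINT u. exp (of_real (- pi * u\<^sup>2) + 2 * \<beta> * of_real u)) = exp (\<beta>\<^sup>2 / of_real pi)"
proof (rule analytic_continuation_from_reals[where S = UNIV and a = 0 and b = 1 and z = \<beta>
      and f = "\<lambda>\<beta>. LBINT u. exp (of_real (- pi * u\<^sup>2) + 2 * \<beta> * of_real u)" and g = "\<lambda>\<beta>. exp (\<beta>\<^sup>2 / of_real pi)"])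
  let ?e = "\<lambda>w u. exp (of_real (- pi * u\<^sup>2) + 2 * w * of_real u) :: complex"
  show "(\<lambda>\<beta>. LBINT u. exp (of_real (- pi * u\<^sup>2) + 2 * \<beta> * of_real u)) holomorphic_on UNIV"
  proof (rule holomorphic_on_lborel_integral[where f' = "\<lambda>\<beta> u. 2 * of_real u * exp (of_real (- pi * u\<^sup>2) + 2 * \<beta> * of_real u)"])
    fix z :: complex
    have "norm (?e w u) \<le> gauss_dom 0 (2 * (norm z + 1)) u"
      if "w \<in> cball z 1" for w u
    proof -
      have "norm w \<le> norm z + 1" using that norm_triangle_ineq2[of w z] by (simp add: dist_norm norm_minus_commute)
      thus ?thesis using norm_exp_gauss_linear[of u w] gauss_dom_mono[of 0 0 "2 * norm w" "2 * (norm z + 1)" u] by simp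
    qed
    thus "\<exists>r>0. \<exists>g. integrable lborel g \<and> (\<forall>w\<in>cball z r \<inter> UNIV. \<forall>u. norm (?e w u) \<le> g u)"
      using integrable_gauss_dom by (intro exI[of _ 1] conjI exI[of _ "gauss_dom 0 (2 * (norm z + 1))"]) auto
  qed (auto intro!: derivative_eq_intros continuous_intros simp: case_prod_unfold)
  fix x :: real
  have "(LBINT u. exp (of_real (- pi * u\<^sup>2) + 2 * of_real x * of_real u)) = (LBINT u. complex_of_real (exp (- pi * u\<^sup>2 + 2 * x * u)))"
    by (rule Bochner_Integration.integral_cong) (simp_all flip: exp_of_real)
  also have "\<dots> = of_real (exp (x\<^sup>2 / pi))" by (simp only: integral_complex_of_real gauss_integral_real)
  finally show "complex_of_real x \<in> UNIV \<and> (LBINT u. exp (complex_of_real (- pi * u\<^sup>2) + 2 * complex_of_real x * complex_of_real u)) = exp ((complex_of_real x)\<^sup>2 / complex_of_real pi)"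
    by (simp flip: exp_of_real)
qed (auto intro!: holomorphic_intros)

lemma omega_sq_line: "\<i> * (line c u)\<^sup>2 = - of_real (u\<^sup>2) + 2 * \<i> * \<omega> * of_real (c * u) + \<i> * of_real (c\<^sup>2)"
proof -
  have "\<i> * (line c u)\<^sup>2 = \<i> * \<omega>\<^sup>2 * of_real (u\<^sup>2) + 2 * \<i> * \<omega> * of_real (c * u) + \<i> * of_real (c\<^sup>2)"
    by (simp add: line_def power2_eq_square algebra_simps)
  thus ?thesis by (simp add: omega_power2)
qed

text \<open>Completing the square. The dependence on \<open>c\<close> cancels between
  \<open>\<beta>\<^sup>2 / pi\<close> and \<open>K\<close>, as it must for an entire integrand with
  Gaussian decay.\<close>

lemma gauss_line_integral:
  "line_integral (\<lambda>x. exp (pi * \<i> * x\<^sup>2 + 2 * pi * \<i> * x * b)) c = \<omega> * exp (- pi * \<i> * b\<^sup>2)"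
proof -
  define \<beta> where "\<beta> = pi * \<i> * \<omega> * (of_real c + b)"
  define K where "K = pi * \<i> * (of_real (c\<^sup>2) + 2 * b * of_real c)"
  have "pi * \<i> * (line c u)\<^sup>2 + 2 * pi * \<i> * line c u * b = (of_real (- pi * u\<^sup>2) + 2 * \<beta> * of_real u) + K" for u
  proof -
    have "pi * \<i> * (line c u)\<^sup>2 = pi * (- of_real (u\<^sup>2) + 2 * \<i> * \<omega> * of_real (c * u) + \<i> * of_real (c\<^sup>2))"
      by (subst omega_sq_line[symmetric]) simp
    thus ?thesis by (simp add: \<beta>_def K_def line_def algebra_simps)
  qed
  hence "line_integral (\<lambda>x. exp (pi * \<i> * x\<^sup>2 + 2 * pi * \<i> * x * b)) c
      = \<omega> * (LBINT u. exp (of_real (- pi * u\<^sup>2) + 2 * \<beta> * of_real u) * exp K)"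
    unfolding line_integral_def by (simp only: exp_add)
  also have "\<dots> = \<omega> * exp (\<beta>\<^sup>2 / pi + K)"
    by (subst integral_mult_left_zero, subst gauss_integral_complex) (simp only: exp_add)
  also have "\<beta>\<^sup>2 / pi + K = - pi * \<i> * b\<^sup>2"
    by (simp add: \<beta>_def K_def power_mult_distrib omega_power2) (simp add: power2_eq_square field_simps)
  finally show ?thesis .
qed

lemma norm_exp_sq_line: "norm (exp (pi * \<i> * (line c u)\<^sup>2)) = exp (- pi * u\<^sup>2 - sqrt 2 * pi * c * u)"
proof -
  have "Re (pi * \<i> * (line c u)\<^sup>2) = - 2 * pi * (Re (line c u) * Im (line c u))"
    by (simp add: power2_eq_square)
  also have "\<dots> = - 2 * pi * (c * u / sqrt 2 + u\<^sup>2 / 2)"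
    unfolding Re_Im_line by (simp add: power2_eq_square field_simps)
  also have "\<dots> = - pi * u\<^sup>2 - (2 / sqrt 2) * pi * c * u" by (simp add: field_simps)
  also have "2 / sqrt 2 = sqrt (2 :: real)" by (simp add: real_div_sqrt)
  finally show ?thesis by (simp add: norm_exp_eq_Re)
qed

lemma norm_exp_sq_line_le:
  assumes "\<bar>c\<bar> \<le> C"
  shows "norm (exp (pi * \<i> * (line c u)\<^sup>2)) \<le> gauss_dom 0 (2 * pi * C) u"
proof -
  have "sqrt 2 * (pi * C) \<le> 2 * (pi * C)" using assms by (intro mult_right_mono real_le_lsqrt) auto
  hence *: "sqrt 2 * pi * C \<le> 2 * pi * C" by (simp only: mult.assoc)
  have "- (sqrt 2 * pi * c * u) \<le> \<bar>sqrt 2 * pi * c * u\<bar>" by (rule abs_ge_minus_self)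
  also have "\<dots> = sqrt 2 * pi * \<bar>c\<bar> * \<bar>u\<bar>" by (simp add: abs_mult)
  also have "\<dots> \<le> sqrt 2 * pi * C * \<bar>u\<bar>" using assms by (intro mult_right_mono mult_left_mono) auto
  also have "\<dots> \<le> 2 * pi * C * \<bar>u\<bar>" by (intro mult_right_mono *) auto
  finally show ?thesis unfolding norm_exp_sq_line gauss_dom_def exp_le_cancel_iff by simp
qed

lemma norm_line_le: "norm (line c u) \<le> \<bar>c\<bar> + \<bar>u\<bar>"
  unfolding line_def by (rule norm_triangle_le) (simp add: norm_mult)

lemma norm_exp_mult_line_le:
  assumes "\<bar>c\<bar> \<le> C"
  shows "norm (exp (y * line c u)) \<le> exp (norm y * C + norm y * \<bar>u\<bar>)"
proof -
  have "Re (y * line c u) \<le> norm (y * line c u)" by (rule complex_Re_le_cmod)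
  also have "\<dots> \<le> norm y * (C + \<bar>u\<bar>)" unfolding norm_mult
    using norm_line_le[of c u] assms by (intro mult_left_mono) auto
  finally show ?thesis by (simp add: norm_exp_eq_Re algebra_simps)
qed

definition mordell :: "complex \<Rightarrow> complex \<Rightarrow> complex" where
  "mordell y x = exp (of_real pi * \<i> * x\<^sup>2 + of_real (2 * pi) * \<i> * x * y) / (2 * \<i> * sin (of_real pi * x))"

lemma mordell_num_dom:
  assumes "\<bar>c\<bar> \<le> C"
  shows "norm (exp (pi * \<i> * (line c u)\<^sup>2 + 2 * pi * \<i> * line c u * y))
    \<le> gauss_dom (norm (2 * pi * \<i> * y) * C) (norm (2 * pi * \<i> * y) + 2 * pi * C) u"
proof -
  have "exp (pi * \<i> * (line c u)\<^sup>2 + 2 * pi * \<i> * line c u * y) = exp (2 * pi * \<i> * y * line c u) * exp (pi * \<i> * (line c u)\<^sup>2)"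
    by (simp add: exp_add[symmetric] algebra_simps)
  thus ?thesis
    using gauss_dom_mult[OF norm_exp_mult_line_le[OF assms] norm_exp_sq_line_le[OF assms], of "2 * pi * \<i> * y" u] by simp
qed

lemma integrable_mordell:
  assumes "c \<notin> \<int>"
  shows "integrable lborel (\<lambda>u. mordell y (line c u))"
  unfolding mordell_def
  by (rule csc_line_gauss[OF assms _ _ mordell_num_dom[OF order.refl]])
     (auto intro!: continuous_intros)

lemma half_not_Int: "(1 / 2 :: real) \<notin> \<int>" and three_halves_not_Int: "(3 / 2 :: real) \<notin> \<int>"
  by (auto elim!: Ints_cases simp: field_simps)

text \<open>Two linear equations for the values at \<open>y\<close> and \<open>y + 1\<close>. Their
  difference is a Gaussian integral, since raising \<open>y\<close> by one produces exactly the sine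
  of the denominator. Translating the line by one links them again, through the residue at
  \<open>1\<close>. Solving for the value at \<open>y\<close> divides by
  \<open>q - 1\<close>.\<close>

lemma mordell_eval:
  assumes "exp (2 * pi * \<i> * y) \<noteq> 1"
  shows "line_integral (mordell y) (1 / 2)
       = exp (2 * pi * \<i> * y) * (1 - exp (- pi * \<i> * (y\<^sup>2 + y))) / (exp (2 * pi * \<i> * y) - 1)"
proof -
  define q where "q = exp (2 * pi * \<i> * y)"
  define J where "J = line_integral (mordell y) (1 / 2)"
  have 1: "line_integral (mordell (y + 1)) (1 / 2) - J = \<omega> * exp (- pi * \<i> * (y + 1 / 2)\<^sup>2)"
  proof -
    have "mordell (y + 1) (line (1/2) u) - mordell y (line (1/2) u)
        = exp (pi * \<i> * (line (1/2) u)\<^sup>2 + 2 * pi * \<i> * line (1/2) u * (y + 1 / 2))" for u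
    proof -
      define x where "x = line (1/2) u"
      have nz: "2 * \<i> * sin (of_real pi * x) \<noteq> 0" using sin_pi_line_nz[OF half_not_Int] by (simp add: x_def)
      have s: "2 * \<i> * sin (of_real pi * x) = exp (\<i> * (pi * x)) - exp (- (\<i> * (pi * x)))"
        by (simp add: sin_exp_eq field_simps)
      have "exp (pi * \<i> * x\<^sup>2 + 2 * pi * \<i> * x * (y + 1)) - exp (pi * \<i> * x\<^sup>2 + 2 * pi * \<i> * x * y)
        = exp (pi * \<i> * x\<^sup>2 + 2 * pi * \<i> * x * (y + 1 / 2)) * (2 * \<i> * sin (of_real pi * x))"
        unfolding s right_diff_distrib exp_add[symmetric] by (simp add: algebra_simps)
      thus ?thesis unfolding mordell_def x_def[symmetric] using nz
        by (simp only: diff_divide_distrib[symmetric]) simp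
    qed
    hence "line_integral (mordell (y + 1)) (1 / 2) - J
      = line_integral (\<lambda>x. exp (pi * \<i> * x\<^sup>2 + 2 * pi * \<i> * x * (y + 1 / 2))) (1 / 2)"
      unfolding line_integral_def J_def right_diff_distrib[symmetric]
      by (subst Bochner_Integration.integral_diff[symmetric]) (simp_all add: integrable_mordell half_not_Int)
    thus ?thesis unfolding gauss_line_integral .
  qed
  \<comment> \<open>The translation \<open>x + 1\<close> carries the line through
    \<open>1 / 2\<close> to the one through \<open>3 / 2\<close>; the factor
    \<open>exp (pi * \<i>)\<close> and the sign change of the sine cancel.\<close>
  have 2: "line_integral (mordell y) (3 / 2) = q * line_integral (mordell (y + 1)) (1 / 2)"
  proof -
    have "mordell y (line (3/2) u) = q * mordell (y + 1) (line (1/2) u)" for u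
    proof -
      define x where "x = line (1/2) u"
      have x: "line (3/2) u = x + 1" by (simp add: x_def line_def)
      have "exp (pi * \<i> * (x + 1)\<^sup>2 + 2 * pi * \<i> * (x + 1) * y) = exp (pi * \<i>) * (q * exp (pi * \<i> * x\<^sup>2 + 2 * pi * \<i> * x * (y + 1)))"
        unfolding q_def exp_add[symmetric] by (simp add: power2_eq_square algebra_simps)
      moreover have "sin (of_real pi * (x + 1)) = - sin (of_real pi * x)"
        by (simp add: distrib_left sin_add flip: sin_of_real cos_of_real)
      ultimately show ?thesis unfolding mordell_def x x_def[symmetric] by simp
    qed
    thus ?thesis unfolding line_integral_def by simp
  qed
  have "line_integral (mordell y) (3 / 2) - J = (\<Sum>n::int | (1/2::real) < of_int n \<and> of_int n < (3/2::real). (- 1) powi n *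
     exp (pi * \<i> * (of_int n)\<^sup>2 + 2 * pi * \<i> * (of_int n) * y))"
    unfolding J_def mordell_def
    by (rule line_shift[OF _ half_not_Int three_halves_not_Int, where e = 1, OF _ _ _ _ mordell_num_dom[where C = "3 / 2"]])
       (auto intro!: holomorphic_intros)
  also have "{n::int. (1/2::real) < of_int n \<and> of_int n < (3/2::real)} = {1}"
    by (auto simp: field_simps)
  \<comment> \<open>At the only pole crossed, the sign \<open>(- 1) powi 1\<close> cancels
    \<open>exp (pi * \<i>)\<close>, which leaves \<open>q\<close>.\<close>
  finally have 3: "line_integral (mordell y) (3 / 2) - J = q"
    by (simp add: q_def exp_add)
  define E where "E = \<omega> * exp (- pi * \<i> * (y + 1 / 2)\<^sup>2)"
  have E: "E = exp (- pi * \<i> * (y\<^sup>2 + y))"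
  proof -
    have "\<omega> = exp (pi * \<i> / 4)" by (simp add: omega_def cis_conv_exp mult.commute)
    moreover have "pi * \<i> / 4 + - pi * \<i> * (y + 1 / 2)\<^sup>2 = - pi * \<i> * (y\<^sup>2 + y)"
      by (simp add: power2_eq_square field_simps)
    ultimately show ?thesis unfolding E_def by (metis exp_add)
  qed
  have "q * (J + E) - J = q"
    using 1 2 3 by (simp add: E_def algebra_simps)
  hence "J * (q - 1) = q * (1 - E)" by (simp add: algebra_simps)
  thus ?thesis using assms unfolding J_def[symmetric] E[symmetric] q_def[symmetric]
    by (simp add: nonzero_eq_divide_eq)
qed

section \<open>The Riemann--Siegel integral\<close>

definition RSI :: "real \<Rightarrow> complex \<Rightarrow> complex" where
  "RSI c w = - line_integral (\<lambda>x. (x powr (- w) * exp (of_real pi * \<i> * x\<^sup>2)) / (2 * \<i> * sin (of_real pi * x))) c"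

section \<open>Bounds for the integrand of the Riemann-Siegel integral\<close>

lemma norm_line_sq: "(norm (line c u))\<^sup>2 = c\<^sup>2 + sqrt 2 * c * u + u\<^sup>2"
proof -
  have "(norm (line c u))\<^sup>2 = (c + u / sqrt 2)\<^sup>2 + (u / sqrt 2)\<^sup>2"
    by (simp add: cmod_power2 Re_Im_line)
  also have "\<dots> = c\<^sup>2 + (2 / sqrt 2) * c * u + u\<^sup>2"
    by (simp add: power2_sum power_divide)
  also have "2 / sqrt 2 = sqrt (2 :: real)" by (simp add: real_div_sqrt)
  finally show ?thesis .
qed

lemma norm_line_ge:
  assumes "c \<ge> 0" shows "norm (line c u) \<ge> c / sqrt 2"
proof (rule power2_le_imp_le)
  have "0 \<le> (c / sqrt 2 + u)\<^sup>2" by simp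
  also have "\<dots> = c\<^sup>2 / 2 + (2 / sqrt 2) * c * u + u\<^sup>2" by (simp add: power2_sum power_divide)
  also have "2 / sqrt 2 = sqrt (2 :: real)" by (simp add: real_div_sqrt)
  finally show "(c / sqrt 2)\<^sup>2 \<le> (norm (line c u))\<^sup>2" by (simp add: norm_line_sq power_divide)
qed simp

lemma line_not_nonpos_Reals: "c > 0 \<Longrightarrow> line c u \<notin> \<real>\<^sub>\<le>\<^sub>0"
  by (auto simp: complex_nonpos_Reals_iff Re_Im_line)

lemma line_nonzero: "c > 0 \<Longrightarrow> line c u \<noteq> 0"
  using line_not_nonpos_Reals[of c u] by auto

lemma line_powr: "c > 0 \<Longrightarrow> line c u powr w = exp (w * Ln (line c u))"
  by (simp add: powr_def line_nonzero)

text \<open>The modulus is at most \<open>exp (norm w * norm (Ln x))\<close>, and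
  \<open>Ln x\<close> grows at most linearly in \<open>\<bar>u\<bar>\<close>:
  \<open>ln (norm x)\<close> is bounded above by \<open>norm x\<close>, and below because the line
  keeps the distance \<open>c1 / sqrt 2\<close> from \<open>0\<close>. Uniformity in
  \<open>c\<close> serves the shift of the line, uniformity in \<open>w\<close> the
  holomorphy.\<close>

lemma norm_powr_line_le:
  assumes c: "0 < c1" "c1 \<le> c" "c \<le> c2" and w: "norm w \<le> W"
  shows "norm (line c u powr (- w)) \<le> exp (W * (c2 + \<bar>ln (c1 / sqrt 2)\<bar> + pi) + W * \<bar>u\<bar>)"
proof -
  define x where "x = line c u"
  have x0: "x \<noteq> 0" using c by (auto simp: x_def line_nonzero)
  have lb: "c1 / sqrt 2 \<le> norm x"
    using norm_line_ge[of c u] c by (simp add: x_def) (smt (verit) divide_right_mono real_sqrt_ge_zero)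
  have "\<bar>ln (norm x)\<bar> \<le> c2 + \<bar>u\<bar> + \<bar>ln (c1 / sqrt 2)\<bar>"
  proof (rule abs_leI)
    have "ln (norm x) \<le> norm x" using x0 ln_le_minus_one[of "norm x"] by simp
    also have "norm x \<le> c2 + \<bar>u\<bar>" using norm_line_le[of c u] c by (simp add: x_def)
    finally show "ln (norm x) \<le> c2 + \<bar>u\<bar> + \<bar>ln (c1 / sqrt 2)\<bar>" by simp
    have "ln (c1 / sqrt 2) \<le> ln (norm x)" using lb c by (intro ln_mono) auto
    moreover have "- \<bar>ln (c1 / sqrt 2)\<bar> \<le> ln (c1 / sqrt 2)" by linarith
    ultimately show "- ln (norm x) \<le> c2 + \<bar>u\<bar> + \<bar>ln (c1 / sqrt 2)\<bar>" using c by linarith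
  qed
  moreover have "norm (Ln x) \<le> \<bar>Re (Ln x)\<bar> + \<bar>Im (Ln x)\<bar>" by (rule cmod_le)
  moreover have "\<bar>Im (Ln x)\<bar> \<le> pi" using Im_Ln_le_pi[OF x0] mpi_less_Im_Ln[OF x0] by simp
  ultimately have Ln: "norm (Ln x) \<le> c2 + \<bar>u\<bar> + \<bar>ln (c1 / sqrt 2)\<bar> + pi"
    using x0 by simp
  have "norm (x powr (- w)) \<le> exp (norm w * norm (Ln x))"
    using complex_Re_le_cmod[of "- (w * Ln x)"] x0 by (simp add: powr_def norm_mult)
  also have "norm w * norm (Ln x) \<le> W * (c2 + \<bar>u\<bar> + \<bar>ln (c1 / sqrt 2)\<bar> + pi)"
    using w Ln by (intro mult_mono) (auto intro: order.trans[OF norm_ge_zero])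
  finally show ?thesis by (simp add: x_def algebra_simps)
qed

lemma RSI_num_dom:
  assumes c: "0 < c1" "c1 \<le> c" "c \<le> c2" and w: "norm w \<le> W"
  shows "norm (line c u powr (- w) * exp (of_real pi * \<i> * (line c u)\<^sup>2))
     \<le> gauss_dom (W * (c2 + \<bar>ln (c1 / sqrt 2)\<bar> + pi) + 0) (W + 2 * pi * c2) u"
  by (intro gauss_dom_mult norm_powr_line_le norm_exp_sq_line_le) (use assms in auto)

lemma continuous_RSI_num:
  "c > 0 \<Longrightarrow> continuous_on UNIV (\<lambda>u. line c u powr (- w) * exp (of_real pi * \<i> * (line c u)\<^sup>2))"
  unfolding line_powr by (intro continuous_intros) (rule line_not_nonpos_Reals)

lemma RSI_shift:
  assumes c: "0 < c1" "c1 < c2" "c1 \<notin> \<int>" "c2 \<notin> \<int>"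
  shows "RSI c1 w = (\<Sum>n::int | c1 < of_int n \<and> of_int n < c2. of_int n powr (- w)) + RSI c2 w"
proof -
  have "RSI c1 w - RSI c2 w = (\<Sum>n::int | c1 < of_int n \<and> of_int n < c2. (- 1) powi n * (of_int n powr (- w) * exp (of_real pi * \<i> * (of_int n)\<^sup>2)))"
    unfolding RSI_def minus_diff_minus minus_diff_eq
  proof (rule line_shift[OF c(2-4) _ _ _ RSI_num_dom[OF c(1) _ _ order.refl]])
    show "c1 > 0" "norm w + 2 * pi * c2 \<ge> 0" using c by auto
    show "(\<lambda>x. x powr (- w) * exp (of_real pi * \<i> * x\<^sup>2)) holomorphic_on {x. c1 - c1 < Re x - Im x \<and> Re x - Im x < c2 + c1}"
      by (auto intro!: holomorphic_intros simp: complex_nonpos_Reals_iff)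
  qed auto
  \<comment> \<open>\<open>n\<^sup>2\<close> and \<open>n\<close> have the same parity, so
    \<open>exp (pi * \<i> * n\<^sup>2)\<close> cancels the sign left by the cosecant. This is why
    the residues form a plain Dirichlet polynomial.\<close>
  also have "\<dots> = (\<Sum>n::int | c1 < of_int n \<and> of_int n < c2. of_int n powr (- w))"
  proof (rule sum.cong[OF refl])
    fix n :: int
    have "exp (of_real pi * \<i> * (of_int n)\<^sup>2) = exp (of_int (n\<^sup>2) * (of_real pi * \<i>))" by (simp add: mult_ac)
    also have "\<dots> = (exp (of_real pi * \<i>)) powi (n\<^sup>2)" by (simp only: exp_power_int)
    also have "\<dots> = (- 1) powi n" by (simp add: power_int_minus_left)
    finally show "(- 1) powi n * (of_int n powr (- w) * exp (of_real pi * \<i> * (of_int n)\<^sup>2)) = of_int n powr (- w)"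
      by (simp add: power_int_minus_left)
  qed
  finally show ?thesis by (simp add: algebra_simps)
qed

lemma csc_line_bounded:
  assumes c: "c \<notin> \<int>"
  obtains B where "B > 0" "\<And>u. norm (1 / (2 * \<i> * sin (of_real pi * line c u))) \<le> B"
proof -
  let ?f = "\<lambda>u. 1 / (2 * \<i> * sin (of_real pi * line c u))"
  have "continuous_on {-1..1} (\<lambda>u. ?f u)"
    using sin_pi_line_nz[OF c] by (intro continuous_intros) auto
  hence "compact ((\<lambda>u. ?f u) ` {-1..1})"
    by (rule compact_continuous_image) simp
  then obtain B where B: "\<And>x. x \<in> (\<lambda>u. ?f u) ` {-1..1} \<Longrightarrow> norm x \<le> B"
    using compact_imp_bounded bounded_iff by metis
  show thesis
  proof (rule that[of "max B 1"])
    fix u show "norm (?f u) \<le> max B 1"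
    proof (cases "\<bar>u\<bar> \<ge> 1")
      case True
      thus ?thesis using norm_csc_line_le[OF True, of 1 c] by simp
    next
      case False
      hence "u \<in> {-1..1}" by auto
      from B[OF imageI[OF this]] show ?thesis by simp
    qed
  qed simp
qed

lemma RSI_holomorphic:
  assumes c: "c > 0" "c \<notin> \<int>"
  shows "RSI c holomorphic_on UNIV"
proof -
  obtain B where B: "B > 0" "\<And>u. norm (1 / (2 * \<i> * sin (of_real pi * line c u))) \<le> B"
    using csc_line_bounded[OF c(2)] by blast
  note nz = line_nonzero[OF c(1)] line_not_nonpos_Reals[OF c(1)] sin_pi_line_nz[OF c(2)]
  define f where "f = (\<lambda>w u. (line c u powr (- w) * exp (of_real pi * \<i> * (line c u)\<^sup>2)) / (2 * \<i> * sin (of_real pi * line c u)))"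
  have "(\<lambda>w. LBINT u. f w u) holomorphic_on UNIV"
  proof (rule holomorphic_on_lborel_integral[where f' = "\<lambda>w u. - Ln (line c u) * f w u"])
    show "((\<lambda>w. f w u) has_field_derivative - Ln (line c u) * f z u) (at z)" for z u
      unfolding f_def line_powr[OF c(1)] using nz by (auto intro!: derivative_eq_intros simp: field_simps)
    have cont: "continuous_on UNIV (\<lambda>(w, u). f w u)"
      unfolding f_def case_prod_unfold line_powr[OF c(1)] using nz(3)
      by (intro continuous_intros ballI nz(2)) auto
    thus "continuous_on (UNIV \<times> UNIV) (\<lambda>(w, u). f w u)" by simp
    have "continuous_on UNIV (\<lambda>x. - Ln (line c (snd x)) * (\<lambda>(w, u). f w u) x)"
      by (intro continuous_intros cont ballI nz(2))
    thus "continuous_on (UNIV \<times> UNIV) (\<lambda>(w, u). - Ln (line c u) * f w u)" by (simp add: case_prod_unfold)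
    fix z :: complex
    define A where "A = (norm z + 1) * (c + \<bar>ln (c / sqrt 2)\<bar> + pi) + 0"
    define L where "L = norm z + 1 + 2 * pi * c"
    have "norm (f w u) \<le> gauss_dom A L u * B" if "w \<in> cball z 1" for w u
    proof -
      have w: "norm w \<le> norm z + 1" using that norm_triangle_ineq2[of w z] by (simp add: dist_norm norm_minus_commute)
      have "f w u = (line c u powr (- w) * exp (of_real pi * \<i> * (line c u)\<^sup>2)) * (1 / (2 * \<i> * sin (of_real pi * line c u)))"
        by (simp add: f_def)
      also have "norm \<dots> \<le> gauss_dom A L u * B"
        unfolding norm_mult[of "_ * exp _"] A_def L_def
        by (intro mult_mono RSI_num_dom B w) (use c less_imp_le[OF gauss_dom_pos] in auto)
      finally show ?thesis .
    qed
    moreover have "integrable lborel (\<lambda>u. gauss_dom A L u * B)" using integrable_gauss_dom by simp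
    ultimately show "\<exists>r>0. \<exists>g. integrable lborel g \<and> (\<forall>w\<in>cball z r \<inter> UNIV. \<forall>u. norm (f w u) \<le> g u)"
      by (intro exI[of _ 1] conjI exI[of _ "\<lambda>u. gauss_dom A L u * B"]) auto
  qed simp
  hence "(\<lambda>w. - (\<omega> * (LBINT u. f w u))) holomorphic_on UNIV" by (intro holomorphic_intros)
  thus ?thesis unfolding f_def RSI_def[abs_def] line_integral_def .
qed

lemma holomorphic_cnj_RSI:
  assumes c: "c > 0" "c \<notin> \<int>"
  shows "(\<lambda>s. cnj (RSI c (1 - cnj s))) holomorphic_on UNIV"
proof -
  have "(\<lambda>z. RSI c (1 - z)) holomorphic_on UNIV"
    by (auto intro!: holomorphic_on_compose_gen[OF _ RSI_holomorphic[OF c], unfolded o_def] holomorphic_intros)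
  hence "cnj \<circ> (\<lambda>z. RSI c (1 - z)) \<circ> cnj holomorphic_on UNIV"
    by (intro holomorphic_on_compose_cnj_cnj) (auto intro: holomorphic_on_subset)
  thus ?thesis by (simp add: o_def)
qed

section \<open>Mellin transforms\<close>

text \<open>\<open>v powr (s - 1)\<close> extended by zero to \<open>v \<le> 0\<close>. Mellin
  transforms become integrals over the whole real line, and for \<open>s > 1\<close> the weight is
  continuous there.\<close>

definition ppow :: "real \<Rightarrow> real \<Rightarrow> real" where "ppow s v = max 0 v powr (s - 1)"

lemma ppow_nonneg [simp]: "ppow s v \<ge> 0" by (simp add: ppow_def)

lemma ppow_nonpos: "v \<le> 0 \<Longrightarrow> ppow s v = 0" by (simp add: ppow_def)

lemma continuous_on_ppow [continuous_intros]:
  "s > 1 \<Longrightarrow> continuous_on S f \<Longrightarrow> continuous_on S (\<lambda>x. ppow s (f x))"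
  unfolding ppow_def by (intro continuous_on_powr' continuous_intros) auto

lemma mellin_exp_real:
  assumes s: "s > 1" and d: "d > 0"
  shows "has_bochner_integral lborel (\<lambda>v. ppow s v * exp (- d * v)) (Gamma s * d powr (- s))"
proof -
  have meas: "(\<lambda>v. ppow s v * exp (- v)) \<in> borel_measurable lborel"
    using borel_measurable_continuous_onI[of "\<lambda>v. ppow s v * exp (- v)"] s
    by (simp add: continuous_intros)
  have "(\<integral>\<^sup>+v. ennreal (ppow s v * exp (- v)) \<partial>lborel) = (\<integral>\<^sup>+t. ennreal (indicator {0..} t * t powr (s - 1) / exp t) \<partial>lborel)"
    by (intro nn_integral_cong) (auto simp: ppow_def indicator_def max_def exp_minus field_simps)
  also have "\<dots> = ennreal (Gamma s)" using Gamma_conv_nn_integral_real[of s] s by simp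
  finally have "has_bochner_integral lborel (\<lambda>v. ppow s v * exp (- v)) (Gamma s)"
    using s by (intro has_bochner_integral_nn_integral meas) (auto simp: Gamma_real_nonneg less_imp_le)
  hence "has_bochner_integral lborel (\<lambda>v. ppow s (0 + d * v) * exp (- (0 + d * v))) (Gamma s /\<^sub>R \<bar>d\<bar>)"
    using d by (subst lborel_has_bochner_integral_real_affine_iff[symmetric, where c = d]) auto
  hence "has_bochner_integral lborel (\<lambda>v. ppow s (0 + d * v) * exp (- (0 + d * v)) * d powr (1 - s)) (Gamma s /\<^sub>R \<bar>d\<bar> * d powr (1 - s))"
    by (rule has_bochner_integral_mult_left)
  also have "(\<lambda>v. ppow s (0 + d * v) * exp (- (0 + d * v)) * d powr (1 - s)) = (\<lambda>v. ppow s v * exp (- d * v))"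
  proof
    fix v
    have "max 0 (d * v) = d * max 0 v" using d by (simp add: max_mult_distrib_left)
    hence "ppow s (0 + d * v) = d powr (s - 1) * ppow s v"
      using d by (simp add: ppow_def powr_mult)
    moreover have "d powr (s - 1) * d powr (1 - s) = 1" using d by (simp flip: powr_add)
    ultimately show "ppow s (0 + d * v) * exp (- (0 + d * v)) * d powr (1 - s) = ppow s v * exp (- d * v)"
      by simp
  qed
  also have "Gamma s /\<^sub>R \<bar>d\<bar> * d powr (1 - s) = Gamma s * d powr (- s)"
    using d by (simp add: powr_diff powr_minus field_simps)
  finally show ?thesis .
qed

lemma norm_ppow_exp: "norm (of_real (ppow s v) * exp (- p * of_real v)) = ppow s v * exp (- Re p * v)"
  by (simp add: norm_mult norm_exp_eq_Re)

lemma integrable_mellin_exp: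
  assumes s: "s > 1" and p: "Re p > 0"
  shows "integrable lborel (\<lambda>v. of_real (ppow s v) * exp (- p * of_real v))"
proof (rule Bochner_Integration.integrable_bound[OF integrable.intros[OF mellin_exp_real[OF s p]]])
  have "continuous_on UNIV (\<lambda>v. of_real (ppow s v) * exp (- p * of_real v))" using s by (intro continuous_intros)
  from borel_measurable_continuous_onI[OF this]
  show "(\<lambda>v. of_real (ppow s v) * exp (- p * of_real v)) \<in> borel_measurable lborel" by simp
  show "AE v in lborel. norm (of_real (ppow s v) * exp (- p * of_real v)) \<le> norm (ppow s v * exp (- Re p * v))"
    unfolding norm_ppow_exp by (intro AE_I2) simp
qed

text \<open>For real \<open>p\<close> this is Euler's integral rescaled; analytic continuation in
  \<open>p\<close> replaces a rotation of the ray.\<close>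

lemma mellin_exp:
  fixes p :: complex
  assumes s: "s > 1" and p: "Re p > 0"
  shows "(LBINT v. of_real (ppow s v) * exp (- p * of_real v)) = of_real (Gamma s) * p powr (- of_real s)"
proof (rule analytic_continuation_from_reals[where S = "{p. Re p > 0}" and a = 0 and b = 1 and z = p
      and f = "\<lambda>p. LBINT v. of_real (ppow s v) * exp (- p * of_real v)" and g = "\<lambda>p. of_real (Gamma s) * p powr (- of_real s)"])
  show "(\<lambda>p. LBINT v. of_real (ppow s v) * exp (- p * of_real v)) holomorphic_on {p. Re p > 0}"
  proof (rule holomorphic_on_lborel_integral[where f' = "\<lambda>p v. - of_real v * (of_real (ppow s v) * exp (- p * of_real v))"])
    show "open {p. Re p > 0}" by (rule open_halfspace_Re_gt)
    fix z assume "z \<in> {p. Re p > 0}"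
    hence z: "Re z > 0" by simp
    have "norm (of_real (ppow s v) * exp (- w * of_real v)) \<le> ppow s v * exp (- (Re z / 2) * v)"
      if "w \<in> cball z (Re z / 2)" for w v
    proof (cases "v > 0")
      case True
      have "Re z - Re w \<le> norm (z - w)" using complex_Re_le_cmod[of "z - w"] by simp
      also have "\<dots> \<le> Re z / 2" using that by (simp add: dist_norm)
      finally have "Re z / 2 \<le> Re w" by simp
      hence "Re z / 2 * v \<le> Re w * v" using True by (intro mult_right_mono) auto
      thus ?thesis unfolding norm_ppow_exp by (intro mult_left_mono) auto
    qed (simp add: ppow_nonpos)
    thus "\<exists>r>0. \<exists>g. integrable lborel g \<and> (\<forall>w\<in>cball z r \<inter> {p. Re p > 0}. \<forall>v. norm (of_real (ppow s v) * exp (- w * of_real v)) \<le> g v)"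
      using z integrable.intros[OF mellin_exp_real[OF s, of "Re z / 2"]]
      by (intro exI[of _ "Re z / 2"] conjI exI[of _ "\<lambda>v. ppow s v * exp (- (Re z / 2) * v)"]) auto
  qed (use s in \<open>auto intro!: derivative_eq_intros continuous_intros simp: case_prod_unfold\<close>)
  show "(\<lambda>p. of_real (Gamma s) * p powr (- of_real s)) holomorphic_on {p. Re p > 0}"
    by (auto intro!: holomorphic_intros simp: complex_nonpos_Reals_iff)
  fix x :: real assume x: "0 < x"
  have "(LBINT v. of_real (ppow s v) * exp (- of_real x * of_real v)) = (LBINT v. complex_of_real (ppow s v * exp (- x * v)))"
    by (rule Bochner_Integration.integral_cong) (simp_all flip: exp_of_real)
  also have "\<dots> = of_real (Gamma s * x powr (- s))"
    by (simp only: integral_complex_of_real has_bochner_integral_integral_eq[OF mellin_exp_real[OF s x]])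
  also have "\<dots> = of_real (Gamma s) * of_real x powr (- of_real s)"
    using x by (simp add: powr_of_real flip: of_real_minus)
  finally show "complex_of_real x \<in> {p. Re p > 0} \<and> (LBINT v. complex_of_real (ppow s v) * exp (- complex_of_real x * complex_of_real v))
      = complex_of_real (Gamma s) * complex_of_real x powr (- complex_of_real s)" using x by simp
qed (use p in \<open>auto intro!: convex_connected convex_halfspace_Re_gt open_halfspace_Re_gt\<close>)

section \<open>The line through the origin\<close>

text \<open>Jordan's inequality with half its constant: the mean value theorem where
  \<open>cos \<ge> 1 / 2\<close>, monotonicity beyond.\<close>

lemma sin_ge_half_linear:
  assumes "0 \<le> y" "y \<le> pi / 2"
  shows "sin y \<ge> y / pi"
proof (cases "y \<le> pi / 3")
  case True
  show ?thesis
  proof (cases "y = 0")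
    case False
    hence y: "y > 0" using assms by simp
    have "\<exists>z. 0 < z \<and> z < y \<and> sin y - sin 0 = (y - 0) * cos z"
      by (rule MVT2[OF y]) (auto intro!: derivative_eq_intros)
    then obtain z where z: "0 < z" "z < y" "sin y = y * cos z" by auto
    have "cos z \<ge> cos (pi / 3)" using z True by (intro cos_monotone_0_pi_le) auto
    hence "y * (1 / 2) \<le> y * cos z" using y by (intro mult_left_mono) (auto simp: cos_60)
    moreover have "y / pi \<le> y / 2" using y pi_gt3 by (intro divide_left_mono) auto
    ultimately show ?thesis unfolding z(3) by linarith
  qed simp
next
  case False
  have "sin y \<ge> sin (pi / 6)" using False assms by (intro sin_monotone_2pi_le) auto
  hence "sin y \<ge> 1 / 2" by (simp add: sin_30)
  moreover have "y / pi \<le> 1 / 2" using assms by (simp add: field_simps)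
  ultimately show ?thesis by linarith
qed

lemma norm_sin_pi_ge:
  assumes "\<bar>Re x\<bar> \<le> 1 / 2"
  shows "norm (sin (of_real pi * x)) \<ge> norm x"
proof (rule power2_le_imp_le)
  have "\<bar>Re x\<bar> \<le> \<bar>sin (pi * Re x)\<bar>"
  proof -
    have "\<bar>Re x\<bar> = (pi * \<bar>Re x\<bar>) / pi" by simp
    also have "\<dots> \<le> sin (pi * \<bar>Re x\<bar>)" using assms by (intro sin_ge_half_linear) auto
    also have "\<dots> \<le> \<bar>sin (pi * Re x)\<bar>" by (cases "Re x \<ge> 0") auto
    finally show ?thesis .
  qed
  hence "(Re x)\<^sup>2 \<le> (sin (pi * Re x))\<^sup>2" by (simp add: abs_le_square_iff)
  moreover have "\<bar>Im x\<bar> \<le> \<bar>sinh (pi * Im x)\<bar>"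
  proof -
    have "1 * \<bar>Im x\<bar> \<le> pi * \<bar>Im x\<bar>" using pi_gt3 by (intro mult_right_mono) auto
    also have "\<dots> = \<bar>pi * Im x\<bar>" by (simp add: abs_mult)
    finally show ?thesis using abs_le_abs_sinh[of "pi * Im x"] by simp
  qed
  hence "(Im x)\<^sup>2 \<le> (sinh (pi * Im x))\<^sup>2" by (simp add: abs_le_square_iff)
  ultimately show "(norm x)\<^sup>2 \<le> (norm (sin (of_real pi * x)))\<^sup>2"
    unfolding norm_sin_sq_eq unfolding cmod_power2[of x] by simp
qed simp

lemma one_plus_powr_le:
  assumes "u \<ge> 0" "0 \<le> a" "a \<le> (k::real)"
  shows "(1 + u) powr a \<le> exp (k * u)"
proof -
  have "(1 + u) powr a \<le> (1 + u) powr k" using assms by (intro powr_mono) auto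
  also have "\<dots> \<le> exp u powr k" using assms by (intro powr_mono2) auto
  also have "\<dots> = exp (k * u)" by (simp add: powr_def)
  finally show ?thesis .
qed

text \<open>A majorant uniform in \<open>c\<close>, including \<open>c = 0\<close>, for the
  dominated passage onto the pole. Where \<open>\<bar>Re x\<bar> \<le> 1 / 2\<close> the sine is at
  least \<open>norm x\<close> and costs one power of \<open>x\<close>, leaving the positive exponent
  \<open>s - 2\<close>; elsewhere \<open>c \<le> 1 / 4\<close> forces
  \<open>\<bar>Im x\<bar> \<ge> 1 / 4\<close>.\<close>

lemma RSI_integrand_dom:
  assumes c: "0 \<le> c" "c \<le> 1 / 4" and s: "3 < s" "s < 4"
  shows "norm ((line c u powr of_real (s - 1) * exp (of_real pi * \<i> * (line c u)\<^sup>2)) / (2 * \<i> * sin (of_real pi * line c u)))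
     \<le> gauss_dom 0 (3 + 2 * pi) u"
proof -
  define x where "x = line c u"
  let ?q = "x powr of_real (s - 1) / (2 * \<i> * sin (of_real pi * x))"
  have nx: "norm x \<le> 1 + \<bar>u\<bar>" using norm_line_le[of c u] c by (simp add: x_def)
  have np: "norm (x powr of_real (s - 1)) = norm x powr (s - 1)"
    by (cases "x = 0") (auto simp: norm_powr_real_powr')
  have "norm ?q \<le> exp (3 * \<bar>u\<bar>)"
  proof (cases "\<bar>Re x\<bar> \<le> 1 / 2")
    case True
    show ?thesis
    proof (cases "x = 0")
      case False
      have "norm x \<le> 2 * norm (sin (of_real pi * x))" using norm_sin_pi_ge[OF True] norm_ge_zero[of "sin (of_real pi * x)"] by linarith
      moreover have "norm (sin (of_real pi * x)) > 0" using norm_sin_pi_ge[OF True] False zero_less_norm_iff[of x] by linarith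
      ultimately have "norm ?q \<le> norm x powr (s - 1) / norm x"
        unfolding norm_divide np using False by (intro divide_left_mono) (auto simp: norm_mult)
      also have "\<dots> = norm x powr (s - 2)" using False by (simp add: powr_diff power2_eq_square)
      also have "\<dots> \<le> (1 + \<bar>u\<bar>) powr (s - 2)" using nx s by (intro powr_mono2) auto
      also have "\<dots> \<le> exp (3 * \<bar>u\<bar>)" using s by (intro one_plus_powr_le) auto
      finally show ?thesis .
    qed simp
  next
    case False
    have "\<bar>Im x\<bar> \<ge> 1 / 4" using False c unfolding x_def Re_Im_line by linarith
    hence "1 / 4 * 3 \<le> \<bar>Im x\<bar> * pi" using pi_gt3 by (intro mult_mono) auto
    also have "\<dots> = \<bar>Im (of_real pi * x)\<bar>" by (simp add: abs_mult)
    also have "\<dots> \<le> norm (sin (of_real pi * x))" by (rule norm_sin_ge_Im)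
    finally have "1 \<le> 2 * norm (sin (of_real pi * x))" by simp
    hence "norm ?q \<le> norm x powr (s - 1) / 1"
      unfolding norm_divide np by (intro divide_left_mono) (auto simp: norm_mult)
    also have "\<dots> \<le> (1 + \<bar>u\<bar>) powr (s - 1)" using nx s by (simp add: powr_mono2)
    also have "\<dots> \<le> exp (3 * \<bar>u\<bar>)" using s by (intro one_plus_powr_le) auto
    finally show ?thesis .
  qed
  hence "norm ?q \<le> exp (0 + 3 * \<bar>u\<bar>)" by simp
  from gauss_dom_mult[OF this norm_exp_sq_line_le[of c 1 u]] c
  have "norm (x powr of_real (s - 1) / (2 * \<i> * sin (of_real pi * x)) * exp (of_real pi * \<i> * (line c u)\<^sup>2)) \<le> gauss_dom 0 (3 + 2 * pi) u"
    by simp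
  thus ?thesis unfolding x_def by (simp add: mult_ac)
qed

text \<open>For real \<open>3 < s < 4\<close> the line of integration can be moved onto the pole at \<open>0\<close>, which the factor \<open>x powr (s - 1)\<close> cancels.\<close>

lemma RSI_zero_line:
  assumes s: "3 < s" "s < 4"
  shows "RSI (1 / 2) (of_real (1 - s)) = - line_integral (\<lambda>x. (x powr of_real (s - 1) * exp (of_real pi * \<i> * x\<^sup>2)) / (2 * \<i> * sin (of_real pi * x))) 0"
proof -
  define f where "f = (\<lambda>x. (x powr of_real (s - 1) * exp (of_real pi * \<i> * x\<^sup>2)) / (2 * \<i> * sin (of_real pi * x)))"
  \<comment> \<open>Tends to \<open>0\<close>; the \<open>4\<close> keeps \<open>c n\<close> in the
    range \<open>c \<le> 1 / 4\<close> of the majorant, and between \<open>c n\<close> and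
    \<open>1 / 2\<close> there is no integer.\<close>
  define c where "c = (\<lambda>n::nat. 1 / (real n + 4))"
  have c: "0 < c n" "c n \<le> 1 / 4" "c n < 1 / 2" "c n \<notin> \<int>" for n
  proof -
    show *: "0 < c n" "c n \<le> 1 / 4" "c n < 1 / 2" by (auto simp: c_def field_simps)
    show "c n \<notin> \<int>" using * by (auto elim!: Ints_cases)
  qed
  have c0: "c \<longlonglongrightarrow> 0" unfolding c_def by real_asymp
  have RSI_c: "RSI (1 / 2) (of_real (1 - s)) = - \<omega> * (LBINT u. f (line (c n) u))" for n
  proof -
    have E: "{k::int. c n < of_int k \<and> of_int k < (1 / 2 :: real)} = {}"
      using c(1)[of n] by (auto simp: not_less) (smt (verit) of_int_less_iff of_int_1 of_int_0 c(1) half_gt_zero_iff field_sum_of_halves)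
    have "RSI (1 / 2) (of_real (1 - s)) = RSI (c n) (of_real (1 - s))"
      using RSI_shift[OF c(1,3,4) half_not_Int, of n "of_real (1 - s)", unfolded E] by simp
    also have "\<dots> = - \<omega> * (LBINT u. f (line (c n) u))"
      by (simp add: RSI_def line_integral_def f_def)
    finally show ?thesis .
  qed
  have cont_f: "isCont f x" if "x \<notin> \<real>\<^sub>\<le>\<^sub>0" "sin (of_real pi * x) \<noteq> 0" for x
  proof -
    have "isCont (\<lambda>x. x powr of_real (s - 1)) x" using that by (intro continuous_intros) auto
    thus ?thesis unfolding f_def using that by (intro continuous_intros) auto
  qed
  have "(\<lambda>n. LBINT u. f (line (c n) u)) \<longlonglongrightarrow> (LBINT u. f (line 0 u))"
  proof (rule integral_dominated_convergence[where w = "gauss_dom 0 (3 + 2 * pi)"])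
    show "integrable lborel (gauss_dom 0 (3 + 2 * pi))" by (rule integrable_gauss_dom)
    show "AE u in lborel. norm (f (line (c n) u)) \<le> gauss_dom 0 (3 + 2 * pi) u" for n
      unfolding f_def using c(1,2)[of n] s by (intro AE_I2 RSI_integrand_dom) auto
    \<comment> \<open>The exceptional point \<open>u = 0\<close>, where the limit line meets the
      pole, is a null set.\<close>
    show "AE u in lborel. (\<lambda>n. f (line (c n) u)) \<longlonglongrightarrow> f (line 0 u)"
    proof -
      have "(\<lambda>n. f (line (c n) u)) \<longlonglongrightarrow> f (line 0 u)" if "u \<noteq> 0" for u
      proof (rule isCont_tendsto_compose[OF cont_f])
        have "Im (line 0 u) \<noteq> 0" using that by (simp add: Re_Im_line)
        thus "line 0 u \<notin> \<real>\<^sub>\<le>\<^sub>0" by (auto simp: complex_nonpos_Reals_iff)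
        have "0 < \<bar>Im (of_real pi * line 0 u)\<bar>" using \<open>Im (line 0 u) \<noteq> 0\<close> by simp
        also have "\<dots> \<le> norm (sin (of_real pi * line 0 u))" by (rule norm_sin_ge_Im)
        finally show "sin (of_real pi * line 0 u) \<noteq> 0" by auto
        have "(\<lambda>n. of_real (c n) + \<omega> * of_real u) \<longlonglongrightarrow> of_real 0 + \<omega> * of_real u"
          by (intro tendsto_intros c0)
        thus "(\<lambda>n. line (c n) u) \<longlonglongrightarrow> line 0 u" by (simp add: line_def)
      qed
      with AE_lborel_singleton[of "0::real"] show ?thesis by (auto elim: eventually_mono)
    qed
    show "(\<lambda>u. f (line (c n) u)) \<in> borel_measurable lborel" for n
    proof -
      have "continuous_on UNIV (\<lambda>u. f (line (c n) u))"
      proof (rule continuous_on_compose2[where g = f and t = "range (line (c n))"])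
        show "continuous_on (range (line (c n))) f"
          by (intro continuous_at_imp_continuous_on ballI cont_f)
             (use line_not_nonpos_Reals[OF c(1)] sin_pi_line_nz[OF c(4)] in auto)
      qed (auto intro!: continuous_intros)
      from borel_measurable_continuous_onI[OF this] show ?thesis by simp
    qed
    show "(\<lambda>u. f (line 0 u)) \<in> borel_measurable lborel"
    proof -
      have [measurable]: "(\<lambda>x. exp (of_real pi * \<i> * x\<^sup>2)) \<in> borel_measurable borel"
        "(\<lambda>x. 2 * \<i> * sin (of_real pi * x)) \<in> borel_measurable borel" "(\<lambda>x::complex. exp (of_real (s - 1) * x)) \<in> borel_measurable borel"
        "line 0 \<in> borel_measurable borel"
        by (intro borel_measurable_continuous_onI continuous_intros)+
      have [measurable]: "f \<in> borel_measurable borel" unfolding f_def powr_def by measurable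
      have "(\<lambda>u. f (line 0 u)) \<in> borel_measurable borel" by measurable
      thus ?thesis by simp
    qed
  qed
  from tendsto_mult_left[OF this, of "- \<omega>"]
  have "(\<lambda>n. RSI (1 / 2) (of_real (1 - s))) \<longlonglongrightarrow> - \<omega> * (LBINT u. f (line 0 u))"
    unfolding RSI_c[symmetric] .
  hence "RSI (1 / 2) (of_real (1 - s)) = - \<omega> * (LBINT u. f (line 0 u))"
    by (simp only: LIMSEQ_const_iff)
  thus ?thesis unfolding f_def line_integral_def by simp
qed

section \<open>The Riemann--Siegel formula for real arguments\<close>

lemma omega_exp: "\<omega> = exp (\<i> * of_real (pi / 4))"
  by (simp add: omega_def cis_conv_exp)

lemma Re_omega_line: "Re (of_real (2 * pi) * \<omega> * line c u) = sqrt 2 * pi * c"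
proof -
  have "\<omega> * line c u = of_real c * \<omega> + \<i> * of_real u"
    unfolding line_def distrib_left mult.assoc[symmetric] omega_power2[unfolded power2_eq_square] by (simp add: mult.commute)
  hence "Re (\<omega> * line c u) = c / sqrt 2" by (simp add: omega_Complex)
  hence "Re (of_real (2 * pi) * \<omega> * line c u) = (2 / sqrt 2) * pi * c" by (simp add: mult.assoc)
  also have "2 / sqrt 2 = sqrt (2 :: real)" by (simp add: real_div_sqrt)
  finally show ?thesis .
qed

text \<open>The line stays in the half-plane \<open>Re x > Im x\<close>. So multiplication by
  \<open>\<omega>\<close> does not push the argument across the branch cut, and \<open>powr\<close>
  splits over the product without a correction.\<close>

lemma Arg_line: assumes "c > 0" shows "- (3 * pi / 4) < Im (Ln (line c u))" "Im (Ln (line c u)) < pi / 4"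
proof -
  define x where "x = line c u"
  have x0: "x \<noteq> 0" and xn: "x \<notin> \<real>\<^sub>\<le>\<^sub>0" using assms line_nonzero line_not_nonpos_Reals by (auto simp: x_def)
  define r where "r = norm x"
  define \<theta> where "\<theta> = Im (Ln x)"
  have r: "r > 0" using x0 by (simp add: r_def)
  have "x = exp (Ln x)" using x0 by simp
  also have "\<dots> = of_real r * cis \<theta>" by (simp add: exp_eq_polar x0 r_def \<theta>_def)
  finally have xc: "x = of_real r * cis \<theta>" .
  have "Re x - Im x > 0" using assms by (simp add: x_def Re_Im_line)
  hence "r * (cos \<theta> - sin \<theta>) > 0" unfolding xc by (simp add: algebra_simps)
  hence "cos \<theta> - sin \<theta> > 0" using r zero_less_mult_pos by blast
  moreover have "sin (pi / 4 - \<theta>) = sqrt 2 / 2 * (cos \<theta> - sin \<theta>)"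
    unfolding sin_diff sin_45 cos_45 by (simp add: algebra_simps)
  ultimately have pos: "sin (pi / 4 - \<theta>) > 0" by (simp only: mult_pos_pos) simp
  have th: "- pi < \<theta>" "\<theta> \<le> pi" using mpi_less_Im_Ln[OF x0] Im_Ln_le_pi[OF x0] by (auto simp: \<theta>_def)
  show "\<theta> < pi / 4" unfolding \<theta>_def[symmetric]
  proof (rule ccontr)
    assume "\<not> \<theta> < pi / 4"
    hence "sin (\<theta> - pi / 4) \<ge> 0" using th by (intro sin_ge_zero) auto
    moreover have "sin (\<theta> - pi / 4) = - sin (pi / 4 - \<theta>)" by (metis minus_diff_eq sin_minus)
    ultimately show False using pos by simp
  qed
  show "- (3 * pi / 4) < \<theta>" unfolding \<theta>_def[symmetric]
  proof (rule ccontr)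
    assume "\<not> - (3 * pi / 4) < \<theta>"
    hence "sin (pi / 4 - \<theta>) \<le> 0" using th by (intro sin_le_zero) auto
    thus False using pos by simp
  qed
qed

lemma powr_omega_line:
  assumes "c > 0"
  shows "(of_real (2 * pi) * \<omega> * line c u) powr (- of_real s)
       = of_real ((2 * pi) powr (- s)) * exp (- \<i> * of_real (pi * s / 4)) * line c u powr (- of_real s)"
proof -
  define x where "x = line c u"
  have x0: "x \<noteq> 0" using assms line_nonzero by (auto simp: x_def)
  have "of_real (2 * pi) * \<omega> * x = exp (of_real (ln (2 * pi)) + \<i> * of_real (pi / 4) + Ln x)"
    by (simp only: exp_add omega_exp exp_of_real) (simp add: x0)
  moreover have "Ln (exp (of_real (ln (2 * pi)) + \<i> * of_real (pi / 4) + Ln x)) = of_real (ln (2 * pi)) + \<i> * of_real (pi / 4) + Ln x"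
    by (rule Ln_exp) (use Arg_line[OF assms, of u] in \<open>auto simp: x_def\<close>)
  ultimately have "(of_real (2 * pi) * \<omega> * x) powr (- of_real s) = exp (- of_real s * (of_real (ln (2 * pi)) + \<i> * of_real (pi / 4) + Ln x))"
    using x0 by (simp add: powr_def)
  also have "\<dots> = exp (of_real (- s * ln (2 * pi))) * exp (- \<i> * of_real (pi * s / 4)) * exp (- of_real s * Ln x)"
    by (simp add: exp_add[symmetric] algebra_simps)
  also have "exp (of_real (- s * ln (2 * pi)) :: complex) = of_real ((2 * pi) powr (- s))"
    unfolding exp_of_real by (simp add: powr_def)
  finally show ?thesis using x0 by (simp add: powr_def x_def)
qed

text \<open>This is \<open>Gamma s\<close> times the principal value of
  \<open>(2 * pi * \<omega>) powr (- s)\<close>.\<close>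

definition mell_fac :: "real \<Rightarrow> complex" where
  "mell_fac s = of_real (Gamma s) * (of_real ((2 * pi) powr (- s)) * exp (- \<i> * of_real (pi * s / 4)))"

lemma mellin_line:
  assumes "s > 1" "c > 0"
  shows "(LBINT v. of_real (ppow s v) * exp (- (of_real (2 * pi) * \<omega> * line c u) * of_real v)) = mell_fac s * line c u powr (- of_real s)"
proof -
  have "Re (of_real (2 * pi) * \<omega> * line c u) > 0" unfolding Re_omega_line using assms by simp
  from mellin_exp[OF assms(1) this] show ?thesis
    unfolding powr_omega_line[OF assms(2)] mell_fac_def by (simp only: mult.assoc)
qed

text \<open>Fubini applies because \<open>Re (\<omega> * x)\<close> is constant on the line, so the decay along the ray is uniform in \<open>x\<close>.\<close>

lemma mellin_mordell:
  assumes s: "s > 1"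
  shows "(LBINT v. of_real (ppow s v) * - line_integral (mordell (\<i> * \<omega> * of_real v)) (1 / 2)) = mell_fac s * RSI (1 / 2) (of_real s)" (is ?A)
    and "integrable lborel (\<lambda>v. of_real (ppow s v) * - line_integral (mordell (\<i> * \<omega> * of_real v)) (1 / 2))" (is ?B)
proof -
  let ?M = "\<lambda>v. of_real (ppow s v) * - line_integral (mordell (\<i> * \<omega> * of_real v)) (1 / 2)"
  let ?k = "\<lambda>u. (line (1/2) u powr (- of_real s) * exp (of_real pi * \<i> * (line (1/2) u)\<^sup>2)) / (2 * \<i> * sin (of_real pi * line (1/2) u))"
  define K where "K = (\<lambda>u. mordell 0 (line (1/2) u))"
  \<comment> \<open>With \<open>y = \<i> * \<omega> * v\<close> the term
    \<open>2 * pi * \<i> * x * y\<close> equals \<open>- 2 * pi * \<omega> * x * v\<close>, so the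
    dependence of \<open>mordell\<close> on \<open>y\<close> is precisely a Mellin kernel
    \<open>exp (- p u * v)\<close>.\<close>
  define p where "p = (\<lambda>u. of_real (2 * pi) * \<omega> * line (1/2) u)"
  define F where "F = (\<lambda>u v. of_real (ppow s v) * exp (- p u * of_real v) * K u)"
  have F_eq: "F u v = of_real (ppow s v) * mordell (\<i> * \<omega> * of_real v) (line (1/2) u)" for u v
  proof -
    have "mordell (\<i> * \<omega> * of_real v) (line (1/2) u) = exp (- p u * of_real v) * K u"
      unfolding mordell_def K_def p_def times_divide_eq_right exp_add[symmetric]
      by (rule arg_cong[of _ _ "\<lambda>e. exp e / _"]) (simp add: algebra_simps)
    thus ?thesis by (simp add: F_def)
  qed
  have Rep: "Re (p u) = sqrt 2 * pi * (1 / 2)" for u by (simp only: p_def Re_omega_line)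
  have Rep0: "Re (p u) > 0" for u unfolding Rep by simp
  have contK: "continuous_on S (\<lambda>x. K (f x))" if "continuous_on S f" for S and f :: "real \<times> real \<Rightarrow> real"
    unfolding K_def mordell_def using sin_pi_line_nz[OF half_not_Int] by (intro continuous_intros that) auto
  have contF: "continuous_on UNIV (\<lambda>(u, v). F u v)"
    unfolding F_def p_def case_prod_unfold using s by (intro continuous_intros contK)
  have intK: "integrable lborel K" unfolding K_def by (rule integrable_mordell[OF half_not_Int])
  have normF: "norm (F u v) = norm (K u) * (ppow s v * exp (- (sqrt 2 * pi * (1 / 2)) * v))" for u v
    unfolding F_def norm_mult[of _ "K u"] norm_ppow_exp Rep by simp
  have intFv: "integrable lborel (\<lambda>v. F u v)" for u
    unfolding F_def using integrable_mellin_exp[OF s Rep0[of u]] by (rule integrable_mult_left)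
  have meas: "(\<lambda>(u, v). F u v) \<in> borel_measurable (lborel \<Otimes>\<^sub>M lborel)"
    using borel_measurable_continuous_onI[OF contF] by (simp add: lborel_prod)
  have intF: "integrable (lborel \<Otimes>\<^sub>M lborel) (\<lambda>(u, v). F u v)"
  proof (rule lborel_pair.Fubini_integrable[OF meas])
    have "(LBINT v. norm (F u v)) = norm (K u) * (Gamma s * (sqrt 2 * pi * (1 / 2)) powr (- s))" for u
      unfolding normF by (simp only: integral_mult_right_zero has_bochner_integral_integral_eq[OF mellin_exp_real[OF s Rep0[unfolded Rep]]])
    thus "integrable lborel (\<lambda>u. LBINT v. norm (case (u, v) of (u, v) \<Rightarrow> F u v))"
      using intK by simp
    show "AE u in lborel. integrable lborel (\<lambda>v. case (u, v) of (u, v) \<Rightarrow> F u v)"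
      using intFv by simp
  qed
  have inner: "(LBINT u. F u v) = of_real (ppow s v) * (LBINT u. mordell (\<i> * \<omega> * of_real v) (line (1/2) u))" for v
    unfolding F_eq by (rule integral_mult_right_zero)
  have eq: "?M v = - \<omega> * (LBINT u. F u v)" for v
    unfolding inner line_integral_def by simp
  have "integrable lborel (\<lambda>v. LBINT u. F u v)"
    by (rule lborel_pair.integrable_snd[OF intF])
  thus ?B unfolding eq by (rule integrable_mult_right)
  have "(LBINT v. ?M v) = - \<omega> * (LBINT v. LBINT u. F u v)"
    unfolding eq by (rule integral_mult_right_zero)
  also have "(LBINT v. LBINT u. F u v) = (LBINT u. LBINT v. F u v)"
    by (rule lborel_pair.Fubini_integral[OF intF])
  also have "(\<lambda>u. LBINT v. F u v) = (\<lambda>u. mell_fac s * ?k u)"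
  proof
    fix u
    have "(LBINT v. F u v) = (LBINT v. of_real (ppow s v) * exp (- p u * of_real v)) * K u"
      unfolding F_def by (rule integral_mult_left_zero)
    also have "(LBINT v. of_real (ppow s v) * exp (- p u * of_real v)) = mell_fac s * line (1/2) u powr (- of_real s)"
      unfolding p_def using s by (intro mellin_line) auto
    finally show "(LBINT v. F u v) = mell_fac s * ?k u"
      by (simp add: K_def mordell_def)
  qed
  also have "- \<omega> * (LBINT u. mell_fac s * ?k u)
     = mell_fac s * RSI (1 / 2) (of_real s)"
    unfolding integral_mult_right_zero RSI_def line_integral_def by simp
  finally show ?A .
qed

text \<open>On this ray \<open>y\<^sup>2 = - \<i> * v\<^sup>2\<close>, so the Gaussian in Mordell's
  formula becomes the real \<open>exp (- pi * v\<^sup>2)\<close>. The first summand is the sum of a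
  geometric series and leads to the Dirichlet series; the second leads to the dual integral.\<close>

lemma mordell_ray:
  assumes v: "v > 0"
  defines "q \<equiv> exp (- (of_real (2 * pi) * \<omega> * of_real v))"
  shows "norm q < 1"
    and "- line_integral (mordell (\<i> * \<omega> * of_real v)) (1 / 2)
       = q / (1 - q) + of_real (exp (- pi * v\<^sup>2)) / (2 * \<i> * sin (of_real pi * (\<i> * \<omega> * of_real v)))"
proof -
  define y where "y = \<i> * \<omega> * of_real v"
  have qy: "q = exp (2 * pi * \<i> * y)" by (simp add: q_def y_def algebra_simps)
  show nq: "norm q < 1" using v by (simp add: q_def norm_exp_eq_Re omega_Complex)
  hence q1: "q \<noteq> 1" by auto
  have y2: "y\<^sup>2 = - \<i> * of_real (v\<^sup>2)" by (simp add: y_def power_mult_distrib omega_power2)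
  \<comment> \<open>A square root of \<open>q\<close>, in terms of which both
    \<open>exp (- pi * \<i> * y)\<close> and the sine are rational.\<close>
  define E where "E = exp (of_real pi * \<i> * y)"
  have E: "E \<noteq> 0" "q = E * E" by (simp_all add: E_def qy flip: exp_add) (simp add: algebra_simps)
  have sE: "2 * \<i> * sin (of_real pi * y) = E - 1 / E"
    by (simp add: sin_exp_eq E_def exp_minus field_simps)
  have "- pi * \<i> * (y\<^sup>2 + y) = - pi * \<i> * y\<^sup>2 - of_real pi * \<i> * y" by (simp add: algebra_simps)
  hence "exp (- pi * \<i> * (y\<^sup>2 + y)) = exp (- pi * \<i> * y\<^sup>2) / E"
    by (simp only: E_def exp_diff)
  also have "- pi * \<i> * y\<^sup>2 = of_real (- pi * v\<^sup>2)" unfolding y2 by (simp add: algebra_simps)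
  finally have e: "exp (- pi * \<i> * (y\<^sup>2 + y)) = of_real (exp (- pi * v\<^sup>2)) / E"
    by (simp only: exp_of_real)
  have nz: "E * E \<noteq> 1" using q1 E by simp
  have "- line_integral (mordell y) (1 / 2) = - (q * (1 - of_real (exp (- pi * v\<^sup>2)) / E) / (q - 1))"
    using mordell_eval[of y] q1 unfolding qy[symmetric] e by simp
  also have "\<dots> = q / (1 - q) + of_real (exp (- pi * v\<^sup>2)) / (E - 1 / E)"
  proof -
    have "E - 1 / E = (E * E - 1) / E" using E(1) by (simp add: field_simps)
    moreover have "1 - E * E = - (E * E - 1)" by simp
    moreover have "E * E - 1 \<noteq> 0" using nz by simp
    ultimately show ?thesis unfolding E(2) using E(1)
      by (simp only: divide_minus_right) (simp add: divide_simps, simp add: algebra_simps)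
  qed
  finally show "- line_integral (mordell (\<i> * \<omega> * of_real v)) (1 / 2)
       = q / (1 - q) + of_real (exp (- pi * v\<^sup>2)) / (2 * \<i> * sin (of_real pi * (\<i> * \<omega> * of_real v)))"
    unfolding y_def[symmetric] sE .
qed


text \<open>Termwise integration of the geometric series; the integrals of the norms are multiples
  of \<open>Suc n powr (- s)\<close>, summable because \<open>s > 1\<close>.\<close>

lemma mellin_geometric:
  assumes s: "s > 1"
  defines "G \<equiv> (\<lambda>v. of_real (ppow s v) * (exp (- (of_real (2 * pi) * \<omega> * of_real v)) / (1 - exp (- (of_real (2 * pi) * \<omega> * of_real v)))))"
  shows "integrable lborel G" "(LBINT v. G v) = mell_fac s * (\<Sum>n. 1 / of_nat (Suc n) powr of_real s)"
proof -
  \<comment> \<open>\<open>line (Suc n) 0\<close> is just the integer \<open>Suc n\<close>; written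
    this way, the term is evaluated by \<open>mellin_line\<close>.\<close>
  define f where "f = (\<lambda>n v. of_real (ppow s v) * exp (- (of_real (2 * pi) * \<omega> * line (real (Suc n)) 0) * of_real v))"
  have Re_p: "Re (of_real (2 * pi) * \<omega> * line (real (Suc n)) 0) = sqrt 2 * pi * real (Suc n)" for n
    by (rule Re_omega_line)
  have p: "sqrt 2 * pi * real (Suc n) > 0" for n by simp
  have nf: "norm (f n v) = ppow s v * exp (- (sqrt 2 * pi * real (Suc n)) * v)" for n v
    unfolding f_def norm_ppow_exp Re_p ..
  have f_geo: "f n v = of_real (ppow s v) * exp (- (of_real (2 * pi) * \<omega> * of_real v)) ^ Suc n" for n v
    unfolding f_def exp_of_nat_mult[symmetric] by (simp add: line_def mult_ac)
  have geo: "(\<lambda>n. f n v) sums G v" "summable (\<lambda>n. norm (f n v))" for v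
  proof -
    define q where "q = exp (- (of_real (2 * pi) * \<omega> * of_real v))"
    have "(\<lambda>n. f n v) sums G v \<and> summable (\<lambda>n. norm (f n v))"
    proof (cases "v > 0")
      case False
      thus ?thesis by (simp add: f_def G_def ppow_nonpos)
    next
      case True
      have q: "norm q < 1" unfolding q_def by (rule mordell_ray(1)[OF True])
      have "(\<lambda>n. of_real (ppow s v) * q * q ^ n) sums (of_real (ppow s v) * q * (1 / (1 - q)))"
        by (intro sums_mult geometric_sums q)
      moreover have "summable (\<lambda>n. ppow s v * norm q * norm q ^ n)"
        using q by (intro summable_mult summable_geometric) simp
      ultimately show ?thesis
        unfolding f_geo G_def q_def[symmetric] by (simp add: norm_mult norm_power mult_ac)
    qed
    thus "(\<lambda>n. f n v) sums G v" "summable (\<lambda>n. norm (f n v))" by auto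
  qed
  have int: "integrable lborel (f n)" for n
    unfolding f_def by (rule integrable_mellin_exp[OF s]) (unfold Re_p, rule p)
  have nint: "(LBINT v. norm (f n v)) = Gamma s * (sqrt 2 * pi) powr (- s) * real (Suc n) powr (- s)" for n
    unfolding nf has_bochner_integral_integral_eq[OF mellin_exp_real[OF s p]] by (simp add: powr_mult)
  have "summable (\<lambda>n. real (Suc n) powr (- s))"
    using s by (subst summable_Suc_iff) (simp add: summable_real_powr_iff)
  hence summ: "summable (\<lambda>n. LBINT v. norm (f n v))" unfolding nint by (rule summable_mult)
  have val: "(LBINT v. f n v) = mell_fac s * (1 / of_nat (Suc n) powr of_real s)" for n
    unfolding f_def by (subst mellin_line[OF s]) (simp_all add: line_def powr_minus divide_inverse)
  have sum_eq: "(\<lambda>v. \<Sum>n. f n v) = G" using geo(1) by (auto simp: sums_iff)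
  show "integrable lborel G"
    unfolding sum_eq[symmetric] by (rule integrable_suminf[OF int AE_I2[OF geo(2)] summ])
  have "(\<lambda>n. LBINT v. f n v) sums (LBINT v. G v)"
    unfolding sum_eq[symmetric] by (rule sums_integral[OF int AE_I2[OF geo(2)] summ])
  hence sums: "(\<lambda>n. mell_fac s * (1 / of_nat (Suc n) powr of_real s)) sums (LBINT v. G v)" unfolding val .
  have "Gamma s > 0" using s by (intro Gamma_real_pos) auto
  hence "mell_fac s \<noteq> 0" by (simp add: mell_fac_def)
  hence "summable (\<lambda>n. 1 / of_nat (Suc n) powr of_real s :: complex)"
    using sums_summable[OF sums] by (simp only: summable_cmult_iff) simp
  from suminf_mult[OF this, of "mell_fac s"] sums_unique[OF sums]
  show "(LBINT v. G v) = mell_fac s * (\<Sum>n. 1 / of_nat (Suc n) powr of_real s)" by (simp only:)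
qed

text \<open>The second summand of \<open>mordell_ray\<close> with its Mellin weight.\<close>

definition ray_term :: "real \<Rightarrow> real \<Rightarrow> complex" where
  "ray_term s v = of_real (ppow s v) * (of_real (exp (- pi * v\<^sup>2)) / (2 * \<i> * sin (of_real pi * (\<i> * \<omega> * of_real v))))"

text \<open>Integrability of \<open>ray_term\<close>, which behaves like
  \<open>v powr (s - 2)\<close> near \<open>0\<close>, is inherited from the other two integrands
  instead of being estimated.\<close>

lemma RS_ray:
  assumes s: "s > 1"
  shows "integrable lborel (ray_term s)"
    "mell_fac s * RSI (1 / 2) (of_real s) = mell_fac s * (\<Sum>n. 1 / of_nat (Suc n) powr of_real s) + (LBINT v. ray_term s v)"
proof -
  define G where "G = (\<lambda>v. of_real (ppow s v) * (exp (- (of_real (2 * pi) * \<omega> * of_real v)) / (1 - exp (- (of_real (2 * pi) * \<omega> * of_real v)))))"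
  define M where "M = (\<lambda>v. of_real (ppow s v) * - line_integral (mordell (\<i> * \<omega> * of_real v)) (1 / 2))"
  have G: "integrable lborel G" "(LBINT v. G v) = mell_fac s * (\<Sum>n. 1 / of_nat (Suc n) powr of_real s)"
    unfolding G_def by (rule mellin_geometric[OF s])+
  have M: "(LBINT v. M v) = mell_fac s * RSI (1 / 2) (of_real s)" "integrable lborel M"
    unfolding M_def by (rule mellin_mordell[OF s])+
  have eq: "ray_term s = (\<lambda>v. M v - G v)"
  proof
    fix v show "ray_term s v = M v - G v"
    proof (cases "v > 0")
      case True
      show ?thesis unfolding ray_term_def M_def G_def mordell_ray(2)[OF True] by (simp add: algebra_simps)
    qed (simp add: ray_term_def M_def G_def ppow_nonpos)
  qed
  show "integrable lborel (ray_term s)" unfolding eq using M(2) G(1) by (rule Bochner_Integration.integrable_diff)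
  have "(LBINT v. ray_term s v) = (LBINT v. M v) - (LBINT v. G v)"
    unfolding eq by (rule Bochner_Integration.integral_diff[OF M(2) G(1)])
  thus "mell_fac s * RSI (1 / 2) (of_real s) = mell_fac s * (\<Sum>n. 1 / of_nat (Suc n) powr of_real s) + (LBINT v. ray_term s v)"
    unfolding M G by simp
qed

lemma powr_pos_mult_polar:
  assumes "v > 0" "-pi < \<theta>" "\<theta> \<le> pi"
  shows "(exp (\<i> * of_real \<theta>) * of_real v) powr (of_real a) = exp (\<i> * of_real (\<theta> * a)) * of_real (v powr a)"
proof -
  have "exp (\<i> * of_real \<theta>) * of_real v = exp (of_real (ln v) + \<i> * of_real \<theta>)"
    using assms by (simp only: exp_add exp_of_real) simp
  moreover have "Ln (exp (of_real (ln v) + \<i> * of_real \<theta>)) = of_real (ln v) + \<i> * of_real \<theta>"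
    using assms by (intro Ln_exp) auto
  ultimately have "(exp (\<i> * of_real \<theta>) * of_real v) powr (of_real a) = exp (of_real a * (of_real (ln v) + \<i> * of_real \<theta>))"
    by (simp add: powr_def)
  also have "\<dots> = exp (\<i> * of_real (\<theta> * a)) * exp (of_real (a * ln v))"
    by (simp add: exp_add[symmetric] algebra_simps)
  also have "exp (of_real (a * ln v) :: complex) = of_real (v powr a)"
    unfolding exp_of_real using assms by (simp add: powr_def)
  finally show ?thesis .
qed

text \<open>The origin splits the line into rays of argument \<open>pi / 4\<close> and
  \<open>- (3 * pi / 4)\<close>. On each, the power is a fixed phase times
  \<open>\<bar>u\<bar> powr (s - 1)\<close>; as the sine is odd, both parts are multiples of one
  integral \<open>S\<close>, and the phases combine to the cosine. Since
  \<open>cnj \<omega> = - (\<i> * \<omega>)\<close>, conjugation carries \<open>S\<close> to the ray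
  of \<open>ray_term\<close>.\<close>

lemma cnj_RSI_ray:
  assumes s: "3 < s" "s < 4"
  shows "cnj (RSI (1 / 2) (of_real (1 - s))) = - exp (\<i> * of_real (pi * s / 4)) * (2 * cos (of_real (pi * s / 2))) *
     (LBINT v. ray_term s v)"
proof -
  define T where "T = ray_term s"
  define H where "H = (\<lambda>v. of_real (ppow s v) * (of_real (exp (- pi * v\<^sup>2)) / sin (of_real pi * (\<omega> * of_real v))))"
  have intT: "integrable lborel T" unfolding T_def using s by (intro RS_ray) auto
  have cnj_om: "cnj \<omega> = - (\<i> * \<omega>)" by (simp add: omega_Complex complex_eq_iff)
  have sin_eq: "sin (of_real pi * (\<i> * \<omega> * of_real v)) = - cnj (sin (of_real pi * (\<omega> * of_real v)))" for v
  proof -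
    have "cnj (sin (of_real pi * (\<omega> * of_real v))) = sin (of_real pi * (cnj \<omega> * of_real v))" by (simp add: cnj_sin)
    also have "\<dots> = sin (- (of_real pi * (\<i> * \<omega> * of_real v)))" unfolding cnj_om by simp
    finally show ?thesis by (simp only: sin_minus minus_minus)
  qed
  have TH: "T = (\<lambda>v. - (1 / (2 * \<i>)) * cnj (H v))"
  proof
    have "a * (b / (2 * \<i> * (- y))) = - (1 / (2 * \<i>)) * (a * (b / y))" for a b y :: complex
      by (cases "y = 0") (simp_all add: field_simps)
    thus "T v = - (1 / (2 * \<i>)) * cnj (H v)" for v
      unfolding T_def ray_term_def H_def sin_eq by simp
  qed
  have HT: "H = (\<lambda>v. 2 * \<i> * cnj (T v))" unfolding TH by (rule ext) simp
  have intH: "integrable lborel H" unfolding HT using intT by (intro integrable_mult_right) simp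
  define S where "S = (LBINT v. H v)"
  have T_S: "(LBINT v. T v) = - (1 / (2 * \<i>)) * cnj S"
    unfolding TH S_def integral_mult_right_zero by (simp only: Bochner_Integration.integral_cnj)
  define a1 where "a1 = exp (\<i> * of_real (pi / 4 * (s - 1)))"
  define a2 where "a2 = exp (\<i> * of_real (- (3 * pi / 4) * (s - 1)))"
  have pt: "(line 0 u powr of_real (s - 1) * exp (of_real pi * \<i> * (line 0 u)\<^sup>2)) / (2 * \<i> * sin (of_real pi * line 0 u))
      = 1 / (2 * \<i>) * (a1 * H u - a2 * H (0 + (- 1) * u))" for u
  proof -
    have l0: "line 0 u = \<omega> * of_real u" by (simp add: line_def)
    have "of_real pi * \<i> * (line 0 u)\<^sup>2 = of_real (- pi * u\<^sup>2)"
      unfolding l0 power_mult_distrib omega_power2 by (simp add: algebra_simps)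
    hence e: "exp (of_real pi * \<i> * (line 0 u)\<^sup>2) = of_real (exp (- pi * u\<^sup>2))" by (simp only: exp_of_real)
    have rearr: "a * p * b / (2 * \<i> * x) = 1 / (2 * \<i>) * (a * (p * (b / x)))" for a p b x :: complex
      by (simp only: divide_inverse inverse_mult_distrib mult_ac mult_1_left)
    consider "u = 0" | "u > 0" | "u < 0" by linarith
    thus ?thesis
    proof cases
      case 1
      thus ?thesis by (simp add: line_def H_def ppow_nonpos)
    next
      case 2
      have "line 0 u powr of_real (s - 1) = a1 * of_real (ppow s u)"
        unfolding l0 omega_exp a1_def using 2 by (subst powr_pos_mult_polar) (auto simp: ppow_def)
      moreover have "H (0 + (- 1) * u) = 0" using 2 by (simp add: H_def ppow_nonpos)
      ultimately show ?thesis unfolding e by (simp only: rearr H_def l0 mult_zero_right diff_zero)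
    next
      case 3
      \<comment> \<open>The principal argument for \<open>u < 0\<close> is
        \<open>- (3 * pi / 4)\<close> and not \<open>5 * pi / 4\<close>; this choice decides the
        second phase.\<close>
      have "\<omega> * of_real u = exp (\<i> * of_real (- (3 * pi / 4))) * of_real (- u)"
      proof -
        have "\<i> * of_real (- (3 * pi / 4)) = \<i> * of_real (pi / 4) - \<i> * of_real pi" by (simp add: field_simps)
        hence "exp (\<i> * of_real (- (3 * pi / 4))) = \<omega> / exp (\<i> * of_real pi)" by (simp only: exp_diff omega_exp)
        thus ?thesis by (simp add: exp_pi_i')
      qed
      hence "line 0 u powr of_real (s - 1) = a2 * of_real (ppow s (- u))"
        unfolding l0 a2_def using 3 by (simp only:) (subst powr_pos_mult_polar, auto simp: ppow_def intro: order.trans[of _ 0])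
      moreover have "H u = 0" using 3 by (simp add: H_def ppow_nonpos)
      moreover have "H (0 + (- 1) * u) = - (of_real (ppow s (- u)) * (of_real (exp (- pi * u\<^sup>2)) / sin (of_real pi * (\<omega> * of_real u))))"
        by (simp add: H_def)
      ultimately show ?thesis unfolding e by (simp only: rearr l0 mult_zero_right diff_0 mult_minus_right minus_minus)
    qed
  qed
  have "(LBINT u. H (0 + (- 1) * u)) = S"
    using lborel_integral_real_affine[of "-1" H 0] by (simp add: S_def)
  moreover have "integrable lborel (\<lambda>u. H (0 + (- 1) * u))"
    using lborel_integrable_real_affine[OF intH, of "-1" 0] by simp
  ultimately have "(LBINT u. 1 / (2 * \<i>) * (a1 * H u - a2 * H (0 + (- 1) * u))) = 1 / (2 * \<i>) * (a1 * S - a2 * S)"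
    using intH by (simp only: integral_mult_right_zero Bochner_Integration.integral_diff integrable_mult_right S_def[symmetric])
  hence R: "RSI (1 / 2) (of_real (1 - s)) = - (\<omega> * (1 / (2 * \<i>) * (a1 * S - a2 * S)))"
    unfolding RSI_zero_line[OF s] line_integral_def pt by simp
  have "cnj (RSI (1 / 2) (of_real (1 - s))) = cnj \<omega> * (cnj a1 - cnj a2) * (1 / (2 * \<i>) * cnj S)"
    unfolding R by (simp add: algebra_simps diff_divide_distrib)
  also have "1 / (2 * \<i>) * cnj S = - (LBINT v. T v)" unfolding T_S by simp
  also have "cnj \<omega> * (cnj a1 - cnj a2) = exp (\<i> * of_real (pi * s / 4)) * (2 * cos (of_real (pi * s / 2)))"
  proof -
    have c1: "cnj \<omega> * cnj a1 = exp (\<i> * of_real (- (pi * s / 4)))"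
      unfolding omega_exp a1_def exp_cnj exp_add[symmetric]
      by (rule arg_cong[of _ _ exp]) (simp add: algebra_simps add_divide_distrib diff_divide_distrib)
    have "cnj \<omega> * cnj a2 = exp (\<i> * of_real (3 * pi * s / 4) - \<i> * of_real pi)"
      unfolding omega_exp a2_def exp_cnj exp_add[symmetric]
      by (rule arg_cong[of _ _ exp]) (simp add: field_simps)
    hence c2: "cnj \<omega> * cnj a2 = - exp (\<i> * of_real (3 * pi * s / 4))" by (simp add: exp_diff exp_pi_i')
    have "2 * cos (of_real (pi * s / 2)) = exp (\<i> * of_real (pi * s / 2)) + exp (\<i> * of_real (- (pi * s / 2)))"
      by (simp add: cos_exp_eq)
    hence "exp (\<i> * of_real (pi * s / 4)) * (2 * cos (of_real (pi * s / 2))) =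
        exp (\<i> * of_real (pi * s / 4) + \<i> * of_real (pi * s / 2)) + exp (\<i> * of_real (pi * s / 4) + \<i> * of_real (- (pi * s / 2)))"
      by (simp only: exp_add distrib_left)
    also have "\<i> * of_real (pi * s / 4) + \<i> * of_real (pi * s / 2) = \<i> * of_real (3 * pi * s / 4)" by (simp add: field_simps)
    also have "\<i> * of_real (pi * s / 4) + \<i> * of_real (- (pi * s / 2)) = \<i> * of_real (- (pi * s / 4))" by (simp add: field_simps)
    finally show ?thesis unfolding right_diff_distrib c1 c2 by simp
  qed
  finally show ?thesis unfolding T_def by simp
qed

text \<open>The factor in the functional equation
  \<open>zeta s = chi s * zeta (1 - s)\<close>.\<close>

definition chi :: "complex \<Rightarrow> complex" where
  "chi s = 2 powr s * of_real pi powr (s - 1) * sin (of_real pi * s / 2) * Gamma (1 - s)"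

text \<open>\<open>RS_ray\<close> and \<open>cnj_RSI_ray\<close> involve the same integral over the
  ray. Eliminating it leaves the formula, which requires
  \<open>cos (pi * s / 2) \<noteq> 0\<close>.\<close>

lemma RS_formula_real:
  assumes s: "3 < s" "s < 4"
  shows "(\<Sum>n. 1 / of_nat (Suc n) powr of_real s) = RSI (1 / 2) (of_real s) + chi (of_real s) * cnj (RSI (1 / 2) (1 - cnj (of_real s)))"
proof -
  define Z :: complex where "Z = (\<Sum>n. 1 / of_nat (Suc n) powr of_real s)"
  define T where "T = (LBINT v. ray_term s v)"
  define C where "C = cnj (RSI (1 / 2) (of_real (1 - s)))"
  define e where "e = exp (\<i> * of_real (pi * s / 4))"
  define co :: complex where "co = cos (of_real (pi * s / 2))"
  define si :: complex where "si = sin (of_real (pi * s / 2))"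
  have 1: "mell_fac s * RSI (1 / 2) (of_real s) = mell_fac s * Z + T"
    unfolding Z_def T_def using s by (intro RS_ray) auto
  have 2: "C = - e * (2 * co) * T"
    unfolding C_def e_def co_def T_def by (rule cnj_RSI_ray[OF s])
  have Gs: "Gamma s > 0" using s by (intro Gamma_real_pos) auto
  have mf: "mell_fac s = of_real (Gamma s) * of_real ((2 * pi) powr (- s)) / e"
  proof -
    have "exp (- \<i> * of_real (pi * s / 4)) * e = 1" unfolding e_def exp_add[symmetric] by simp
    hence "exp (- \<i> * of_real (pi * s / 4)) = 1 / e" by (simp add: e_def eq_divide_eq)
    thus ?thesis unfolding mell_fac_def by (simp only: times_divide_eq_right mult_1_right)
  qed
  have "pi * 3 < pi * s" "pi * s < pi * 4" using s by simp_all
  \<comment> \<open>Shifting by \<open>3 * pi\<close> brings \<open>pi * s\<close> into the interval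
    from \<open>0\<close> to \<open>pi\<close>. By the double angle formula neither
    \<open>si\<close> nor \<open>co\<close> vanishes.\<close>
  hence "sin (pi * s - 3 * pi) > 0" by (intro sin_gt_zero) linarith+
  moreover have "sin (pi * s - 3 * pi) = - sin (pi * s)"
  proof -
    have "sin (pi * s - 3 * pi) = sin (pi * s) * cos (3 * pi) - cos (pi * s) * sin (3 * pi)" by (rule sin_diff)
    moreover have "cos (3 * pi) = - 1" using cos_npi[of 3] by simp
    moreover have "sin (3 * pi) = 0" using sin_npi[of 3] by simp
    ultimately show ?thesis by simp
  qed
  ultimately have "sin (pi * s) \<noteq> 0" by simp
  hence "complex_of_real (sin (pi * s)) \<noteq> 0" by simp
  moreover have sin2: "complex_of_real (sin (pi * s)) = 2 * si * co"
    using sin_double[of "pi * s / 2"] by (simp add: si_def co_def flip: sin_of_real cos_of_real)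
  ultimately have nz: "si \<noteq> 0" "co \<noteq> 0" by auto
  \<comment> \<open>Reflection removes \<open>Gamma (1 - s)\<close> and brings \<open>chi\<close> to
    the form \<open>(2 * pi) powr s / (2 * cos (pi * s / 2) * Gamma s)\<close>, which matches the
    inverse of \<open>mell_fac\<close>.\<close>
  have "Gamma (of_real s) * Gamma (1 - of_real s) = of_real pi / sin (of_real pi * of_real s :: complex)"
    by (rule Gamma_reflection_complex)
  also have "sin (of_real pi * of_real s :: complex) = 2 * si * co"
    unfolding sin2[symmetric] by (simp flip: sin_of_real)
  finally have GG: "Gamma (of_real s) * Gamma (1 - of_real s) = of_real pi / (2 * si * co)" .
  have Gr: "Gamma (1 - of_real s) = of_real pi / (2 * si * co * of_real (Gamma s))"
  proof -
    from GG have "Gamma (1 - of_real s) * of_real (Gamma s) = of_real pi / (2 * si * co)"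
      by (simp only: Gamma_complex_of_real mult.commute)
    moreover have "complex_of_real (Gamma s) \<noteq> 0" using Gs by simp
    ultimately have "Gamma (1 - of_real s) = of_real pi / (2 * si * co) / of_real (Gamma s)"
      using nonzero_eq_divide_eq[THEN iffD2] by blast
    thus ?thesis by (simp only: divide_divide_eq_left)
  qed
  have "2 powr of_real s * of_real pi powr (of_real s - 1) = complex_of_real (2 powr s * pi powr (s - 1))"
    using powr_of_real[of 2 s] powr_of_real[of pi "s - 1"] by simp
  also have "2 powr s * pi powr (s - 1) = (2 * pi) powr s / pi"
    by (simp add: powr_mult powr_diff)
  finally have chi: "chi (of_real s) = of_real ((2 * pi) powr s) / (2 * co * of_real (Gamma s))"
    unfolding chi_def Gr using nz by (simp add: si_def mult_ac)
  have e0: "e \<noteq> 0" by (simp add: e_def)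
  have "T = - C / (e * (2 * co))" using 2 nz e0 by (simp add: field_simps)
  moreover have mf0: "mell_fac s \<noteq> 0" using Gs e0 unfolding mf by simp
  hence "Z = RSI (1 / 2) (of_real s) - T / mell_fac s" using 1 by (simp add: field_simps)
  ultimately have "Z = RSI (1 / 2) (of_real s) + C / (e * (2 * co) * mell_fac s)"
    by (simp add: field_simps)
  also have "C / (e * (2 * co) * mell_fac s) = chi (of_real s) * C"
    unfolding mf chi using e0 nz Gs by (simp add: powr_minus field_simps)
  finally show ?thesis by (simp add: Z_def C_def)
qed

section \<open>Continuation of zeta\<close>

definition zeta_series :: "complex \<Rightarrow> complex" where
  "zeta_series s = (\<Sum>n. 1 / of_nat (Suc n) powr s)"

lemma zeta_series_holomorphic: "zeta_series holomorphic_on {s. Re s > 1}"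
proof (rule holomorphic_uniform_sequence[where f = "\<lambda>n s. \<Sum>k<n. 1 / of_nat (Suc k) powr s"])
  show "open {s. Re s > 1}" by (rule open_halfspace_Re_gt)
  show "(\<lambda>s. \<Sum>k<n. 1 / of_nat (Suc k) powr s) holomorphic_on {s. Re s > 1}" for n
    by (intro holomorphic_intros) auto
  fix z assume "z \<in> {s. Re s > 1}"
  hence z: "Re z > 1" by simp
  define d where "d = (Re z - 1) / 2"
  have d: "d > 0" using z by (simp add: d_def)
  have Re_w: "Re w \<ge> 1 + d" if "w \<in> cball z d" for w
  proof -
    have "Re z - Re w \<le> norm (z - w)" using complex_Re_le_cmod[of "z - w"] by simp
    also have "\<dots> \<le> d" using that by (simp add: dist_norm)
    finally show ?thesis by (simp add: d_def field_simps)
  qed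
  have "uniform_limit (cball z d) (\<lambda>n s. \<Sum>k<n. 1 / of_nat (Suc k) powr s) (\<lambda>s. \<Sum>k. 1 / of_nat (Suc k) powr s) sequentially"
  proof (rule Weierstrass_m_test)
    fix n w assume "w \<in> cball z d"
    have "norm (1 / of_nat (Suc n) powr w) = 1 / real (Suc n) powr Re w"
      by (simp only: norm_divide norm_one) (subst norm_powr_real_powr, auto)
    also have "\<dots> \<le> 1 / real (Suc n) powr (1 + d)"
      using Re_w[OF \<open>w \<in> cball z d\<close>] by (intro divide_left_mono powr_mono) auto
    finally show "norm (1 / of_nat (Suc n) powr w) \<le> 1 / real (Suc n) powr (1 + d)" .
  next
    have "summable (\<lambda>n. real (Suc n) powr (- (1 + d)))"
      using d by (subst summable_Suc_iff) (simp add: summable_real_powr_iff)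
    thus "summable (\<lambda>n. 1 / real (Suc n) powr (1 + d))" by (simp only: powr_minus divide_inverse mult_1_left)
  qed
  moreover have "cball z d \<subseteq> {s. Re s > 1}" using Re_w d by force
  ultimately show "\<exists>d>0. cball z d \<subseteq> {s. Re s > 1} \<and> uniform_limit (cball z d) (\<lambda>n s. \<Sum>k<n. 1 / of_nat (Suc k) powr s) zeta_series sequentially"
    using d unfolding zeta_series_def[abs_def] by blast
qed

definition RSF :: "complex \<Rightarrow> complex" where
  "RSF s = RSI (1 / 2) s + chi s * cnj (RSI (1 / 2) (1 - cnj s))"

text \<open>The plane without the positive integers, the poles of \<open>Gamma (1 - s)\<close>.
  Removing these countably many points keeps open connected sets connected.\<close>

definition regular_set :: "complex set" where "regular_set = {s. 1 - s \<notin> \<int>\<^sub>\<le>\<^sub>0}"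

lemma regular_set_eq: "regular_set = - (\<lambda>z. 1 - z) ` \<int>\<^sub>\<le>\<^sub>0"
  by (auto simp: regular_set_def intro: image_eqI[of _ _ "1 - x" for x])

lemma countable_irregular: "countable ((\<lambda>z::complex. 1 - z) ` \<int>\<^sub>\<le>\<^sub>0)"
proof -
  have "(\<int>\<^sub>\<le>\<^sub>0 :: complex set) \<subseteq> range of_int" by (auto elim!: nonpos_Ints_cases)
  thus ?thesis by (intro countable_image) (rule countable_subset, auto)
qed

lemma open_regular_set: "open regular_set"
proof -
  have eq: "regular_set = (\<lambda>s. 1 - s) -` (- \<int>\<^sub>\<le>\<^sub>0)" by (auto simp: regular_set_def)
  show ?thesis unfolding eq by (intro open_vimage continuous_intros open_Compl closed_nonpos_Ints)
qed

lemma connected_regular_Int: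
  assumes "open S" "connected S"
  shows "connected (S \<inter> regular_set)"
  using connected_open_diff_countable[OF _ assms countable_irregular] by (simp add: regular_set_eq Diff_eq)

lemma chi_holomorphic: "chi holomorphic_on regular_set"
  unfolding chi_def[abs_def] by (intro holomorphic_intros) (auto simp: regular_set_def)

lemma RSF_holomorphic: "RSF holomorphic_on regular_set"
proof -
  have half: "(1 / 2 :: real) > 0" by simp
  show ?thesis
    unfolding RSF_def[abs_def]
    by (intro holomorphic_intros chi_holomorphic holomorphic_on_subset[OF RSI_holomorphic[OF half half_not_Int]]
        holomorphic_on_subset[OF holomorphic_cnj_RSI[OF half half_not_Int]]) auto
qed

lemma of_real_regular: assumes "3 < x" "x < 4" shows "complex_of_real x \<in> regular_set"
proof -
  have "1 - complex_of_real x \<notin> \<int>\<^sub>\<le>\<^sub>0"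
  proof
    assume "1 - complex_of_real x \<in> \<int>\<^sub>\<le>\<^sub>0"
    then obtain n :: int where "1 - complex_of_real x = of_int n" by (auto elim!: nonpos_Ints_cases)
    hence "Re (1 - complex_of_real x) = Re (of_int n)" by simp
    hence "1 - x = of_int n" by simp
    with assms have "- 3 < (of_int n :: real)" "(of_int n :: real) < - 2" by linarith+
    hence "- 3 < n" "n < - 2" by linarith+
    thus False by linarith
  qed
  thus ?thesis by (simp add: regular_set_def)
qed

text \<open>\<open>RSF\<close> is unreliable at \<open>2, 3, ...\<close>, where \<open>chi\<close>
  contains a pole of \<open>Gamma\<close>, and the series reaches only \<open>Re s > 1\<close>; the
  two domains together cover everything but \<open>1\<close>.\<close>

lemma is_zeta_continuation_exists: "is_zeta_continuation (\<lambda>s. if Re s > 1 then zeta_series s else RSF s)"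
proof -
  define F where "F = (\<lambda>s. if Re s > 1 then zeta_series s else RSF s)"
  define A where "A = {s. Re s > 1}"
  have A: "open A" "convex A" unfolding A_def by (rule open_halfspace_Re_gt, rule convex_halfspace_Re_gt)
  have eq: "zeta_series s = RSF s" if "s \<in> A \<inter> regular_set" for s
  proof (rule analytic_continuation_from_reals[where S = "A \<inter> regular_set" and a = 3 and b = 4 and f = zeta_series and g = RSF and z = s])
    show "zeta_series holomorphic_on A \<inter> regular_set" "RSF holomorphic_on A \<inter> regular_set"
      using zeta_series_holomorphic RSF_holomorphic by (auto intro: holomorphic_on_subset simp: A_def)
    show "open (A \<inter> regular_set)" by (intro open_Int A open_regular_set)
    show "connected (A \<inter> regular_set)"
      by (intro connected_regular_Int A convex_connected)
    fix x :: real assume x: "3 < x" "x < 4"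
    show "complex_of_real x \<in> A \<inter> regular_set \<and> zeta_series (complex_of_real x) = RSF (complex_of_real x)"
      using of_real_regular[OF x] RS_formula_real[OF x] x by (simp add: A_def zeta_series_def RSF_def)
  qed (use that in auto)
  have "F holomorphic_on A"
    by (rule holomorphic_transform[OF zeta_series_holomorphic, folded A_def]) (auto simp: F_def A_def)
  moreover have "F holomorphic_on regular_set"
    by (rule holomorphic_transform[OF RSF_holomorphic]) (use eq in \<open>auto simp: F_def A_def\<close>)
  ultimately have "F holomorphic_on A \<union> regular_set" using A(1) open_regular_set by (rule holomorphic_on_Un)
  moreover have "- {1} \<subseteq> A \<union> regular_set"
  proof
    fix s :: complex assume s: "s \<in> - {1}"
    show "s \<in> A \<union> regular_set"
    proof (cases "1 - s \<in> \<int>\<^sub>\<le>\<^sub>0")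
      case True
      then obtain n :: int where n: "1 - s = of_int n" "n \<le> 0" by (auto elim!: nonpos_Ints_cases)
      hence "s = of_int (1 - n)" by (simp add: algebra_simps)
      moreover have "n \<noteq> 0" using s n by auto
      ultimately show ?thesis using n by (auto simp: A_def)
    qed (auto simp: regular_set_def)
  qed
  ultimately have "F holomorphic_on - {1}" by (rule holomorphic_on_subset)
  thus ?thesis unfolding is_zeta_continuation_def F_def by (auto simp: zeta_series_def)
qed

lemma is_zeta_continuation_zeta: "is_zeta_continuation zeta"
  unfolding zeta_def by (rule someI_ex[OF exI[of is_zeta_continuation, OF is_zeta_continuation_exists]])

text \<open>\<open>zeta\<close> is an unspecified choice, so it is pinned down by uniqueness: it
  agrees with the formula on a real interval, and \<open>regular_set\<close> is connected.\<close>

lemma zeta_eq_RSF: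
  assumes "s \<in> regular_set"
  shows "zeta s = RSF s"
proof -
  from is_zeta_continuation_zeta have hol: "zeta holomorphic_on - {1}" and ser: "\<And>s. Re s > 1 \<Longrightarrow> zeta s = zeta_series s"
    by (auto simp: is_zeta_continuation_def zeta_series_def)
  have sub: "regular_set \<subseteq> - {1}" by (auto simp: regular_set_def)
  show ?thesis
  proof (rule analytic_continuation_from_reals[where S = regular_set and a = 3 and b = 4 and f = zeta and g = RSF and z = s])
    show "zeta holomorphic_on regular_set" by (rule holomorphic_on_subset[OF hol sub])
    show "connected regular_set"
      using connected_regular_Int[of UNIV] connected_UNIV by simp
    fix x :: real assume x: "3 < x" "x < 4"
    show "complex_of_real x \<in> regular_set \<and> zeta (complex_of_real x) = RSF (complex_of_real x)"
      using of_real_regular[OF x] RS_formula_real[OF x] x by (simp add: ser zeta_series_def RSF_def)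
  qed (use assms RSF_holomorphic open_regular_set in auto)
qed

section \<open>Zeta on the line Re s = 1 and its two finite sums\<close>

lemma RSI_half_eq:
  assumes a: "a > 0" "a \<notin> \<int>"
  shows "RSI (1 / 2) w = (\<Sum>n = 1..nat \<lfloor>a\<rfloor>. of_nat n powr (- w)) + RSI a w"
proof -
  consider "a > 1 / 2" | "a = 1 / 2" | "a < 1 / 2" by linarith
  thus ?thesis
  proof cases
    case 1
    have "{n::int. (1 / 2 :: real) < of_int n \<and> of_int n < a} = int ` {1..nat \<lfloor>a\<rfloor>}"
    proof (intro equalityI subsetI)
      fix n :: int assume "n \<in> {n::int. (1 / 2 :: real) < of_int n \<and> of_int n < a}"
      hence n: "(1 / 2 :: real) < of_int n" "of_int n < a" by auto
      have "n > 0" using n(1) by linarith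
      moreover have "n \<le> \<lfloor>a\<rfloor>" using n(2) by (simp add: le_floor_iff)
      ultimately show "n \<in> int ` {1..nat \<lfloor>a\<rfloor>}" by (intro image_eqI[of _ _ "nat n"]) auto
    next
      fix n :: int assume "n \<in> int ` {1..nat \<lfloor>a\<rfloor>}"
      then obtain m where m: "n = int m" "1 \<le> m" "m \<le> nat \<lfloor>a\<rfloor>" by auto
      have "n \<le> \<lfloor>a\<rfloor>" using m by linarith
      hence "of_int n \<le> a" by (simp add: le_floor_iff)
      moreover have "of_int n \<noteq> a" using a(2) Ints_of_int by metis
      ultimately show "n \<in> {n::int. (1 / 2 :: real) < of_int n \<and> of_int n < a}" using m by auto
    qed
    moreover have "(\<Sum>n\<in>int ` {1..nat \<lfloor>a\<rfloor>}. complex_of_int n powr (- w)) = (\<Sum>n = 1..nat \<lfloor>a\<rfloor>. of_nat n powr (- w))"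
      by (subst sum.reindex) auto
    ultimately show ?thesis using RSI_shift[OF _ 1 half_not_Int a(2), of w] by simp
  next
    case 2 show ?thesis unfolding 2 by simp
  next
    \<comment> \<open>Here the line through \<open>a\<close> lies to the left of
      \<open>1 / 2\<close>; no pole separates the two, and the sum is empty.\<close>
    case 3
    have E: "{n::int. a < of_int n \<and> of_int n < (1 / 2 :: real)} = {}"
    proof -
      have False if "a < of_int n" "of_int n < (1 / 2 :: real)" for n :: int
      proof -
        have "(0::real) < of_int n" using that a by linarith
        hence "n \<ge> 1" by simp
        hence "(1::real) \<le> of_int n" by simp
        thus False using that(2) by linarith
      qed
      thus ?thesis by blast
    qed
    moreover have "nat \<lfloor>a\<rfloor> = 0" using 3 a by linarith
    ultimately show ?thesis using RSI_shift[OF a(1) 3 a(2) half_not_Int, of w, unfolded E] by simp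
  qed
qed

text \<open>At \<open>s = 1 + \<i> * t\<close> the reflected argument \<open>1 - cnj s\<close> is
  \<open>\<i> * t\<close>, so the two integrals belong to the two edges of the critical
  strip.\<close>

lemma norm_zeta_one_line_le:
  fixes t a :: real
  assumes a: "a > 0" "a \<notin> \<int>" and t: "t \<noteq> 0"
  shows "norm (zeta (1 + \<i> * of_real t)) \<le> norm (\<Sum>n = 1..nat \<lfloor>a\<rfloor>. 1 / (of_nat n :: complex) powr (1 + \<i> * of_real t))
    + norm (RSI a (1 + \<i> * of_real t)) + norm (chi (1 + \<i> * of_real t)) *
      (norm (\<Sum>n = 1..nat \<lfloor>a\<rfloor>. 1 / (of_nat n :: complex) powr (- (\<i> * of_real t))) + norm (RSI a (\<i> * of_real t)))"
proof -
  let ?Y = "\<Sum>n = 1..nat \<lfloor>a\<rfloor>. (of_nat n :: complex) powr (- (\<i> * of_real t))"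
  define s where "s = 1 + \<i> * of_real t"
  let ?X = "\<Sum>n = 1..nat \<lfloor>a\<rfloor>. (of_nat n :: complex) powr (- s)"
  have "1 - s \<notin> \<int>\<^sub>\<le>\<^sub>0" using t by (auto simp: s_def complex_eq_iff elim!: nonpos_Ints_cases)
  hence "zeta s = RSF s" by (intro zeta_eq_RSF) (simp add: regular_set_def)
  also have "\<dots> = ?X + RSI a s
    + chi s * cnj (?Y + RSI a (\<i> * of_real t))"
    unfolding RSF_def RSI_half_eq[OF a] by (simp add: s_def)
  also have "norm \<dots> \<le> norm ?X + norm (RSI a s)
    + norm (chi s) * (norm ?Y + norm (RSI a (\<i> * of_real t)))"
  proof -
    have "norm (A + B + C * cnj (X + Y)) \<le> norm A + norm B + norm C * (norm X + norm Y)" for A B C X Y :: complex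
    proof -
      have "norm (A + B + C * cnj (X + Y)) \<le> norm A + norm B + norm (C * cnj (X + Y))"
        by (intro order.trans[OF norm_triangle_ineq] add_right_mono norm_triangle_ineq)
      also have "norm (C * cnj (X + Y)) \<le> norm C * (norm X + norm Y)"
        unfolding norm_mult complex_mod_cnj by (intro mult_left_mono norm_triangle_ineq norm_ge_zero)
      finally show ?thesis by simp
    qed
    thus ?thesis by blast
  qed
  also have "?X = (\<Sum>n = 1..nat \<lfloor>a\<rfloor>. 1 / (of_nat n :: complex) powr s)"
    by (simp add: powr_minus divide_inverse)
  \<comment> \<open>Conjugating \<open>n powr (- (\<i> * t))\<close> inverts it, which gives the
    second sum the form it has in the theorem.\<close>
  also have "norm ?Y = norm (cnj ?Y)"
    by (simp only: complex_mod_cnj)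
  also have "cnj ?Y = (\<Sum>n = 1..nat \<lfloor>a\<rfloor>. 1 / (of_nat n :: complex) powr (- (\<i> * of_real t)))"
    unfolding cnj_sum
  proof (rule sum.cong[OF refl])
    fix n assume "n \<in> {1..nat \<lfloor>a\<rfloor>}"
    hence n: "n > 0" by auto
    have "cnj (of_nat n powr (- (\<i> * of_real t))) = of_nat n powr (\<i> * of_real t)"
      using n by (simp add: powr_def exp_cnj cnj_Ln)
    thus "cnj (of_nat n powr (- (\<i> * of_real t))) = 1 / of_nat n powr (- (\<i> * of_real t))"
      by (simp add: powr_minus divide_inverse)
  qed
  finally show ?thesis unfolding s_def .
qed

section \<open>The factor chi on the line Re s = 1\<close>

lemma cosh_le_sinh:
  assumes "y > (0::real)" shows "cosh y \<le> (1 + 1 / y) * sinh y"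
proof -
  have "cosh y - sinh y = exp (- y)" by (simp add: cosh_def sinh_def field_simps)
  also have "\<dots> \<le> 1" using assms by simp
  also have "\<dots> \<le> sinh y / y" using abs_le_abs_sinh[of y] assms by simp
  finally show ?thesis by (simp add: algebra_simps)
qed

text \<open>The modulus is explicit: its square is \<open>2 * pi / t * (cosh y / sinh y)\<close>
  with \<open>y = pi * t / 2\<close>. The quotient is at most
  \<open>1 + 1 / y \<le> exp (1 / y)\<close>, and
  \<open>1 / y = 2 / (pi * t) \<le> pi / (3 * t)\<close> by \<open>pi\<^sup>2 \<ge> 6\<close>, which
  is twice the second term in the exponent of \<open>g\<close>.\<close>

lemma norm_chi_le:
  assumes t: "t > 0"
  shows "norm (chi (1 + \<i> * of_real t)) \<le> g t / t powr (1 / 2)"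
proof -
  define y where "y = pi * t / 2"
  have y: "y > 0" using t by (simp add: y_def)
  have sy: "sinh y > 0" using y by simp
  have G: "(norm (Gamma (\<i> * of_real t)))\<^sup>2 = pi / (t * sinh (pi * t))"
  proof -
    have "norm (sin (of_real pi * (\<i> * of_real t))) = sinh (pi * t)"
    proof (rule power2_eq_imp_eq)
      show "(norm (sin (of_real pi * (\<i> * of_real t))))\<^sup>2 = (sinh (pi * t))\<^sup>2"
        unfolding norm_sin_sq_eq by simp
    qed (use t in auto)
    moreover have "norm (Gamma (- (\<i> * of_real t))) = norm (Gamma (\<i> * of_real t))"
    proof -
      have "- (\<i> * of_real t) = cnj (\<i> * of_real t)" by simp
      thus ?thesis by (metis cnj_Gamma complex_mod_cnj)
    qed
    ultimately have "norm (Gamma (\<i> * of_real t) * Gamma (- (\<i> * of_real t))) = pi / (t * sinh (pi * t))"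
      unfolding Gamma_reflection_complex' using t by (simp add: norm_divide norm_mult)
    moreover have "norm (Gamma (\<i> * of_real t) * Gamma (- (\<i> * of_real t))) = (norm (Gamma (\<i> * of_real t)))\<^sup>2"
      unfolding norm_mult \<open>norm (Gamma (- (\<i> * of_real t))) = norm (Gamma (\<i> * of_real t))\<close> by (simp add: power2_eq_square)
    ultimately show ?thesis by simp
  qed
  have S: "(norm (sin (of_real pi * (1 + \<i> * of_real t) / 2)))\<^sup>2 = (cosh y)\<^sup>2"
  proof -
    have "Re (of_real pi * (1 + \<i> * of_real t) / 2) = pi / 2" "Im (of_real pi * (1 + \<i> * of_real t) / 2) = y"
      by (simp_all add: y_def)
    thus ?thesis unfolding norm_sin_sq_eq by (simp add: cosh_square_eq)
  qed
  have G': "(norm (Gamma (1 - (1 + \<i> * of_real t))))\<^sup>2 = pi / (t * sinh (pi * t))"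
  proof -
    have "1 - (1 + \<i> * of_real t) = cnj (\<i> * of_real t)" by simp
    hence "norm (Gamma (1 - (1 + \<i> * of_real t))) = norm (Gamma (\<i> * of_real t))" by (metis cnj_Gamma complex_mod_cnj)
    thus ?thesis using G by simp
  qed
  have "norm (2 powr (1 + \<i> * of_real t) :: complex) = 2"
    using norm_powr_real_powr[of 2 "1 + \<i> * of_real t"] by simp
  moreover have "norm (of_real pi powr (1 + \<i> * of_real t - 1) :: complex) = 1"
    using norm_powr_real_powr[of "of_real pi" "1 + \<i> * of_real t - 1"] by simp
  ultimately have "(norm (chi (1 + \<i> * of_real t)))\<^sup>2 = 4 * (cosh y)\<^sup>2 * (pi / (t * sinh (pi * t)))"
    unfolding chi_def norm_mult power_mult_distrib S G' by simp
  also have "sinh (pi * t) = 2 * sinh y * cosh y"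
    using sinh_double[of y] by (simp add: y_def)
  also have "4 * (cosh y)\<^sup>2 * (pi / (t * (2 * sinh y * cosh y))) = 2 * pi / t * (cosh y / sinh y)"
    using t sy cosh_real_pos[of y] by (simp add: field_simps power2_eq_square)
  also have "cosh y / sinh y \<le> 1 + 1 / y" using cosh_le_sinh[OF y] sy by (simp add: pos_divide_le_eq)
  also have "1 + 1 / y \<le> exp (1 / y)" by (rule exp_ge_add_one_self)
  also have "1 / y \<le> 2 * (5 / (3 * t\<^sup>2) + pi / (6 * t))"
  proof -
    have "3 * 3 \<le> pi * pi" using pi_gt3 by (intro mult_mono) auto
    hence "2 / pi \<le> pi / 3" by (simp add: field_simps)
    hence "2 / pi / t \<le> pi / 3 / t" using t by (intro divide_right_mono) auto
    moreover have "1 / y = 2 / pi / t" by (simp add: y_def)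
    moreover have "0 \<le> 2 * (5 / (3 * t\<^sup>2))" by simp
    moreover have "2 * (pi / (6 * t)) = pi / 3 / t" by simp
    ultimately show ?thesis unfolding distrib_left by linarith
  qed
  finally have "(norm (chi (1 + \<i> * of_real t)))\<^sup>2 \<le> 2 * pi / t * exp (2 * (5 / (3 * t\<^sup>2) + pi / (6 * t)))"
    using t by (simp add: mult_left_mono divide_right_mono)
  also have "\<dots> = (g t / t powr (1 / 2))\<^sup>2"
    unfolding exp_double using t by (simp add: g_def power_divide power_mult_distrib powr_half_sqrt)
  finally show ?thesis
    by (rule power2_le_imp_le) (use t in \<open>simp add: g_def\<close>)
qed

section \<open>The main term at the saddle point\<close>

lemma norm_cos_imag: "norm (cos (\<i> * of_real y)) = cosh y"
proof (rule power2_eq_imp_eq)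
  have "cos (\<i> * of_real y) = sin (of_real (pi / 2) - \<i> * of_real y)" by (simp add: sin_diff flip: sin_of_real cos_of_real)
  hence "(norm (cos (\<i> * of_real y)))\<^sup>2 = (sin (pi / 2))\<^sup>2 + (sinh (- y))\<^sup>2"
    by (simp only: norm_sin_sq_eq) simp
  thus "(norm (cos (\<i> * of_real y)))\<^sup>2 = (cosh y)\<^sup>2" by (simp add: cosh_square_eq)
qed (auto simp: cosh_real_nonneg)

text \<open>The Gaussian term at \<open>a + w\<close> plus that at \<open>a - w\<close>, up to the
  factor \<open>2 * \<i>\<close>. On \<open>w = \<omega> * u\<close> the exponential is
  \<open>exp (- 2 * pi * u\<^sup>2)\<close>, on \<open>w = \<i> * y\<close> it has modulus
  one.\<close>

definition saddle_ker :: "real \<Rightarrow> complex \<Rightarrow> complex" where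
  "saddle_ker a w = exp (2 * of_real pi * \<i> * w\<^sup>2) * (1 / sin (of_real pi * (of_real a + w)) + 1 / sin (of_real pi * (of_real a - w)))"

lemma sin_pi_add_nz:
  assumes "a \<notin> \<int>" "Im w = 0 \<Longrightarrow> w = 0"
  shows "sin (of_real pi * (of_real a + w)) \<noteq> 0"
proof
  assume "sin (of_real pi * (of_real a + w)) = 0"
  then obtain n :: int where "of_real pi * (of_real a + w) = of_real (n * pi)" by (auto simp: sin_eq_0)
  hence "of_real pi * (of_real a + w) = of_real pi * of_int n" by simp
  hence eq: "of_real a + w = of_int n" by simp
  hence "Im (of_real a + w) = Im (of_int n)" by simp
  hence "w = 0" using assms(2) by simp
  hence "Re (of_real a) = Re (of_int n)" using eq by simp
  hence "a = of_int n" by simp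
  thus False using assms(1) by simp
qed

text \<open>The modulus on the imaginary axis is the derivative of
  \<open>2 / pi * arctan (sinh (pi * y) / \<sigma>)\<close>, which rises from \<open>0\<close> to
  \<open>1\<close> whatever the distance of \<open>a\<close> from the integers.\<close>

lemma saddle_ker_imag_integral:
  assumes a: "a \<notin> \<int>" and m: "m \<ge> 0"
  shows "norm (integral {0..m} (\<lambda>y. saddle_ker a (\<i> * of_real y))) \<le> 1"
proof -
  let ?d = "\<lambda>\<sigma> y. 2 * \<sigma> * cosh (pi * y) / (\<sigma>\<^sup>2 + (sinh (pi * y))\<^sup>2)"
  define \<sigma> where "\<sigma> = \<bar>sin (pi * a)\<bar>"
  have "sin (complex_of_real pi * (of_real a + 0)) \<noteq> 0" by (rule sin_pi_add_nz[OF a]) simp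
  hence "complex_of_real (sin (pi * a)) \<noteq> 0" by (simp flip: sin_of_real)
  hence \<sigma>: "\<sigma> > 0" by (simp add: \<sigma>_def)
  define G where "G = (\<lambda>y. 2 / pi * arctan (sinh (pi * y) / \<sigma>))"
  have ker: "norm (saddle_ker a (\<i> * of_real y)) = ?d \<sigma> y" for y
  proof -
    define A where "A = sin (of_real pi * (of_real a + \<i> * of_real y))"
    define B where "B = sin (of_real pi * (of_real a - \<i> * of_real y))"
    have nz: "A \<noteq> 0" "B \<noteq> 0"
      using sin_pi_add_nz[OF a, of "\<i> * of_real y"] sin_pi_add_nz[OF a, of "- (\<i> * of_real y)"] by (auto simp: A_def B_def)
    have "norm (exp (2 * of_real pi * \<i> * (\<i> * of_real y)\<^sup>2)) = 1"
      by (simp add: norm_exp_eq_Re power_mult_distrib flip: of_real_power)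
    hence "norm (saddle_ker a (\<i> * of_real y)) = norm (1 / A + 1 / B)"
      by (simp add: saddle_ker_def norm_mult A_def B_def)
    also have "1 / A + 1 / B = (A + B) / (A * B)" using nz by (simp add: field_simps)
    \<comment> \<open>Sum to product: the numerator acquires the factor \<open>\<sigma>\<close>,
      small exactly when a pole is near.\<close>
    also have "A + B = 2 * of_real (sin (pi * a)) * cos (\<i> * of_real (pi * y))"
      unfolding A_def B_def by (simp add: sin_add sin_diff distrib_left right_diff_distrib mult_ac flip: sin_of_real)
    also have "norm (2 * of_real (sin (pi * a)) * cos (\<i> * of_real (pi * y)) / (A * B)) = 2 * \<sigma> * cosh (pi * y) / (norm A * norm B)"
      unfolding norm_divide norm_mult norm_cos_imag by (simp add: \<sigma>_def)
    also have "norm A = norm B"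
    proof (rule power2_eq_imp_eq)
      show "(norm A)\<^sup>2 = (norm B)\<^sup>2" unfolding A_def B_def norm_sin_sq_eq by simp
    qed auto
    also have "norm B * norm B = \<sigma>\<^sup>2 + (sinh (pi * y))\<^sup>2"
      unfolding power2_eq_square[symmetric] B_def norm_sin_sq_eq by (simp add: \<sigma>_def)
    finally show ?thesis .
  qed
  have "((\<lambda>y. ?d \<sigma> y) has_integral (G m - G 0)) {0..m}"
  proof (rule fundamental_theorem_of_calculus[OF m])
    fix y
    have "((\<lambda>y. sinh (pi * y) / \<sigma>) has_real_derivative cosh (pi * y) * pi / \<sigma>) (at y within {0..m})"
      using \<sigma> by (auto intro!: derivative_eq_intros)
    from DERIV_cmult[OF DERIV_chain2[OF DERIV_arctan this], of "2 / pi"]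
    have "(G has_real_derivative 2 / pi * (1 / (1 + (sinh (pi * y) / \<sigma>)\<^sup>2) * (cosh (pi * y) * pi / \<sigma>))) (at y within {0..m})"
      unfolding G_def inverse_eq_divide .
    also have "2 / pi * (1 / (1 + (sinh (pi * y) / \<sigma>)\<^sup>2) * (cosh (pi * y) * pi / \<sigma>)) = ?d \<sigma> y"
    proof -
      have "1 + (sinh (pi * y) / \<sigma>)\<^sup>2 = (\<sigma>\<^sup>2 + (sinh (pi * y))\<^sup>2) / \<sigma>\<^sup>2" using \<sigma> by (simp add: power_divide field_simps)
      thus ?thesis using \<sigma> by (simp add: power2_eq_square)
    qed
    finally show "(G has_vector_derivative ?d \<sigma> y) (at y within {0..m})"
      by (simp add: has_real_derivative_iff_has_vector_derivative)
  qed
  hence hi: "((\<lambda>y. norm (saddle_ker a (\<i> * of_real y))) has_integral (G m - G 0)) {0..m}" unfolding ker .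
  have cont: "continuous_on {0..m} (\<lambda>y. saddle_ker a (\<i> * of_real y))"
    unfolding saddle_ker_def
    by (intro continuous_intros ballI sin_pi_add_nz[OF a] sin_pi_add_nz[OF a, of "- (\<i> * of_real y)" for y, simplified]) auto
  have "norm (integral {0..m} (\<lambda>y. saddle_ker a (\<i> * of_real y))) \<le> integral {0..m} (\<lambda>y. norm (saddle_ker a (\<i> * of_real y)))"
    by (rule Henstock_Kurzweil_Integration.integral_norm_bound_integral)
       (use integrable_continuous_interval[OF cont] hi in auto)
  also have "\<dots> = G m - G 0" using hi by (rule integral_unique)
  also have "G 0 = 0" by (simp add: G_def)
  also have "G m - 0 \<le> 1" using arctan_ubound[of "sinh (pi * m) / \<sigma>"] by (simp add: G_def field_simps)
  finally show ?thesis .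
qed

text \<open>Cauchy's theorem on the triangle between the diagonal and the imaginary axis. The poles
  are real and differ from \<open>0\<close>, so none lies in it. On the third side the exponential
  is at most one in modulus and both sines are at least \<open>sinh (pi * m)\<close>.\<close>

lemma saddle_ker_triangle:
  assumes a: "a \<notin> \<int>" and n: "n > (0::real)"
  shows "norm (integral {0..n} (\<lambda>u. saddle_ker a (\<omega> * of_real u))) \<le> 1 + 2 * (n / sqrt 2) / sinh (pi * (n / sqrt 2))"
proof -
  define m where "m = n / sqrt 2"
  let ?vert = "integral {0..m} (\<lambda>y. saddle_ker a (\<i> * of_real y))"
  let ?diag = "integral {0..n} (\<lambda>u. saddle_ker a (\<omega> * of_real u))"
  let ?V = "{0, Complex m m, \<i> * of_real m}"
  let ?top = "contour_integral (linepath (Complex m m) (\<i> * of_real m)) (saddle_ker a)"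
  have m: "m > 0" using n by (simp add: m_def)
  have wn: "\<omega> * of_real n = Complex m m" by (simp add: omega_Complex m_def complex_eq_iff)
  define Tr where "Tr = convex hull ?V"
  have Tr: "0 \<le> Re w \<and> 0 \<le> Im w \<and> (Im w = 0 \<longrightarrow> w = 0)" if "w \<in> Tr" for w
  proof -
    from that obtain x y z where xyz: "0 \<le> x" "0 \<le> y" "0 \<le> z" "x + y + z = 1"
      and w: "w = x *\<^sub>R 0 + y *\<^sub>R Complex m m + z *\<^sub>R (\<i> * of_real m)"
      unfolding Tr_def convex_hull_3 by blast
    have Re: "Re w = y * m" and Im: "Im w = (y + z) * m" by (simp_all add: w algebra_simps)
    have "w = 0" if "Im w = 0"
    proof -
      have "y + z = 0" using that m Im by simp
      hence "y = 0" "z = 0" using xyz by linarith+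
      thus ?thesis by (simp add: w)
    qed
    thus ?thesis using xyz m by (simp add: Re Im)
  qed
  have nz: "sin (of_real pi * (of_real a + w)) \<noteq> 0" "sin (of_real pi * (of_real a - w)) \<noteq> 0" if "w \<in> Tr" for w
    using sin_pi_add_nz[OF a, of w] sin_pi_add_nz[OF a, of "- w"] Tr[OF that] by auto
  have hol: "saddle_ker a holomorphic_on Tr"
    unfolding saddle_ker_def[abs_def] by (intro holomorphic_intros nz) auto
  hence cont: "continuous_on Tr (saddle_ker a)" by (rule holomorphic_on_imp_continuous_on)
  have seg: "closed_segment p q \<subseteq> Tr" if "p \<in> ?V" "q \<in> ?V" for p q
    unfolding Tr_def segment_convex_hull using that by (intro hull_mono) auto
  have ci: "saddle_ker a contour_integrable_on linepath p q" if "p \<in> ?V" "q \<in> ?V" for p q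
    by (intro contour_integrable_continuous_linepath continuous_on_subset[OF cont] seg that)
  have "contour_integral (linepath 0 (Complex m m) +++ linepath (Complex m m) (\<i> * of_real m) +++ linepath (\<i> * of_real m) 0) (saddle_ker a) = 0"
    using Cauchy_theorem_triangle[OF hol[unfolded Tr_def]] by (rule contour_integral_unique)
  hence "contour_integral (linepath 0 (Complex m m)) (saddle_ker a) =
      - ?top - contour_integral (linepath (\<i> * of_real m) 0) (saddle_ker a)"
    using ci by (simp add: algebra_simps eq_neg_iff_add_eq_0)
  also have "contour_integral (linepath (\<i> * of_real m) 0) (saddle_ker a) = - contour_integral (linepath 0 (\<i> * of_real m)) (saddle_ker a)"
    by (rule contour_integral_reverse_linepath) (intro continuous_on_subset[OF cont] seg, auto)
  also have "contour_integral (linepath 0 (\<i> * of_real m)) (saddle_ker a) = \<i> * ?vert"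
    using contour_integral_linepath_affine[OF m, of 0 \<i>] by simp
  also have "contour_integral (linepath 0 (Complex m m)) (saddle_ker a) = \<omega> * ?diag"
    using contour_integral_linepath_affine[OF n, of 0 \<omega>] by (simp add: wn)
  finally have eq: "\<omega> * ?diag =
     \<i> * ?vert - ?top"
    by simp
  have top: "norm (?top) \<le> 2 / sinh (pi * m) * norm (\<i> * of_real m - Complex m m)"
  proof (rule contour_integral_bound_linepath[OF ci])
    have sp: "sinh (pi * m) > 0" using m by simp
    show "0 \<le> 2 / sinh (pi * m)" using sp by simp
    fix w assume "w \<in> closed_segment (Complex m m) (\<i> * of_real m)"
    moreover have "closed_segment (Complex m m) (\<i> * of_real m) \<subseteq> Tr" by (intro seg) auto
    ultimately have w: "w \<in> Tr" "Im w = m"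
      using closed_segment_same_Im[of "Complex m m" "\<i> * of_real m"] by auto
    have sn: "1 / norm (sin z) \<le> 1 / sinh (pi * m)" if "(Im z)\<^sup>2 = (pi * m)\<^sup>2" for z
    proof -
      have "(sinh (Im z))\<^sup>2 = (sinh (pi * m))\<^sup>2" using that by (auto simp: power2_eq_iff)
      hence "(sinh (pi * m))\<^sup>2 \<le> (norm (sin z))\<^sup>2" unfolding norm_sin_sq_eq by simp
      hence "sinh (pi * m) \<le> norm (sin z)" by (rule power2_le_imp_le) simp
      thus ?thesis using sp by (intro divide_left_mono mult_pos_pos) auto
    qed
    have "Re (2 * of_real pi * \<i> * w\<^sup>2) = - (4 * pi * (Re w * Im w))" by (simp add: power2_eq_square)
    moreover have "0 \<le> 4 * pi * (Re w * Im w)" using Tr[OF w(1)] by (intro mult_nonneg_nonneg) auto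
    ultimately have e: "norm (exp (2 * of_real pi * \<i> * w\<^sup>2)) \<le> 1" by (simp only: norm_exp_eq_Re) simp
    have "norm (1 / sin (of_real pi * (of_real a + w)) + 1 / sin (of_real pi * (of_real a - w))) \<le> 1 / sinh (pi * m) + 1 / sinh (pi * m)"
      by (rule order.trans[OF norm_triangle_ineq], unfold norm_divide norm_one, intro add_mono sn) (simp_all add: w(2))
    with e have "norm (saddle_ker a w) \<le> 1 * (1 / sinh (pi * m) + 1 / sinh (pi * m))"
      unfolding saddle_ker_def norm_mult by (intro mult_mono) auto
    thus "norm (saddle_ker a w) \<le> 2 / sinh (pi * m)" by simp
  qed auto
  also have "norm (\<i> * of_real m - Complex m m) = m" using m by (simp add: cmod_def)
  finally have top': "norm (?top) \<le> 2 * m / sinh (pi * m)" by simp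
  have "norm (?diag) = norm (\<omega> * ?diag)"
    by (simp add: norm_mult)
  also have "\<dots> \<le> norm (\<i> * ?vert) + norm (?top)"
    unfolding eq by (rule norm_triangle_ineq4)
  also have "\<dots> \<le> 1 + 2 * m / sinh (pi * m)"
    using saddle_ker_imag_integral[OF a, of m] m top' by (intro add_mono) (simp_all add: norm_mult)
  finally show ?thesis by (simp add: m_def)
qed

definition saddle_main :: "real \<Rightarrow> real \<Rightarrow> complex" where
  "saddle_main a u = of_real (exp (- 2 * pi * u\<^sup>2)) / (2 * \<i> * sin (of_real pi * line a u))"

lemma continuous_saddle_main: "a \<notin> \<int> \<Longrightarrow> continuous_on S (saddle_main a)"
  unfolding saddle_main_def[abs_def] using sin_pi_line_nz by (intro continuous_intros) auto

lemma integrable_saddle_main: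
  assumes a: "a \<notin> \<int>"
  shows "integrable lborel (saddle_main a)"
proof -
  have "norm (saddle_main a u) \<le> gauss_dom 0 0 u" if "\<bar>u\<bar> \<ge> 1" for u
  proof -
    have "norm (saddle_main a u) \<le> exp (- 2 * pi * u\<^sup>2)"
      unfolding saddle_main_def by (rule order.trans[OF norm_csc_line_le[OF that]]) simp
    also have "\<dots> \<le> gauss_dom 0 0 u" by (simp add: gauss_dom_def)
    finally show ?thesis .
  qed
  then obtain A' where "\<And>u. norm (saddle_main a u) \<le> gauss_dom A' 0 u"
    using continuous_gauss_dom[OF continuous_saddle_main[OF a, of UNIV], of 0 1 0] by auto
  thus ?thesis by (rule gauss_dom_integrable[OF continuous_saddle_main[OF a]])
qed

text \<open>Folding at \<open>u = 0\<close> gives \<open>1 / (2 * \<i>)\<close> times the integral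
  of the symmetrised kernel over the diagonal, whose modulus exceeds one at most by the vanishing
  contribution of the third side.\<close>

lemma saddle_main_bound:
  assumes a: "a \<notin> \<int>"
  shows "norm (LBINT u. saddle_main a u) \<le> 1 / 2"
proof -
  have sym: "saddle_main a u + saddle_main a (- u) = 1 / (2 * \<i>) * saddle_ker a (\<omega> * of_real u)" for u
  proof -
    have "2 * of_real pi * \<i> * (\<omega> * of_real u)\<^sup>2 = of_real (- 2 * pi * u\<^sup>2)"
      unfolding power_mult_distrib omega_power2 by (simp add: algebra_simps)
    hence "exp (2 * of_real pi * \<i> * (\<omega> * of_real u)\<^sup>2) = of_real (exp (- 2 * pi * u\<^sup>2))" by (simp only: exp_of_real)
    moreover have "e / (2 * \<i> * x) + e / (2 * \<i> * y) = 1 / (2 * \<i>) * (e * (1 / x + 1 / y))" for e x y :: complex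
      by (simp only: divide_inverse inverse_mult_distrib distrib_left mult_ac mult_1_left)
    ultimately show ?thesis
      unfolding saddle_main_def saddle_ker_def line_def
      by (simp only: of_real_minus mult_minus_right add_uminus_conv_diff power2_minus)
  qed
  have int: "saddle_main a integrable_on {p..q}" for p q
    by (intro integrable_continuous_interval continuous_saddle_main a)
  have half: "integral {-real n..real n} (saddle_main a) = 1 / (2 * \<i>) * integral {0..real n} (\<lambda>u. saddle_ker a (\<omega> * of_real u))" for n
  proof -
    have "integral {-real n..real n} (saddle_main a) = integral {-real n..0} (saddle_main a) + integral {0..real n} (saddle_main a)"
      by (rule Henstock_Kurzweil_Integration.integral_combine[symmetric]) (auto intro: int)
    also have "integral {-real n..0} (saddle_main a) = integral {0..real n} (\<lambda>u. saddle_main a (- u))"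
      using Henstock_Kurzweil_Integration.integral_reflect_real[of "real n" 0 "\<lambda>u. saddle_main a (- u)"] by simp
    also have "\<dots> + integral {0..real n} (saddle_main a) = integral {0..real n} (\<lambda>u. saddle_main a (- u) + saddle_main a u)"
    proof (rule Henstock_Kurzweil_Integration.integral_add[symmetric])
      show "(\<lambda>u. saddle_main a (- u)) integrable_on {0..real n}"
        by (intro integrable_continuous_interval continuous_on_compose2[OF continuous_saddle_main[OF a, of UNIV]] continuous_intros) auto
    qed (rule int)
    also have "(\<lambda>u. saddle_main a (- u) + saddle_main a u) = (\<lambda>u. 1 / (2 * \<i>) * saddle_ker a (\<omega> * of_real u))"
      using sym by (simp add: add.commute)
    finally show ?thesis by simp
  qed
  have "(\<lambda>n. norm (integral {-real n..real n} (saddle_main a))) \<longlonglongrightarrow> norm (LBINT u. saddle_main a u)"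
    by (intro tendsto_norm integral_trunc_tendsto integrable_saddle_main a)
  moreover have "(\<lambda>n::nat. 1 / 2 * (1 + 2 * (real n / sqrt 2) / sinh (pi * (real n / sqrt 2)))) \<longlonglongrightarrow> 1 / 2"
    unfolding sinh_field_def by real_asymp
  moreover have "\<forall>\<^sub>F n in sequentially. norm (integral {-real n..real n} (saddle_main a)) \<le> 1 / 2 * (1 + 2 * (real n / sqrt 2) / sinh (pi * (real n / sqrt 2)))"
    using eventually_gt_at_top[of "0::nat"]
  proof eventually_elim
    case (elim n)
    thus ?case unfolding half norm_mult using saddle_ker_triangle[OF a, of "real n"] by (simp add: norm_divide)
  qed
  ultimately show ?thesis by (intro tendsto_le[OF sequentially_bot])
qed

section \<open>The correction at the saddle point\<close>

lemma norm_exp_minus_one_le: "norm (exp z - 1) \<le> norm z * exp (max 0 (Re z))" for z :: complex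
proof -
  have "norm (exp z - exp 0) \<le> exp (max 0 (Re z)) * norm (z - 0)"
  proof (rule field_differentiable_bound[where S = "closed_segment 0 z" and f' = exp])
    fix x assume "x \<in> closed_segment 0 z"
    then obtain u where u: "0 \<le> u" "u \<le> 1" "x = u *\<^sub>R z" by (auto simp: in_segment)
    have "u * Re z \<le> max 0 (Re z)"
    proof (cases "Re z \<ge> 0")
      case True
      have "u * Re z \<le> 1 * Re z" using u True by (intro mult_right_mono) auto
      thus ?thesis by simp
    next
      case False
      hence "u * Re z \<le> 0" using u by (intro mult_nonneg_nonpos) auto
      thus ?thesis by simp
    qed
    thus "norm (exp x) \<le> exp (max 0 (Re z))" by (simp add: norm_exp_eq_Re u)
  qed (auto intro!: derivative_eq_intros)
  thus ?thesis by (simp add: mult.commute)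
qed

text \<open>Remainder of \<open>Ln (1 + z)\<close> after its quadratic Taylor polynomial, at
  \<open>z = \<omega> * v\<close>.\<close>

definition ln_rem :: "real \<Rightarrow> complex" where
  "ln_rem v = Ln (line 1 v) - \<omega> * of_real v + (\<omega> * of_real v)\<^sup>2 / 2"

lemma ln_rem_0 [simp]: "ln_rem 0 = 0"
  by (simp add: ln_rem_def line_def)

definition ln_rem' :: "real \<Rightarrow> complex" where
  "ln_rem' v = \<omega> ^ 3 * of_real (v\<^sup>2) / line 1 v"

lemma ln_rem_deriv: "(ln_rem has_vector_derivative ln_rem' v) (at v)"
proof -
  have nz: "line 1 v \<noteq> 0" and np: "line 1 v \<notin> \<real>\<^sub>\<le>\<^sub>0" by (auto simp: line_nonzero line_not_nonpos_Reals)
  have "((\<lambda>z. Ln (1 + \<omega> * z)) has_field_derivative \<omega> / line 1 v) (at (of_real v))"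
    using np unfolding line_def by (auto intro!: derivative_eq_intros simp: divide_inverse)
  moreover have "((\<lambda>z. (\<omega> * z)\<^sup>2 / 2) has_field_derivative \<omega>\<^sup>2 * of_real v) (at (of_real v))"
    by (auto intro!: derivative_eq_intros simp: power2_eq_square)
  ultimately have "((\<lambda>z. Ln (1 + \<omega> * z) - \<omega> * z + (\<omega> * z)\<^sup>2 / 2) has_field_derivative (\<omega> / line 1 v - \<omega> + \<omega>\<^sup>2 * of_real v)) (at (of_real v))"
    by (intro DERIV_add DERIV_diff DERIV_cmult_Id)
  moreover have "\<omega> / line 1 v - \<omega> + \<omega>\<^sup>2 * of_real v = ln_rem' v"
    using nz unfolding ln_rem'_def by (simp add: line_def field_simps power2_eq_square power3_eq_cube)
  ultimately have "((\<lambda>z. Ln (1 + \<omega> * z) - \<omega> * z + (\<omega> * z)\<^sup>2 / 2) has_field_derivative ln_rem' v) (at (of_real v))" by simp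
  from has_vector_derivative_real_field[OF this] show ?thesis
    by (simp add: ln_rem_def[abs_def] line_def)
qed

lemma norm_line_1_sq: "(norm (line 1 v))\<^sup>2 = 1 + sqrt 2 * v + v\<^sup>2"
  by (simp add: norm_line_sq)

lemma norm_ln_rem'_le: "norm (ln_rem' v) \<le> sqrt 2 * v\<^sup>2"
proof -
  have "v\<^sup>2 / norm (line 1 v) \<le> v\<^sup>2 / (1 / sqrt 2)"
    using norm_line_ge[of 1 v] by (intro divide_left_mono) (auto simp: line_nonzero)
  thus ?thesis by (simp add: ln_rem'_def norm_divide norm_mult norm_power mult.commute)
qed

lemma norm_ln_rem_le: "norm (ln_rem v) \<le> sqrt 2 / 3 * \<bar>v\<bar> ^ 3"
proof -
  have phi: "((\<lambda>x. sqrt 2 / 3 * x ^ 3) has_vector_derivative sqrt 2 * x\<^sup>2) (at x)" for x :: real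
    unfolding has_real_derivative_iff_has_vector_derivative[symmetric]
    by (auto intro!: derivative_eq_intros)
  have bd: "norm (ln_rem q - ln_rem p) \<le> sqrt 2 / 3 * q ^ 3 - sqrt 2 / 3 * p ^ 3" if "p < q" for p q
  proof (rule differentiable_bound_general[OF that, where f' = ln_rem' and \<phi>' = "\<lambda>x. sqrt 2 * x\<^sup>2"])
    show "continuous_on {p..q} ln_rem"
      by (intro continuous_at_imp_continuous_on ballI has_vector_derivative_continuous[OF ln_rem_deriv])
    show "continuous_on {p..q} (\<lambda>x. sqrt 2 / 3 * x ^ 3)" by (intro continuous_intros)
  qed (rule ln_rem_deriv phi norm_ln_rem'_le)+
  consider "v = 0" | "v > 0" | "v < 0" by linarith
  thus ?thesis
  proof cases
    case 2 thus ?thesis using bd[of 0 v] by simp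
  next
    case 3 thus ?thesis using bd[of v 0] by simp
  qed simp
qed

lemma Im_ln_rem': "Im (ln_rem' v) = v * (v * (1 / sqrt 2 + v) / (1 + sqrt 2 * v + v\<^sup>2))"
proof -
  have "\<omega> ^ 3 = \<i> * \<omega>" using omega_power2 by (simp add: power3_eq_cube power2_eq_square)
  have "ln_rem' v = of_real (v\<^sup>2) * (\<i> * \<omega> * cnj (line 1 v)) / of_real ((norm (line 1 v))\<^sup>2)"
    unfolding ln_rem'_def \<open>\<omega> ^ 3 = \<i> * \<omega>\<close> complex_norm_square using line_nonzero[of 1 v] by simp
  also have "\<i> * \<omega> * cnj (line 1 v) = \<i> * \<omega> + \<i> * of_real v"
    using omega_mult_cnj(1) by (simp add: line_def algebra_simps)
  finally have "ln_rem' v = of_real (v\<^sup>2 / (norm (line 1 v))\<^sup>2) * (\<i> * \<omega> + \<i> * of_real v)" by simp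
  note rem_eq = this
  have "Im (ln_rem' v) = v\<^sup>2 / (norm (line 1 v))\<^sup>2 * (1 / sqrt 2 + v)"
  proof -
    have "Im (of_real r * x) = r * Im x" for r x by simp
    thus ?thesis unfolding rem_eq by (simp only:) (simp add: omega_Complex)
  qed
  thus ?thesis unfolding norm_line_1_sq by (simp add: power2_eq_square)
qed

text \<open>A cubic bound cannot be exponentiated against a Gaussian; this quadratic one, valid for
  all real \<open>v\<close>, can. The difference of the two sides has derivative
  \<open>v * q v\<close> with \<open>q \<ge> 0\<close>, so its minimum is at \<open>v = 0\<close>.
  The least constant that could replace \<open>5 / 4\<close> in \<open>q\<close> is
  \<open>(1 + sqrt 2) / 2\<close>, about \<open>1.207\<close>.\<close>

lemma Im_ln_rem_le: "Im (ln_rem v) \<le> 5 / 8 * v\<^sup>2"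
proof -
  define q where "q = (\<lambda>v. 5 / 4 - v * (1 / sqrt 2 + v) / (1 + sqrt 2 * v + v\<^sup>2))"
  define f where "f = (\<lambda>v. 5 / 8 * v\<^sup>2 - Im (ln_rem v))"
  have q: "q v \<ge> 0" for v
  proof -
    have D: "1 + sqrt 2 * v + v\<^sup>2 > 0" using line_nonzero[of 1 v] norm_line_1_sq[of v] by (metis zero_less_norm_iff zero_less_one zero_less_power)
    have i2: "1 / sqrt 2 = sqrt 2 / (2::real)" using real_div_sqrt[of 2] by (simp add: field_simps)
    have e: "5 / 4 * (1 + sqrt 2 * v + v\<^sup>2) - v * (1 / sqrt 2 + v) = 1 / 4 * ((v + 3 * sqrt 2 / 2)\<^sup>2 + 1 / 2)"
      unfolding i2 by (simp add: power2_eq_square algebra_simps)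
    have "0 \<le> 5 / 4 * (1 + sqrt 2 * v + v\<^sup>2) - v * (1 / sqrt 2 + v)" unfolding e by simp
    hence "v * (1 / sqrt 2 + v) \<le> 5 / 4 * (1 + sqrt 2 * v + v\<^sup>2)" by (simp only: diff_ge_0_iff_ge)
    thus ?thesis using D by (simp add: q_def pos_divide_le_eq)
  qed
  have df: "(f has_real_derivative v * q v) (at v)" for v
  proof -
    have "((\<lambda>v. Im (ln_rem v)) has_real_derivative Im (ln_rem' v)) (at v)"
      unfolding has_real_derivative_iff_has_vector_derivative
      using bounded_linear.has_vector_derivative[OF bounded_linear_Im ln_rem_deriv[of v]] .
    moreover have "((\<lambda>v. 5 / 8 * v\<^sup>2) has_real_derivative 5 / 8 * (2 * v)) (at v)"
      by (auto intro!: derivative_eq_intros)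
    ultimately have "(f has_real_derivative 5 / 8 * (2 * v) - Im (ln_rem' v)) (at v)"
      unfolding f_def by (intro DERIV_diff)
    moreover have "5 / 8 * (2 * v) - Im (ln_rem' v) = v * q v"
      unfolding Im_ln_rem' q_def by (simp add: right_diff_distrib)
    ultimately show ?thesis by (simp only:)
  qed
  have "f 0 \<le> f v"
  proof (cases "v \<ge> 0")
    case True
    show ?thesis
    proof (rule DERIV_nonneg_imp_nondecreasing[OF True])
      fix x :: real assume "0 \<le> x"
      thus "\<exists>y. (f has_real_derivative y) (at x) \<and> 0 \<le> y" using df q by (blast intro: mult_nonneg_nonneg)
    qed
  next
    case False
    hence "v \<le> 0" by simp
    thus ?thesis
    proof (rule DERIV_nonpos_imp_nonincreasing)
      fix x :: real assume "x \<le> 0"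
      thus "\<exists>y. (f has_real_derivative y) (at x) \<and> y \<le> 0" using df q by (blast intro: mult_nonpos_nonneg)
    qed
  qed
  thus ?thesis by (simp add: f_def)
qed

definition saddle_exp :: "real \<Rightarrow> real \<Rightarrow> complex" where
  "saddle_exp a u = - (of_real (2 * pi * a\<^sup>2) * \<i> * ln_rem (u / a))"

text \<open>For \<open>t = 2 * pi * a\<^sup>2\<close> the terms linear in \<open>u\<close> from the
  power and from \<open>exp (pi * \<i> * x\<^sup>2)\<close> cancel, so \<open>a\<close> is the
  saddle point. The quadratic terms are \<open>- pi * u\<^sup>2\<close> each and add; what remains
  is the logarithmic remainder.\<close>

lemma saddle_factor:
  assumes a: "a > 0" and t: "t = 2 * pi * a\<^sup>2"
  defines "K \<equiv> exp (\<i> * of_real (pi * a\<^sup>2 - t * ln a))"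
  shows "line a u powr (- (\<i> * of_real t)) * exp (of_real pi * \<i> * (line a u)\<^sup>2) = K * of_real (exp (- 2 * pi * u\<^sup>2)) * exp (saddle_exp a u)"
proof -
  define v where "v = u / a"
  have u: "u = a * v" using a by (simp add: v_def)
  have "line a u = of_real a * line 1 v" by (simp add: line_def u algebra_simps)
  hence Ln: "Ln (line a u) = of_real (ln a) + Ln (line 1 v)"
    using a by (simp add: Ln_times_of_real line_nonzero Ln_of_real)
  have "pi * (\<i> * (line a u)\<^sup>2) = pi * (- of_real (u\<^sup>2) + 2 * \<i> * \<omega> * of_real (a * u) + \<i> * of_real (a\<^sup>2))"
    unfolding omega_sq_line ..
  hence sq: "of_real pi * \<i> * (line a u)\<^sup>2 = pi * (- of_real (u\<^sup>2) + 2 * \<i> * \<omega> * of_real (a * u) + \<i> * of_real (a\<^sup>2))"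
    by (simp only: mult.assoc)
  have w2: "\<omega> * (\<omega> * x) = \<i> * x" for x using omega_power2 by (simp add: power2_eq_square flip: mult.assoc)
  have "- (\<i> * of_real t) * Ln (line a u) + of_real pi * \<i> * (line a u)\<^sup>2
      = \<i> * of_real (pi * a\<^sup>2 - t * ln a) + of_real (- 2 * pi * u\<^sup>2) + saddle_exp a u"
    unfolding sq Ln saddle_exp_def v_def[symmetric] ln_rem_def t unfolding u
    by (simp add: power2_eq_square algebra_simps w2)
  thus ?thesis
    unfolding line_powr[OF a] K_def exp_of_real[symmetric] exp_add[symmetric] by simp
qed

lemma norm_csc_line_le_inverse:
  assumes "u \<noteq> 0"
  shows "norm (1 / (2 * \<i> * sin (of_real pi * line a u))) \<le> 1 / (sqrt 2 * pi * \<bar>u\<bar>)"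
proof -
  have "pi * \<bar>u\<bar> / sqrt 2 = \<bar>Im (of_real pi * line a u)\<bar>" by (simp add: Re_Im_line abs_mult)
  also have "\<dots> \<le> norm (sin (of_real pi * line a u))" by (rule norm_sin_ge_Im)
  finally have "2 * (pi * \<bar>u\<bar> / sqrt 2) \<le> norm (2 * \<i> * sin (of_real pi * line a u))" by (simp add: norm_mult)
  moreover have "2 * (pi * \<bar>u\<bar> / sqrt 2) = sqrt 2 * pi * \<bar>u\<bar>"
    using real_div_sqrt[of 2] by (simp add: field_simps)
  moreover have "0 < sqrt 2 * pi * \<bar>u\<bar>" using assms by simp
  ultimately show ?thesis unfolding norm_divide norm_one
    by (intro divide_left_mono mult_pos_pos[of "norm _"]) linarith+
qed

text \<open>The cubic estimate supplies the factor \<open>1 / a\<close>; the one-sided quadratic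
  estimate limits the growth to \<open>5 / 4 * pi * u\<^sup>2\<close> in the exponent, below the
  available decay \<open>2 * pi * u\<^sup>2\<close>.\<close>

lemma saddle_exp_bound:
  assumes a: "a > 0"
  shows "norm (exp (saddle_exp a u) - 1) \<le> 2 * sqrt 2 * pi / (3 * a) * \<bar>u\<bar> ^ 3 * exp (5 / 4 * pi * u\<^sup>2)"
proof -
  have "norm (saddle_exp a u) = 2 * pi * a\<^sup>2 * norm (ln_rem (u / a))"
    unfolding saddle_exp_def norm_minus_cancel norm_mult norm_of_real by simp
  also have "\<dots> \<le> 2 * pi * a\<^sup>2 * (sqrt 2 / 3 * \<bar>u / a\<bar> ^ 3)"
    by (intro mult_left_mono norm_ln_rem_le) auto
  also have "\<dots> = 2 * sqrt 2 * pi / (3 * a) * \<bar>u\<bar> ^ 3"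
    using a by (simp add: abs_divide power_divide power2_eq_square power3_eq_cube field_simps)
  finally have 1: "norm (saddle_exp a u) \<le> 2 * sqrt 2 * pi / (3 * a) * \<bar>u\<bar> ^ 3" .
  have "Re (saddle_exp a u) = 2 * pi * a\<^sup>2 * Im (ln_rem (u / a))"
    by (simp add: saddle_exp_def)
  also have "\<dots> \<le> 2 * pi * a\<^sup>2 * (5 / 8 * (u / a)\<^sup>2)"
    by (intro mult_left_mono Im_ln_rem_le) auto
  also have "\<dots> = 5 / 4 * pi * u\<^sup>2" using a by (simp add: power_divide)
  finally have "max 0 (Re (saddle_exp a u)) \<le> 5 / 4 * pi * u\<^sup>2" by (intro max.boundedI) auto
  with 1 a show ?thesis
    by (intro order.trans[OF norm_exp_minus_one_le] mult_mono) auto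
qed

section \<open>The remainder estimate\<close>

definition saddle_err_it :: "real \<Rightarrow> real \<Rightarrow> complex" where
  "saddle_err_it a u = saddle_main a u * (exp (saddle_exp a u) - 1)"

definition saddle_err_1it :: "real \<Rightarrow> real \<Rightarrow> complex" where
  "saddle_err_1it a u = saddle_main a u * (exp (saddle_exp a u) / line 1 (u / a) - 1)"

lemma norm_saddle_main_le:
  assumes "u \<noteq> 0" shows "norm (saddle_main a u) \<le> exp (- 2 * pi * u\<^sup>2) * (1 / (sqrt 2 * pi * \<bar>u\<bar>))"
proof -
  have "saddle_main a u = of_real (exp (- 2 * pi * u\<^sup>2)) * (1 / (2 * \<i> * sin (of_real pi * line a u)))"
    by (simp add: saddle_main_def)
  also have "norm \<dots> \<le> exp (- 2 * pi * u\<^sup>2) * (1 / (sqrt 2 * pi * \<bar>u\<bar>))"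
    unfolding norm_mult norm_of_real by (intro mult_mono norm_csc_line_le_inverse assms) auto
  finally show ?thesis .
qed

text \<open>The \<open>1 / \<bar>u\<bar>\<close> from the cosecant turns
  \<open>\<bar>u\<bar> ^ 3\<close> into \<open>u\<^sup>2\<close>, and
  \<open>2 - 5 / 4 = 3 / 4\<close> of the Gaussian rate is left.\<close>

lemma norm_saddle_err_it_le:
  assumes a: "a > 0"
  shows "norm (saddle_err_it a u) \<le> 2 / (3 * a) * (exp (- (3 / 4 * pi) * u\<^sup>2) * u\<^sup>2)"
proof (cases "u = 0")
  case False
  have "norm (saddle_err_it a u) \<le> (exp (- 2 * pi * u\<^sup>2) * (1 / (sqrt 2 * pi * \<bar>u\<bar>))) * (2 * sqrt 2 * pi / (3 * a) * \<bar>u\<bar> ^ 3 * exp (5 / 4 * pi * u\<^sup>2))"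
    unfolding saddle_err_it_def norm_mult by (intro mult_mono norm_saddle_main_le saddle_exp_bound) (use a False in auto)
  also have "\<dots> = 2 / (3 * a) * (exp (- 2 * pi * u\<^sup>2) * exp (5 / 4 * pi * u\<^sup>2) * u\<^sup>2)"
    using False a by (simp add: power3_eq_cube power2_eq_square field_simps)
  also have "exp (- 2 * pi * u\<^sup>2) * exp (5 / 4 * pi * u\<^sup>2) = exp (- (3 / 4 * pi) * u\<^sup>2)"
    by (simp flip: exp_add)
  finally show ?thesis .
qed (simp add: saddle_err_it_def saddle_exp_def)

lemma norm_saddle_err_1it_le:
  assumes a: "a > 0"
  shows "norm (saddle_err_1it a u) \<le> sqrt 2 * (2 / (3 * a) * (exp (- (3 / 4 * pi) * u\<^sup>2) * u\<^sup>2) + 1 / (sqrt 2 * pi * a) * exp (- (2 * pi) * u\<^sup>2))"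
proof (cases "u = 0")
  case True
  show ?thesis unfolding True using a by (simp add: saddle_err_1it_def saddle_exp_def line_def)
next
  case False
  define z where "z = line 1 (u / a)"
  have nz: "z \<noteq> 0" by (simp add: z_def line_nonzero)
  have "1 / sqrt 2 \<le> norm z" using norm_line_ge[of 1 "u / a"] by (simp add: z_def)
  hence iz: "norm (1 / z) \<le> sqrt 2" using nz by (simp add: norm_divide field_simps)
  have zz: "\<omega> * of_real (u / a) = z - 1" by (simp add: z_def line_def)
  have eq: "exp (saddle_exp a u) / z - 1 = (1 / z) * ((exp (saddle_exp a u) - 1) - \<omega> * of_real (u / a))"
    unfolding zz using nz by (simp add: field_simps)
  have "saddle_err_1it a u = (1 / z) * (saddle_err_it a u - saddle_main a u * (\<omega> * of_real (u / a)))"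
    unfolding saddle_err_1it_def saddle_err_it_def z_def[symmetric] eq right_diff_distrib[of "saddle_main a u", symmetric]
    by (rule mult.left_commute)
  also have "norm \<dots> \<le> sqrt 2 * (norm (saddle_err_it a u) + norm (saddle_main a u * (\<omega> * of_real (u / a))))"
    unfolding norm_mult[of "1 / z"] by (intro mult_mono iz norm_triangle_ineq4) auto
  also have "\<dots> \<le> sqrt 2 * (2 / (3 * a) * (exp (- (3 / 4 * pi) * u\<^sup>2) * u\<^sup>2) + 1 / (sqrt 2 * pi * a) * exp (- (2 * pi) * u\<^sup>2))"
  proof (intro mult_left_mono add_mono norm_saddle_err_it_le a)
    have "norm (saddle_main a u * (\<omega> * of_real (u / a))) \<le> (exp (- 2 * pi * u\<^sup>2) * (1 / (sqrt 2 * pi * \<bar>u\<bar>))) * (\<bar>u\<bar> / a)"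
      unfolding norm_mult using a by (intro mult_mono norm_saddle_main_le False) (auto simp: norm_divide)
    also have "\<dots> = 1 / (sqrt 2 * pi * a) * exp (- (2 * pi) * u\<^sup>2)" using False a by simp
    finally show "norm (saddle_main a u * (\<omega> * of_real (u / a))) \<le> 1 / (sqrt 2 * pi * a) * exp (- (2 * pi) * u\<^sup>2)" .
  qed simp
  finally show ?thesis .
qed

lemma has_integral_err0_bound:
  assumes a: "a > 0"
  shows "has_bochner_integral lborel (\<lambda>u. 2 / (3 * a) * (exp (- (3 / 4 * pi) * u\<^sup>2) * u\<^sup>2)) (8 / (9 * sqrt 3 * pi) / a)"
proof -
  have "pi / (3 / 4 * pi) = (2 / sqrt 3)\<^sup>2" by (simp add: power_divide)
  hence "sqrt (pi / (3 / 4 * pi)) = 2 / sqrt 3" by (simp only: real_sqrt_abs) simp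
  hence "2 / (3 * a) * (sqrt (pi / (3 / 4 * pi)) / (2 * (3 / 4 * pi))) = 8 / (9 * sqrt 3 * pi) / a"
    using a by (simp add: field_simps)
  thus ?thesis
    using has_bochner_integral_mult_right[OF has_bochner_integral_gauss(2)[of "3 / 4 * pi"], of "2 / (3 * a)"] by simp
qed

definition rem_1it :: "real \<Rightarrow> real" where
  "rem_1it a = sqrt 2 * (8 / (9 * sqrt 3 * pi) / a + 1 / (sqrt 2 * pi * a) * (1 / sqrt 2))"

lemma has_integral_err1_bound:
  assumes a: "a > 0"
  shows "has_bochner_integral lborel
     (\<lambda>u. sqrt 2 * (2 / (3 * a) * (exp (- (3 / 4 * pi) * u\<^sup>2) * u\<^sup>2) + 1 / (sqrt 2 * pi * a) * exp (- (2 * pi) * u\<^sup>2)))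
     (rem_1it a)"
proof -
  have "sqrt (pi / (2 * pi)) = 1 / sqrt 2" by (simp add: real_sqrt_divide)
  hence "has_bochner_integral lborel (\<lambda>u. exp (- (2 * pi) * u\<^sup>2)) (1 / sqrt 2)"
    using has_bochner_integral_gauss(1)[of "2 * pi"] by simp
  thus ?thesis unfolding rem_1it_def
    by (intro has_bochner_integral_mult_right has_bochner_integral_add has_integral_err0_bound a)
qed

lemma RSI_saddle:
  fixes a t :: real
  assumes a: "a > 0" "a \<notin> \<int>" and t: "t = 2 * pi * a\<^sup>2"
  shows "norm (RSI a (\<i> * of_real t)) \<le> 1 / 2 + 8 / (9 * sqrt 3 * pi) / a"
    and "norm (RSI a (1 + \<i> * of_real t)) \<le> 1 / a * (1 / 2 + rem_1it a)"
proof -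
  define K where "K = exp (\<i> * of_real (pi * a\<^sup>2 - t * ln a))"
  have K: "norm K = 1" by (simp add: K_def)
  hence K0: "K \<noteq> 0" by auto
  define D where "D = (\<lambda>u. 2 * \<i> * sin (of_real pi * line a u))"
  have D_fold: "2 * \<i> * sin (of_real pi * line a u) = D u" for u by (simp add: D_def)
  have fac: "line a u powr (- (\<i> * of_real t)) * exp (of_real pi * \<i> * (line a u)\<^sup>2) = K * of_real (exp (- 2 * pi * u\<^sup>2)) * exp (saddle_exp a u)" for u
    unfolding K_def by (rule saddle_factor[OF a(1) t])
  have e0: "(line a u powr (- (\<i> * of_real t)) * exp (of_real pi * \<i> * (line a u)\<^sup>2)) / D u = K * (saddle_main a u + saddle_err_it a u)" for u
    unfolding fac saddle_err_it_def saddle_main_def D_def by (simp add: algebra_simps diff_divide_distrib)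
  have e1: "(line a u powr (- (1 + \<i> * of_real t)) * exp (of_real pi * \<i> * (line a u)\<^sup>2)) / D u = K / of_real a * (saddle_main a u + saddle_err_1it a u)" for u
  proof -
    have l: "line a u = of_real a * line 1 (u / a)" using a by (simp add: line_def algebra_simps)
    have "line a u powr (- (1 + \<i> * of_real t)) = line a u powr (- (\<i> * of_real t)) / line a u"
    proof -
      have "- (1 + \<i> * of_real t) = - (\<i> * of_real t) - 1" by simp
      thus ?thesis using powr_diff[of "line a u" "- (\<i> * of_real t)" 1] line_nonzero[OF a(1), of u] by (simp only:) simp
    qed
    hence "(line a u powr (- (1 + \<i> * of_real t)) * exp (of_real pi * \<i> * (line a u)\<^sup>2)) / D u =
      (line a u powr (- (\<i> * of_real t)) * exp (of_real pi * \<i> * (line a u)\<^sup>2)) / D u / line a u" by simp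
    also have "\<dots> = K / of_real a * (of_real (exp (- 2 * pi * u\<^sup>2)) / D u) * (exp (saddle_exp a u) / line 1 (u / a))"
      unfolding fac by (simp add: l)
    also have "\<dots> = K / of_real a * (saddle_main a u * (exp (saddle_exp a u) / line 1 (u / a)))"
      unfolding saddle_main_def D_def by (rule mult.assoc)
    also have "saddle_main a u * (exp (saddle_exp a u) / line 1 (u / a)) = saddle_main a u + saddle_err_1it a u"
      unfolding saddle_err_1it_def right_diff_distrib by simp
    finally show ?thesis .
  qed
  have int: "integrable lborel (\<lambda>u. (line a u powr (- w) * exp (of_real pi * \<i> * (line a u)\<^sup>2)) / D u)" for w
    unfolding D_def using a
    by (intro csc_line_gauss[OF a(2) _ continuous_RSI_num RSI_num_dom[OF a(1) order.refl order.refl order.refl]]) auto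
  have M: "integrable lborel (saddle_main a)" by (rule integrable_saddle_main[OF a(2)])
  \<comment> \<open>The error is integrable as the difference of the full integrand, freed from its
    phase \<open>K\<close>, and \<open>saddle_main\<close>.\<close>
  have I0: "integrable lborel (saddle_err_it a)"
  proof -
    have "saddle_err_it a = (\<lambda>u. 1 / K * ((line a u powr (- (\<i> * of_real t)) * exp (of_real pi * \<i> * (line a u)\<^sup>2)) / D u) - saddle_main a u)"
      unfolding e0 using K0 by (rule_tac ext) simp
    thus ?thesis by (simp only:) (intro Bochner_Integration.integrable_diff integrable_mult_right int M)
  qed
  have I1: "integrable lborel (saddle_err_1it a)"
  proof -
    have "saddle_err_1it a = (\<lambda>u. of_real a / K * ((line a u powr (- (1 + \<i> * of_real t)) * exp (of_real pi * \<i> * (line a u)\<^sup>2)) / D u) - saddle_main a u)"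
      unfolding e1 using K0 a by (rule_tac ext) simp
    thus ?thesis by (simp only:) (intro Bochner_Integration.integrable_diff integrable_mult_right int M)
  qed
  have B0: "norm (LBINT u. saddle_err_it a u) \<le> 8 / (9 * sqrt 3 * pi) / a"
    using Bochner_Integration.integral_norm_bound_integral[OF I0 integrable.intros[OF has_integral_err0_bound[OF a(1)]] norm_saddle_err_it_le[OF a(1)]]
    unfolding has_bochner_integral_integral_eq[OF has_integral_err0_bound[OF a(1)]] .
  have B1: "norm (LBINT u. saddle_err_1it a u) \<le> rem_1it a"
    using Bochner_Integration.integral_norm_bound_integral[OF I1 integrable.intros[OF has_integral_err1_bound[OF a(1)]] norm_saddle_err_1it_le[OF a(1)]]
    unfolding has_bochner_integral_integral_eq[OF has_integral_err1_bound[OF a(1)]] .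
  have "RSI a (\<i> * of_real t) = - \<omega> * (K * ((LBINT u. saddle_main a u) + (LBINT u. saddle_err_it a u)))"
    unfolding RSI_def line_integral_def D_fold e0
    by (simp only: integral_mult_right_zero Bochner_Integration.integral_add[OF M I0] mult_minus_left)
  hence "norm (RSI a (\<i> * of_real t)) = norm ((LBINT u. saddle_main a u) + (LBINT u. saddle_err_it a u))"
    by (simp add: norm_mult K)
  also have "\<dots> \<le> 1 / 2 + 8 / (9 * sqrt 3 * pi) / a"
    by (intro order.trans[OF norm_triangle_ineq] add_mono saddle_main_bound a B0)
  finally show "norm (RSI a (\<i> * of_real t)) \<le> 1 / 2 + 8 / (9 * sqrt 3 * pi) / a" .
  have "RSI a (1 + \<i> * of_real t) = - \<omega> * (K / of_real a * ((LBINT u. saddle_main a u) + (LBINT u. saddle_err_1it a u)))"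
    unfolding RSI_def line_integral_def D_fold e1
    by (simp only: integral_mult_right_zero Bochner_Integration.integral_add[OF M I1] mult_minus_left)
  hence "norm (RSI a (1 + \<i> * of_real t)) = 1 / a * norm ((LBINT u. saddle_main a u) + (LBINT u. saddle_err_1it a u))"
    using a by (simp add: norm_mult norm_divide K)
  also have "\<dots> \<le> 1 / a * (1 / 2 + rem_1it a)"
    using a by (intro mult_left_mono order.trans[OF norm_triangle_ineq] add_mono saddle_main_bound B1) auto
  finally show "norm (RSI a (1 + \<i> * of_real t)) \<le> 1 / a * (1 / 2 + rem_1it a)" .
qed

text \<open>The right-hand side of the theorem with the length \<open>N\<close> of the sums freed
  from \<open>t\<close>, so that it is continuous in \<open>t\<close> for fixed
  \<open>N\<close>.\<close>

definition main_bound :: "nat \<Rightarrow> real \<Rightarrow> real" where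
  "main_bound N t = norm (\<Sum>n = 1..N. 1 / (of_nat n :: complex) powr (1 + \<i> * of_real t))
         + g t / t powr (1/2) * norm (\<Sum>n = 1..N. 1 / (of_nat n :: complex) powr (- (\<i> * of_real t)))
         + R t"

text \<open>The leading terms agree exactly, because
  \<open>1 / (2 * a) = sqrt (pi / 2) / sqrt t\<close>. The rest is of order
  \<open>1 / a\<^sup>2\<close> and is compared with the coefficient of \<open>1 / t\<close>, by one
  numerical inequality for each of its two parts: \<open>q\<close> for the part without
  \<open>g\<close>, \<open>erS\<close> for the part with it.\<close>

lemma remainder_le_R:
  fixes a t :: real
  assumes a: "a > 0" and t: "t = 2 * pi * a\<^sup>2"
  shows "1 / a * (1 / 2 + rem_1it a)
     + g t / t powr (1 / 2) * (1 / 2 + 8 / (9 * sqrt 3 * pi) / a) \<le> R t"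
proof -
  have t0: "t > 0" using a by (simp add: t)
  have gp: "g t > 0" by (simp add: g_def)
  define r where "r = sqrt (2 * pi)"
  have r: "r > 0" "r * r = 2 * pi" by (auto simp: r_def)
  have st: "t powr (1 / 2) = r * a"
    using a t0 by (simp add: powr_half_sqrt t r_def real_sqrt_mult)
  have tt: "t = (r * a) * (r * a)" using r by (simp add: t power2_eq_square)
  have sp: "sqrt (pi / 2) = r / 2"
  proof -
    have "pi / 2 = (r / 2)\<^sup>2" using r by (simp add: power2_eq_square field_simps)
    moreover have "sqrt ((r / 2)\<^sup>2) = r / 2" using r by (intro real_sqrt_unique) auto
    ultimately show ?thesis by (simp only:)
  qed
  have r3: "r \<le> 3" unfolding r_def by (rule real_le_lsqrt) (use pi_less_4 in auto)
  define e where "e = 8 / (9 * sqrt 3 * pi)"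
  define q where "q = sqrt 2 * (e + 1 / (2 * pi))"
  define S where "S = sqrt (pi * (3 - 2 * ln 2))"
  have ln2: "3 - 2 * ln 2 \<le> (5 / 3 :: real)" "3 - 2 * ln 2 > (0 :: real)"
    using ln2_ge_two_thirds ln2_le_25_over_36 by simp_all
  have S: "S > 0" using ln2(2) by (simp add: S_def)
  have e: "e \<ge> 0" "e \<le> 8 / 27"
  proof -
    have "9 * 1 * 3 \<le> 9 * sqrt 3 * pi" using pi_gt3 by (intro mult_mono) auto
    thus "e \<le> 8 / 27" unfolding e_def by (intro divide_left_mono) auto
  qed (simp add: e_def)
  have "q \<le> 3 / 2 * (8 / 27 + 1 / 6)" unfolding q_def
  proof (intro mult_mono add_mono e)
    show "sqrt 2 \<le> 3 / (2 :: real)" by (rule real_le_lsqrt) (auto simp: power2_eq_square)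
    show "1 / (2 * pi) \<le> 1 / 6" using pi_gt3 by (intro divide_left_mono) auto
  qed (use e in auto)
  also have "\<dots> \<le> 9 / (2 * 3)" by simp
  also have "\<dots> \<le> 9 / (2 * r)" using r r3 by (intro divide_left_mono) auto
  finally have q: "q \<le> 9 / (2 * r)" .
  \<comment> \<open>After squaring, \<open>pi\<close> cancels and the claim becomes
    \<open>128 / 243 * (3 - 2 * ln 2) \<le> 1\<close>.\<close>
  have erS: "e * r * S \<le> 1"
  proof (rule power2_le_imp_le)
    have "(e * r * S)\<^sup>2 = e\<^sup>2 * (r * r) * (pi * (3 - 2 * ln 2))"
      using ln2(2) by (simp add: power_mult_distrib S_def power2_eq_square[of r])
    also have "\<dots> = 128 / 243 * (3 - 2 * ln 2)"
      unfolding r(2) e_def by (simp add: power_divide power_mult_distrib) (simp add: power2_eq_square field_simps)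
    also have "\<dots> \<le> 128 / 243 * (5 / 3)" by (intro mult_left_mono ln2) auto
    also have "\<dots> \<le> 1\<^sup>2" by simp
    finally show "(e * r * S)\<^sup>2 \<le> 1\<^sup>2" .
  qed simp
  have "1 / a * (1 / 2 + sqrt 2 * (e / a + 1 / (sqrt 2 * pi * a) * (1 / sqrt 2))) + g t / (r * a) * (1 / 2 + e / a)
      = 1 / (r * a) * (r / 2 + g t / 2) + 1 / ((r * a) * (r * a)) * (r * r * q + g t * (e * r))"
  proof -
    have "sqrt 2 * (e / a + 1 / (sqrt 2 * pi * a) * (1 / sqrt 2)) = q / a"
      using a by (simp add: q_def field_simps)
    hence "1 / a * (1 / 2 + sqrt 2 * (e / a + 1 / (sqrt 2 * pi * a) * (1 / sqrt 2))) = 1 / a * (1 / 2 + q / a)" by (simp only:)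
    thus ?thesis using a r(1) by (simp only:) (simp add: field_simps)
  qed
  also have "\<dots> \<le> 1 / (r * a) * (r / 2 + g t / 2) + 1 / ((r * a) * (r * a)) * (9 * (r / 2) + g t / S)"
  proof (intro add_left_mono mult_left_mono add_mono)
    have "r * r * q \<le> r * r * (9 / (2 * r))" using q by (intro mult_left_mono) auto
    thus "r * r * q \<le> 9 * (r / 2)" using r(1) by simp
    have "e * r \<le> 1 / S" using erS S by (simp add: pos_le_divide_eq)
    hence "g t * (e * r) \<le> g t * (1 / S)" using gp by (intro mult_left_mono) auto
    thus "g t * (e * r) \<le> g t / S" by simp
    show "0 \<le> 1 / ((r * a) * (r * a))" using a r by simp
  qed
  also have "\<dots> \<le> \<dots> + 1 / t powr (3/2) * ((968 * pi powr (3/2) + 242 * pi * g t) / 700)"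
    using gp t0 by (simp add: add_nonneg_nonneg)
  also have "\<dots> = R t" unfolding R_def st sp S_def[symmetric] tt[symmetric] ..
  finally show ?thesis unfolding st e_def rem_1it_def .
qed

lemma zeta_bound_nonint:
  assumes t: "t > 0" and a: "sqrt (t / (2 * pi)) \<notin> \<int>"
  shows "norm (zeta (1 + \<i> * of_real t)) \<le> main_bound (n1 t) t"
proof -
  define a where "a = sqrt (t / (2 * pi))"
  have a: "a > 0" "a \<notin> \<int>" and ta: "t = 2 * pi * a\<^sup>2" using t assms(2) by (auto simp: a_def)
  let ?A = "norm (\<Sum>n = 1..nat \<lfloor>a\<rfloor>. 1 / (of_nat n :: complex) powr (1 + \<i> * of_real t))"
  let ?B = "norm (\<Sum>n = 1..nat \<lfloor>a\<rfloor>. 1 / (of_nat n :: complex) powr (- (\<i> * of_real t)))"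
  let ?x = "1 / a * (1 / 2 + rem_1it a)"
  let ?y = "1 / 2 + 8 / (9 * sqrt 3 * pi) / a"
  let ?c = "g t / t powr (1 / 2)"
  have c0: "?c \<ge> 0" using t by (simp add: g_def)
  have "norm (zeta (1 + \<i> * of_real t)) \<le> ?A + norm (RSI a (1 + \<i> * of_real t)) + norm (chi (1 + \<i> * of_real t)) * (?B + norm (RSI a (\<i> * of_real t)))"
    using t by (intro norm_zeta_one_line_le a) auto
  also have "\<dots> \<le> ?A + ?x + ?c * (?B + ?y)"
    by (intro add_mono mult_mono RSI_saddle a ta norm_chi_le t order.refl c0 add_nonneg_nonneg norm_ge_zero)
  also have "\<dots> = ?A + ?c * ?B + (?x + ?c * ?y)" by (simp only: distrib_left add_ac)
  also have "?x + ?c * ?y \<le> R t" by (rule remainder_le_R[OF a(1) ta])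
  finally show ?thesis by (simp add: main_bound_def n1_def a_def)
qed

lemma main_bound_tendsto:
  assumes t: "t > 0"
  shows "(main_bound N \<longlongrightarrow> main_bound N t) (at_right t)"
proof -
  have t': "t \<noteq> 0" "t\<^sup>2 \<noteq> 0" using t by auto
  have pow: "((\<lambda>x. of_nat n powr f x) \<longlongrightarrow> of_nat n powr f t) (at_right t)"
    if "n \<in> {1..N}" "(f \<longlongrightarrow> f t) (at_right t)" for n and f :: "real \<Rightarrow> complex"
  proof -
    have eq: "(of_nat n :: complex) powr z = exp (z * Ln (of_nat n))" for z using that by (simp add: powr_def)
    show ?thesis unfolding eq by (intro tendsto_intros that)
  qed
  have nz: "(of_nat n :: complex) powr z \<noteq> 0" if "n \<in> {1..N}" for n z using that by simp
  have sum1: "((\<lambda>x. \<Sum>n = 1..N. 1 / (of_nat n :: complex) powr (1 + \<i> * of_real x)) \<longlongrightarrow> (\<Sum>n = 1..N. 1 / (of_nat n :: complex) powr (1 + \<i> * of_real t))) (at_right t)"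
    by (rule tendsto_sum, rule tendsto_divide[OF tendsto_const pow nz]) (assumption | intro tendsto_intros)+
  have sum2: "((\<lambda>x. \<Sum>n = 1..N. 1 / (of_nat n :: complex) powr (- (\<i> * of_real x))) \<longlongrightarrow> (\<Sum>n = 1..N. 1 / (of_nat n :: complex) powr (- (\<i> * of_real t)))) (at_right t)"
    by (rule tendsto_sum, rule tendsto_divide[OF tendsto_const pow nz]) (assumption | intro tendsto_intros)+
  have P: "((\<lambda>x. x powr c) \<longlongrightarrow> t powr c) (at_right t)" for c
    by (rule tendsto_powr[OF tendsto_ident_at tendsto_const t'(1)])
  have P0: "t powr c \<noteq> 0" for c using t by simp
  have G: "(g \<longlongrightarrow> g t) (at_right t)"
    unfolding g_def[abs_def] using t' by (intro tendsto_intros) auto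
  have S: "sqrt (pi * (3 - 2 * ln 2)) \<noteq> 0" using ln2_le_25_over_36 by simp
  have Rt: "(R \<longlongrightarrow> R t) (at_right t)"
    unfolding R_def[abs_def] by (intro tendsto_intros G P P0 S t') auto
  show ?thesis
    unfolding main_bound_def[abs_def]
    by (rule tendsto_add[OF tendsto_add[OF tendsto_norm[OF sum1] tendsto_mult[OF tendsto_divide[OF G P P0] tendsto_norm[OF sum2]]] Rt])
qed

theorem theorem3p6:
  fixes t :: real
  assumes "t > 0"
  shows "norm (zeta (1 + \<i> * of_real t))
       \<le> norm (\<Sum>n = 1..n1 t. 1 / (of_nat n :: complex) powr (1 + \<i> * of_real t))
         + g t / t powr (1/2) * norm (\<Sum>n = 1..n1 t. 1 / (of_nat n :: complex) powr (- (\<i> * of_real t)))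
         + R t"
proof -
  define N where "N = \<lfloor>sqrt (t / (2 * pi))\<rfloor>"
  \<comment> \<open>The next value at which the saddle point is an integer. Strictly between
    \<open>t\<close> and \<open>T\<close> the floor stays \<open>N\<close> and the saddle point is
    no integer, even if it is one at \<open>t\<close> itself.\<close>
  define T where "T = 2 * pi * (of_int N + 1)\<^sup>2"
  have N0: "N \<ge> 0" using assms by (simp add: N_def)
  have a0: "of_int N \<le> sqrt (t / (2 * pi))" "sqrt (t / (2 * pi)) < of_int N + 1"
    by (simp_all add: N_def)
  have "t / (2 * pi) < (of_int N + 1)\<^sup>2"
  proof -
    have "(sqrt (t / (2 * pi)))\<^sup>2 < (of_int N + 1)\<^sup>2"
      by (rule power_strict_mono[OF a0(2)]) (use assms in auto)
    moreover have "(sqrt (t / (2 * pi)))\<^sup>2 = t / (2 * pi)" using assms by (intro real_sqrt_pow2) simp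
    ultimately show ?thesis by (simp only:)
  qed
  hence "t < (of_int N + 1)\<^sup>2 * (2 * pi)" by (rule pos_divide_less_eq[THEN iffD1, rotated]) simp
  hence tT: "t < T" by (simp add: T_def mult.commute)
  have bd: "norm (zeta (1 + \<i> * of_real x)) \<le> main_bound (n1 t) x" if x: "t < x" "x < T" for x
  proof -
    have "of_int N < sqrt (x / (2 * pi))"
      using a0(1) x(1) by (rule le_less_trans[OF _ real_sqrt_less_mono[OF divide_strict_right_mono]]) auto
    moreover have "sqrt (x / (2 * pi)) < sqrt ((of_int N + 1)\<^sup>2)"
    proof (rule real_sqrt_less_mono)
      have "x < (of_int N + 1)\<^sup>2 * (2 * pi)" using x(2) by (simp add: T_def mult.commute)
      thus "x / (2 * pi) < (of_int N + 1)\<^sup>2" by (rule pos_divide_less_eq[THEN iffD2, rotated]) simp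
    qed
    hence "sqrt (x / (2 * pi)) < of_int N + 1" using N0 by simp
    ultimately have xN: "of_int N < sqrt (x / (2 * pi))" "sqrt (x / (2 * pi)) < of_int N + 1" by auto
    hence fl: "\<lfloor>sqrt (x / (2 * pi))\<rfloor> = N" by (intro floor_unique) auto
    have "sqrt (x / (2 * pi)) \<notin> \<int>"
    proof
      assume "sqrt (x / (2 * pi)) \<in> \<int>"
      then obtain k :: int where k: "sqrt (x / (2 * pi)) = of_int k" by (auto elim: Ints_cases)
      with xN have "N < k" "k < N + 1" by linarith+
      thus False by linarith
    qed
    hence "norm (zeta (1 + \<i> * of_real x)) \<le> main_bound (n1 x) x"
      using assms x by (intro zeta_bound_nonint) auto
    thus ?thesis unfolding n1_def fl N_def .
  qed
  have ev: "eventually (\<lambda>x. norm (zeta (1 + \<i> * of_real x)) \<le> main_bound (n1 t) x) (at_right t)"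
    using eventually_at_right_less[of t] eventually_at_right_field[of "\<lambda>x. x < T" t] tT bd
    by (auto simp: eventually_at_right_field)
  have "zeta holomorphic_on - {1}"
    using is_zeta_continuation_zeta by (simp add: is_zeta_continuation_def)
  hence "continuous_on (- {1}) zeta" by (rule holomorphic_on_imp_continuous_on)
  moreover have "1 + \<i> * of_real t \<in> - {1}" using assms by simp
  ultimately have "isCont zeta (1 + \<i> * of_real t)"
    using continuous_on_eq_continuous_at[of "- {1}" zeta] by (auto simp: open_Compl)
  moreover have "((\<lambda>x. 1 + \<i> * complex_of_real x) \<longlongrightarrow> 1 + \<i> * of_real t) (at_right t)"
    by (intro tendsto_intros)
  ultimately have "((\<lambda>x. norm (zeta (1 + \<i> * of_real x))) \<longlongrightarrow> norm (zeta (1 + \<i> * of_real t))) (at_right t)"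
    by (intro tendsto_norm isCont_tendsto_compose[of _ zeta])
  \<comment> \<open>Both sides converge from the right to their values at \<open>t\<close>, with the
    number of terms held at \<open>n1 t\<close>.\<close>
  from tendsto_le[OF trivial_limit_at_right_real main_bound_tendsto[OF assms] this ev]
  show ?thesis by (simp add: main_bound_def)
qed

end
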